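(* Let $N,K,T\ge 1$ and $2\le P\le M$ be integers with $T+K\le N$ and $P\ge\frac{M}{2}$. Then, for every sufficiently large prime power $q$ and every generator matrix $\mathbf{G}\in\mathbb{F}_q^{K\times N}$ of an $(N,K)$-MDS code, there exist a positive integer $L$ and an $(N,K,T;M)$ $P$-file PIR scheme, for $M$ files in $\mathbb{F}_q^{L\times K}$ stored via $\mathbf{G}$, with rate $$\frac{\binom{N}{K}}{\frac{M}{P}\left(\binom{N}{K}-\binom{N-T}{K}\right)+\binom{N-T}{K}}.$$ Moreover, when either $K=1$ or $T=1$, this rate is optimal, i.e. it equals the multi-file PIR capacity $C^P$.
   Context: Storage. There are $N$ servers and $M$ files $W^{[1]},\dots,W^{[M]}\in\mathbb{F}_q^{L\times K}$, independent and uniformly distributed (entropies are in $q$-ary units, so $H(W^{[i]})=LK$ and $H(W^{[1]},\dots,W^{[M]})=MLK$). Let $\mathbf{G}=[\mathbf{g}_1\ \cdots\ \mathbf{g}_N]\in\mathbb{F}_q^{K\times N}$ have the MDS property: any $K$ columns are linearly independent. Server $n$ stores $\mathbf{y}_n=(W^{[1]}\mathbf{g}_n,\dots,W^{[M]}\mathbf{g}_n)\in\mathbb{F}_q^{ML}$. $(N,K,T;M)$ $P$-file PIR scheme. The user wants to retrieve simultaneously the files $W^{[\mathcal{P}]}=\{W^{[i]}:i\in\mathcal{P}\}$ for an arbitrary $\mathcal{P}\subseteq\{1,\dots,M\}$ with $|\mathcal{P}|=P$. There is a random variable $\mathcal{F}$ (the user's randomness for generating queries, unknown to the servers) and a random variable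 $\mathcal{G}$ (the servers' randomness for producing feedbacks, also known to the user; it may be deterministic); $\mathcal{F},\mathcal{G},\mathcal{P},W^{[1]},\dots,W^{[M]}$ are mutually independent. Using $\mathcal F$, the user generates queries $Q^{[\mathcal{P}]}_1,\dots,Q^{[\mathcal{P}]}_N$, with $Q^{[\mathcal{P}]}_n$ sent to server $n$, such that $I(Q^{[\mathcal{P}]}_1,\dots,Q^{[\mathcal{P}]}_N;W^{[1]},\dots,W^{[M]})=0$. The feedback $A^{[\mathcal{P}]}_n$ of server $n$ is a deterministic function of $Q^{[\mathcal{P}]}_n,\mathcal{G},\mathbf{y}_n$. The requirements are: - Correctness: $H(W^{[\mathcal{P}]}\mid Q^{[\mathcal{P}]}_1,\dots,Q^{[\mathcal{P}]}_N,A^{[\mathcal{P}]}_1,\dots,A^{[\mathcal{P}]}_N,\mathcal{F},\mathcal{G})=0$. - Privacy: for every $\mathcal{T}\subseteq\{1,\dots,N\}$ with $|\mathcal{T}|=T$, $I(\mathcal{P};Q^{[\mathcal{P}]}_{\mathcal{T}})=I(\mathcal{P};A^{[\mathcal{P}]}_{\mathcal{T}})=0$, where $Q^{[\mathcal{P}]}_{\mathcal{T}}=\{Q^{[\mathcal{P}]}_n:n\in\mathcal{T}\}$ and $A^{[\mathcal{P}]}_{\mathcal{T}}=\{A^{[\mathcal{P}]}_n:n\in\mathcal{T}\}$. Rate: $\sum_{i\in\mathcal{P}}H(W^{[i]})\big/\sum_{n=1}^N H(A^{[\mathcal{P}]}_n)$. The multi-file PIR capacity $C^P$ is the supremum of the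 rates of all such schemes (over all $L$). *)

theory Defs
  imports
    "HOL-Algebra.Ring"
    "HOL-Number_Theory.Prime_Powers"
    "HOL-Probability.Information"
begin

definition mds_generator ::
    "('a, 'b) ring_scheme \<Rightarrow> nat \<Rightarrow> nat \<Rightarrow> (nat \<Rightarrow> nat \<Rightarrow> 'a) \<Rightarrow> bool" where
  "mds_generator R K N gen \<longleftrightarrow>
     (\<forall>k\<in>{1..K}. \<forall>n\<in>{1..N}. gen k n \<in> carrier R) \<and>
     (\<forall>S. S \<subseteq> {1..N} \<and> card S = K \<longrightarrow>
        (\<forall>c\<in>S \<rightarrow> carrier R.
           (\<forall>k\<in>{1..K}. (\<Oplus>\<^bsub>R\<^esub>n\<in>S. c n \<otimes>\<^bsub>R\<^esub> gen k n) = \<zero>\<^bsub>R\<^esub>) \<longrightarrow>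
           (\<forall>n\<in>S. c n = \<zero>\<^bsub>R\<^esub>)))"

text \<open>The mutually independent sources of randomness; file \<open>i\<close> is \<open>File i\<close>.\<close>

datatype source = User | Server | Demand | File nat

text \<open>
  \<^item> \<open>M\<close> is the underlying probability space and \<open>m\<close> the number of files.
  \<^item> \<open>W i \<omega>\<close> is the \<open>L\<close> by \<open>K\<close> matrix of file \<open>i\<close>, a function of the index pair \<open>(l, k)\<close>;
    \<open>gen k n\<close> is entry \<open>(k, n)\<close> of the generator matrix.
  \<^item> \<open>usr\<close> and \<open>srv\<close> are the randomness of the user and of the servers, \<open>dem\<close> is the
    random set of demanded files.
  \<^item> \<open>query p n f\<close> is the query sent to server \<open>n\<close> when the set \<open>p\<close> is demanded and the
    user's randomness takes the value \<open>f\<close>.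
  \<^item> \<open>answer n x g y\<close> is the feedback of server \<open>n\<close> to the query \<open>x\<close> when the servers'
    randomness takes the value \<open>g\<close> and \<open>y\<close> is stored. Servers do not know the demand, so
    this function does not depend on it.
\<close>

locale pir_model =
  field R + information_space M b for R :: "('a, 'c) ring_scheme" (structure) and M :: "'w measure" and b +
  fixes N K T m P L :: nat
    and gen :: "nat \<Rightarrow> nat \<Rightarrow> 'a"
    and W :: "nat \<Rightarrow> 'w \<Rightarrow> nat \<times> nat \<Rightarrow> 'a"
    and usr :: "'w \<Rightarrow> 'f"
    and srv :: "'w \<Rightarrow> 'g"
    and dem :: "'w \<Rightarrow> nat set"
    and query :: "nat set \<Rightarrow> nat \<Rightarrow> 'f \<Rightarrow> 'x"
    and answer :: "nat \<Rightarrow> 'x \<Rightarrow> 'g \<Rightarrow> (nat \<Rightarrow> nat \<Rightarrow> 'a) \<Rightarrow> 'y"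
begin

definition files :: "(nat \<times> nat \<Rightarrow> 'a) set" where
  "files = {1..L} \<times> {1..K} \<rightarrow>\<^sub>E carrier R"

definition demands :: "nat set set" where
  "demands = {p. p \<subseteq> {1..m} \<and> card p = P}"

definition stored :: "nat \<Rightarrow> 'w \<Rightarrow> nat \<Rightarrow> nat \<Rightarrow> 'a" where
  "stored n \<omega> = (\<lambda>i\<in>{1..m}. \<lambda>l\<in>{1..L}. \<Oplus>k\<in>{1..K}. W i \<omega> (l, k) \<otimes> gen k n)"

definition Q :: "nat set \<Rightarrow> nat \<Rightarrow> 'w \<Rightarrow> 'x" where
  "Q p n \<omega> = query p n (usr \<omega>)"

definition A :: "nat set \<Rightarrow> nat \<Rightarrow> 'w \<Rightarrow> 'y" where
  "A p n \<omega> = answer n (Q p n \<omega>) (srv \<omega>) (stored n \<omega>)"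

fun source_events :: "source \<Rightarrow> 'w set set" where
  "source_events User = {usr -` X \<inter> space M | X. True}"
| "source_events Server = {srv -` X \<inter> space M | X. True}"
| "source_events Demand = {dem -` X \<inter> space M | X. True}"
| "source_events (File i) = {W i -` X \<inter> space M | X. True}"

definition rate :: "nat set \<Rightarrow> real" where
  "rate p = (\<Sum>i\<in>p. \<H>(W i)) / (\<Sum>n\<in>{1..N}. \<H>(A p n))"

end

text \<open>
  The condition \<open>demand_full\<close> expresses that every set of \<open>P\<close> files may be demanded:
  the privacy conditions would be void for a deterministic demand. In the privacy
  conditions the queries and answers are those for the random demand, \<open>Q (dem \<omega>) n \<omega>\<close> and
  \<open>A (dem \<omega>) n \<omega>\<close>; the other conditions hold for each fixed demand.
\<close>

locale pir_scheme = pir_model +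
  assumes base: "b = real (card (carrier R))"
    and usr_simple: "simple_function M usr"
    and srv_simple: "simple_function M srv"
    and demand_rv: "random_variable (count_space demands) dem"
    and demand_full: "\<And>p. p \<in> demands \<Longrightarrow> prob {\<omega> \<in> space M. dem \<omega> = p} > 0"
    and file_rv: "\<And>i. i \<in> {1..m} \<Longrightarrow> random_variable (count_space files) (W i)"
    and file_uniform:
      "\<And>i. i \<in> {1..m} \<Longrightarrow> distr M (count_space files) (W i) = uniform_count_measure files"
    and independent: "indep_sets source_events ({User, Server, Demand} \<union> File ` {1..m})"
    and query_indep: "\<And>p. p \<in> demands \<Longrightarrow>
      \<I>((\<lambda>\<omega>. \<lambda>n\<in>{1..N}. Q p n \<omega>) ; (\<lambda>\<omega>. \<lambda>i\<in>{1..m}. W i \<omega>)) = 0"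
    and correctness: "\<And>p. p \<in> demands \<Longrightarrow>
      \<H>((\<lambda>\<omega>. \<lambda>i\<in>p. W i \<omega>) |
        (\<lambda>\<omega>. (\<lambda>n\<in>{1..N}. Q p n \<omega>, \<lambda>n\<in>{1..N}. A p n \<omega>, usr \<omega>, srv \<omega>))) = 0"
    and query_privacy: "\<And>S. S \<subseteq> {1..N} \<Longrightarrow> card S = T \<Longrightarrow>
      \<I>(dem ; (\<lambda>\<omega>. \<lambda>n\<in>S. Q (dem \<omega>) n \<omega>)) = 0"
    and answer_privacy: "\<And>S. S \<subseteq> {1..N} \<Longrightarrow> card S = T \<Longrightarrow>
      \<I>(dem ; (\<lambda>\<omega>. \<lambda>n\<in>S. A (dem \<omega>) n \<omega>)) = 0"

text \<open>
  There is a scheme of rate \<open>r\<close> with \<open>L\<close> rows per file; from here on, \<open>M\<close> is the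
  number of files. All random variables of a scheme
  take finitely many values, so using \<open>nat\<close> for the sample space and for the alphabets
  loses no generality.
\<close>

definition pir_achieves ::
    "'a ring \<Rightarrow> nat \<Rightarrow> nat \<Rightarrow> nat \<Rightarrow> nat \<Rightarrow> nat \<Rightarrow> (nat \<Rightarrow> nat \<Rightarrow> 'a) \<Rightarrow> nat \<Rightarrow> real \<Rightarrow> bool" where
  "pir_achieves R N K T M P gen L r \<longleftrightarrow>
     (\<exists>(\<Omega> :: nat measure) W (usr :: nat \<Rightarrow> nat) (srv :: nat \<Rightarrow> nat) dem
        (query :: nat set \<Rightarrow> nat \<Rightarrow> nat \<Rightarrow> nat)
        (answer :: nat \<Rightarrow> nat \<Rightarrow> nat \<Rightarrow> (nat \<Rightarrow> nat \<Rightarrow> 'a) \<Rightarrow> nat).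
        pir_scheme R \<Omega> (real (card (carrier R))) N K T M P L gen W usr srv dem query answer \<and>
        (\<forall>p\<in>pir_model.demands M P.
           pir_model.rate R \<Omega> (real (card (carrier R))) N K M L gen W usr srv query answer p = r))"

definition pir_capacity ::
    "'a ring \<Rightarrow> nat \<Rightarrow> nat \<Rightarrow> nat \<Rightarrow> nat \<Rightarrow> nat \<Rightarrow> (nat \<Rightarrow> nat \<Rightarrow> 'a) \<Rightarrow> real" where
  "pir_capacity R N K T M P gen = Sup {r. \<exists>L\<ge>1. pir_achieves R N K T M P gen L r}"

end

(*
Upper bound. Let p and p' be two demands that together cover all files; they exist because
P >= M/2. The answers to p determine W_p, so the download is at least P L K plus the entropy of the
answers given W_p and all randomness. For a set S of T servers privacy allows one to replace the
answers to p by those to p'. If K = 1, Han's inequality passes from the sets S to all servers; if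
T = 1, one does so for single servers and uses that any K stored vectors are independent. The
answers to p' determine the remaining files, which contributes (M - P) L K T K / N.

Scheme. Put a = binom(N, K) and r = a - binom(N-T, K). Every K-subset D of the servers carries a
symbols, so there are a^2 = L symbols per file. The symbols of a desired file are its L coordinates
in a random basis; those of an undesired file form a random codeword of an MDS code of dimension
a r. As T servers see only a r symbols, they cannot tell the two cases apart. For r of the a
symbols of D all M files are downloaded separately (up to an invertible matrix); they determine the
codewords of the undesired files. For the other symbols of D it suffices to download P
combinations, since the undesired contributions are known.
*)

theory Submission
  imports Defs "HOL-Number_Theory.Cong"
begin

section \<open>Entropy of simple functions\<close>

text \<open>One number, a r, plays three roles in the scheme: it is the number of symbols that
  \<open>T\<close> servers see (r of the a subsets D meet them, each with a symbols), the dimension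
  of the code, and the number of positions of the first stage. The first coincidence gives privacy,
  the second lets the first stage fix the codewords. Giving a symbols to each subset makes the
  required fraction r/a of them an integer. As every subset involves \<open>K\<close> servers, the
  rate is a P / (r M + (a - r) P). The upper bound has the factor T K / N in place of r/a; the two
  agree if \<open>K = 1\<close> or \<open>T = 1\<close>. The obstacle in the converse is that
  correctness wants all of the user's randomness as a condition, whereas privacy only concerns the
  law of the queries to \<open>T\<close> servers. The gap is closed by the independence of the
  user's randomness from the files and the servers' randomness. In the scheme, privacy is proved by
  comparing each demand with the reference demand of all files, which is admissible only if P = M. A
  pad known to the user makes the entropy of each answer immediate.\<close>

context prob_space
begin

lemma prob_comp_simple:
  assumes "simple_function M X"
  shows "prob ((\<lambda>\<omega>. h (X \<omega>)) -` {v} \<inter> space M) =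
    (\<Sum>x\<in>{x \<in> X ` space M. h x = v}. prob (X -` {x} \<inter> space M))"
proof -
  have "(\<lambda>\<omega>. h (X \<omega>)) -` {v} \<inter> space M = (\<Union>x\<in>{x \<in> X ` space M. h x = v}. X -` {x} \<inter> space M)"
    by auto
  also have "prob \<dots> = (\<Sum>x\<in>{x \<in> X ` space M. h x = v}. prob (X -` {x} \<inter> space M))"
    using assms by (intro finite_measure_finite_Union)
      (auto simp: simple_function_def disjoint_family_on_def)
  finally show ?thesis .
qed

lemma sum_prob_simple:
  assumes "simple_function M X"
  shows "(\<Sum>x\<in>X ` space M. prob (X -` {x} \<inter> space M)) = 1"
  using prob_comp_simple[OF assms, of "\<lambda>_. ()" "()"] by (simp add: prob_space)

lemma sum_transform_simple:
  fixes g :: "'b \<Rightarrow> real"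
  assumes "simple_function M X"
  shows "(\<Sum>x\<in>X ` space M. prob (X -` {x} \<inter> space M) * g (h x)) =
    (\<Sum>v\<in>(\<lambda>\<omega>. h (X \<omega>)) ` space M. prob ((\<lambda>\<omega>. h (X \<omega>)) -` {v} \<inter> space M) * g v)"
proof -
  have fin: "finite (X ` space M)"
    using assms by (simp add: simple_function_def)
  have "(\<Sum>x\<in>X ` space M. prob (X -` {x} \<inter> space M) * g (h x)) =
    (\<Sum>v\<in>h ` X ` space M. \<Sum>x\<in>{x \<in> X ` space M. h x = v}. prob (X -` {x} \<inter> space M) * g (h x))"
    by (rule sum.image_gen[OF fin])
  also have "\<dots> = (\<Sum>v\<in>h ` X ` space M. prob ((\<lambda>\<omega>. h (X \<omega>)) -` {v} \<inter> space M) * g v)"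
    by (intro sum.cong refl) (simp add: prob_comp_simple[OF assms] sum_distrib_right)
  also have "h ` X ` space M = (\<lambda>\<omega>. h (X \<omega>)) ` space M"
    by (auto simp: image_image)
  finally show ?thesis .
qed

lemma prob_comp_pos:
  assumes "simple_function M X" "\<omega> \<in> space M" "prob (X -` {X \<omega>} \<inter> space M) > 0"
  shows "prob ((\<lambda>\<omega>. h (X \<omega>)) -` {h (X \<omega>)} \<inter> space M) > 0"
proof -
  have "(\<lambda>\<omega>. h (X \<omega>)) -` {h (X \<omega>)} \<inter> space M \<in> events"
    using simple_functionD(2)[OF simple_function_compose[OF assms(1), of h], of "{h (X \<omega>)}"]
    by (simp add: comp_def)
  then have "prob (X -` {X \<omega>} \<inter> space M) \<le> prob ((\<lambda>\<omega>. h (X \<omega>)) -` {h (X \<omega>)} \<inter> space M)"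
    by (intro finite_measure_mono) auto
  then show ?thesis
    using assms(3) by linarith
qed

end

context information_space
begin

lemma simple_distributed_prob:
  "simple_function M X \<Longrightarrow> simple_distributed M X (\<lambda>x. prob (X -` {x} \<inter> space M))"
  by (rule simple_distributedI) (auto simp: measure_nonneg)

text \<open>Writes the entropy of any function of \<open>X\<close> as a sum over the range of
  \<open>X\<close> itself, so that the entropies of several marginals can be combined term by
  term.\<close>

lemma entropy_comp_eq:
  assumes "simple_function M X"
  shows "\<H>(\<lambda>\<omega>. h (X \<omega>)) = - (\<Sum>x\<in>X ` space M. prob (X -` {x} \<inter> space M) *
    log b (prob ((\<lambda>\<omega>. h (X \<omega>)) -` {h x} \<inter> space M)))"
proof -
  have "simple_function M (\<lambda>\<omega>. h (X \<omega>))"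
    using simple_function_compose[OF assms, of h] by (simp add: comp_def)
  from entropy_simple_distributed[OF simple_distributed_prob[OF this]] show ?thesis
    unfolding sum_transform_simple[OF assms, of "\<lambda>v. log b (prob ((\<lambda>\<omega>. h (X \<omega>)) -` {v} \<inter> space M))" h]
    by simp
qed

text \<open>Nonnegativity of the conditional mutual information of \<open>X\<close> and
  \<open>Y\<close> given \<open>Z\<close>, expanded into four entropies over the range of the
  triple.\<close>

lemma entropy_strong_subadditive:
  assumes X: "simple_function M X" and Y: "simple_function M Y" and Z: "simple_function M Z"
  shows "\<H>(\<lambda>\<omega>. (X \<omega>, Y \<omega>, Z \<omega>)) + \<H>(Z) \<le> \<H>(\<lambda>\<omega>. (X \<omega>, Z \<omega>)) + \<H>(\<lambda>\<omega>. (Y \<omega>, Z \<omega>))"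
proof -
  define V where "V = (\<lambda>\<omega>. (X \<omega>, Y \<omega>, Z \<omega>))"
  have V: "simple_function M V"
    unfolding V_def by (intro simple_function_Pair X Y Z)
  define pr where "pr = (\<lambda>x. prob (V -` {x} \<inter> space M))"
  define h1 where "h1 = (\<lambda>v :: 'b \<times> 'c \<times> 'd. (fst v, snd (snd v)))"
  define h2 where "h2 = (\<lambda>v :: 'b \<times> 'c \<times> 'd. (fst (snd v), snd (snd v)))"
  define h3 where "h3 = (\<lambda>v :: 'b \<times> 'c \<times> 'd. snd (snd v))"
  have e1: "(\<lambda>\<omega>. (X \<omega>, Z \<omega>)) = (\<lambda>\<omega>. h1 (V \<omega>))" and e2: "(\<lambda>\<omega>. (Y \<omega>, Z \<omega>)) = (\<lambda>\<omega>. h2 (V \<omega>))"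
    and e3: "Z = (\<lambda>\<omega>. h3 (V \<omega>))"
    by (simp_all add: V_def h1_def h2_def h3_def)
  define p1 where "p1 = (\<lambda>x. prob ((\<lambda>\<omega>. (X \<omega>, Z \<omega>)) -` {x} \<inter> space M))"
  define p2 where "p2 = (\<lambda>x. prob ((\<lambda>\<omega>. (Y \<omega>, Z \<omega>)) -` {x} \<inter> space M))"
  define p3 where "p3 = (\<lambda>x. prob (Z -` {x} \<inter> space M))"
  have d: "simple_distributed M Z p3" "simple_distributed M (\<lambda>\<omega>. (Y \<omega>, Z \<omega>)) p2"
    "simple_distributed M (\<lambda>\<omega>. (X \<omega>, Z \<omega>)) p1"
    "simple_distributed M (\<lambda>\<omega>. (X \<omega>, Y \<omega>, Z \<omega>)) pr"
    unfolding p1_def p2_def p3_def pr_def V_def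
    by (intro simple_distributed_prob simple_function_Pair X Y Z)+
  have "0 \<le> \<I>(X ; Y | Z)"
    using X Y Z by (rule conditional_mutual_information_nonneg)
  also have "\<I>(X ; Y | Z) = (\<Sum>v\<in>V ` space M. pr v * log b (pr v / (p1 (h1 v) * (p2 (h2 v) / p3 (h3 v)))))"
    unfolding conditional_mutual_information_eq[OF d]
    by (intro sum.cong) (auto simp: V_def h1_def h2_def h3_def)
  also have "\<dots> = (\<Sum>v\<in>V ` space M. pr v * log b (pr v) + pr v * log b (p3 (h3 v))
      - pr v * log b (p1 (h1 v)) - pr v * log b (p2 (h2 v)))"
  proof (intro sum.cong refl)
    fix v assume "v \<in> V ` space M"
    then obtain \<omega> where \<omega>: "\<omega> \<in> space M" "v = V \<omega>" by auto
    show "pr v * log b (pr v / (p1 (h1 v) * (p2 (h2 v) / p3 (h3 v)))) =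
      pr v * log b (pr v) + pr v * log b (p3 (h3 v)) - pr v * log b (p1 (h1 v)) - pr v * log b (p2 (h2 v))"
    \<comment> \<open>The logarithm of the quotient splits only where all factors are positive; a
      marginal is at least as large as the joint probability.\<close>
    proof (cases "pr v = 0")
      case False
      then have pos: "pr v > 0" by (simp add: pr_def zero_less_measure_iff)
      then have "p1 (h1 v) > 0" "p2 (h2 v) > 0" "p3 (h3 v) > 0"
        using prob_comp_pos[OF V \<omega>(1), of h1] prob_comp_pos[OF V \<omega>(1), of h2]
          prob_comp_pos[OF V \<omega>(1), of h3] \<omega>(2)
        unfolding p1_def p2_def p3_def pr_def e1[symmetric] e2[symmetric] e3[symmetric]
        by simp_all
      then show ?thesis
        using pos b_gt_1 by (simp add: log_mult log_divide algebra_simps)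
    qed simp
  qed
  also have "\<dots> = - \<H>(V) - \<H>(Z) + \<H>(\<lambda>\<omega>. (X \<omega>, Z \<omega>)) + \<H>(\<lambda>\<omega>. (Y \<omega>, Z \<omega>))"
    using entropy_comp_eq[OF V, of "\<lambda>v. v"] entropy_comp_eq[OF V, of h1] entropy_comp_eq[OF V, of h2]
      entropy_comp_eq[OF V, of h3]
    unfolding e1[symmetric] e2[symmetric] e3[symmetric]
    by (simp add: sum.distrib sum_subtractf pr_def p1_def p2_def p3_def)
  finally show ?thesis
    by (simp add: V_def)
qed

text \<open>Determinacy is stated on sample points, as equality of \<open>X\<close> forcing equality
  of \<open>Y\<close>. This spares every later use the explicit function that computes
  \<open>Y\<close> from \<open>X\<close>.\<close>

lemma entropy_mono:
  assumes X: "simple_function M X"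
    and det: "\<And>\<omega> \<omega>'. \<omega> \<in> space M \<Longrightarrow> \<omega>' \<in> space M \<Longrightarrow> X \<omega> = X \<omega>' \<Longrightarrow> Y \<omega> = Y \<omega>'"
  shows "\<H>(Y) \<le> \<H>(X)"
proof -
  define f where "f x = Y (SOME \<omega>. \<omega> \<in> space M \<and> X \<omega> = x)" for x
  have f: "f (X \<omega>) = Y \<omega>" if "\<omega> \<in> space M" for \<omega>
  proof -
    have "\<exists>\<omega>'. \<omega>' \<in> space M \<and> X \<omega>' = X \<omega>" using that by auto
    from someI_ex[OF this] show ?thesis
      unfolding f_def using det that by blast
  qed
  have Y: "simple_function M Y"
    using simple_function_compose[OF X, of f] simple_function_cong[of M "f \<circ> X" Y] f by simp
  have eq: "Y -` {y} \<inter> space M = (f \<circ> X) -` {y} \<inter> space M" "Y ` space M = (f \<circ> X) ` space M" for y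
    using f by (auto simp: image_iff)
  have "\<H>(Y) = - (\<Sum>y\<in>Y ` space M. prob (Y -` {y} \<inter> space M) * log b (prob (Y -` {y} \<inter> space M)))"
    by (rule entropy_simple_distributed[OF simple_distributed_prob[OF Y]])
  also have "\<dots> = \<H>(f \<circ> X)"
    unfolding eq
    by (rule entropy_simple_distributed[OF simple_distributed_prob[OF simple_function_compose[OF X]], symmetric])
  also have "\<dots> \<le> \<H>(X)"
    by (rule entropy_data_processing[OF X])
  finally show ?thesis .
qed

text \<open>Strong subadditivity for variables that overlap implicitly: \<open>Z\<close> is a common
  part of \<open>X\<close> and \<open>Y\<close>, and \<open>V\<close> is determined by the two
  together. Most entropy inequalities of the converse take this shape.\<close>

lemma entropy_submodular:
  assumes X: "simple_function M X" and Y: "simple_function M Y" and Z: "simple_function M Z"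
    and det: "\<And>\<omega> \<omega>'. \<omega> \<in> space M \<Longrightarrow> \<omega>' \<in> space M \<Longrightarrow> X \<omega> = X \<omega>' \<Longrightarrow> Y \<omega> = Y \<omega>' \<Longrightarrow> V \<omega> = V \<omega>'"
    and detX: "\<And>\<omega> \<omega>'. \<omega> \<in> space M \<Longrightarrow> \<omega>' \<in> space M \<Longrightarrow> X \<omega> = X \<omega>' \<Longrightarrow> Z \<omega> = Z \<omega>'"
    and detY: "\<And>\<omega> \<omega>'. \<omega> \<in> space M \<Longrightarrow> \<omega>' \<in> space M \<Longrightarrow> Y \<omega> = Y \<omega>' \<Longrightarrow> Z \<omega> = Z \<omega>'"
  shows "\<H>(V) + \<H>(Z) \<le> \<H>(X) + \<H>(Y)"
proof -
  have "\<H>(V) \<le> \<H>(\<lambda>\<omega>. (X \<omega>, Y \<omega>, Z \<omega>))"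
    by (rule entropy_mono[OF simple_function_Pair[OF X simple_function_Pair[OF Y Z]]])
      (auto intro: det)
  moreover have "\<H>(\<lambda>\<omega>. (X \<omega>, Z \<omega>)) \<le> \<H>(X)"
    by (rule entropy_mono) (auto intro: X detX)
  moreover have "\<H>(\<lambda>\<omega>. (Y \<omega>, Z \<omega>)) \<le> \<H>(Y)"
    by (rule entropy_mono) (auto intro: Y detY)
  ultimately show ?thesis
    using entropy_strong_subadditive[OF X Y Z] by linarith
qed

lemma entropy_const: "\<H>(\<lambda>\<omega>. c) = 0"
proof -
  have "simple_function M (\<lambda>\<omega>. c)" by simp
  from entropy_simple_distributed[OF simple_distributed_prob[OF this]]
  show ?thesis
    using not_empty by (simp add: image_constant_conv prob_space)
qed

lemma entropy_subadditive:
  assumes X: "simple_function M X" and Y: "simple_function M Y"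
    and det: "\<And>\<omega> \<omega>'. \<omega> \<in> space M \<Longrightarrow> \<omega>' \<in> space M \<Longrightarrow> X \<omega> = X \<omega>' \<Longrightarrow> Y \<omega> = Y \<omega>' \<Longrightarrow> V \<omega> = V \<omega>'"
  shows "\<H>(V) \<le> \<H>(X) + \<H>(Y)"
proof -
  have "\<H>(V) + \<H>(\<lambda>_. ()) \<le> \<H>(X) + \<H>(Y)"
    by (rule entropy_submodular[OF X Y]) (auto intro: det)
  then show ?thesis
    using entropy_const[of "()"] by linarith
qed

lemma entropy_uniform_simple:
  assumes X: "simple_function M X"
    and unif: "\<And>x. x \<in> X ` space M \<Longrightarrow> prob (X -` {x} \<inter> space M) = 1 / c" and "c > 0"
  shows "\<H>(X) = log b c"
proof -
  have "\<H>(X) = - (\<Sum>x\<in>X ` space M. prob (X -` {x} \<inter> space M) * log b (1 / c))"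
    unfolding entropy_simple_distributed[OF simple_distributed_prob[OF X]]
    by (simp add: unif)
  also have "\<dots> = - log b (1 / c)"
    by (simp add: sum_distrib_right[symmetric] sum_prob_simple[OF X])
  also have "\<dots> = log b c"
    using \<open>c > 0\<close> by (simp add: log_divide)
  finally show ?thesis .
qed

section \<open>Mutual information and independence\<close>

lemma mutual_information_eq:
  assumes X: "simple_function M X" and Y: "simple_function M Y"
  shows "\<I>(X ; Y) = \<H>(X) + \<H>(Y) - \<H>(\<lambda>\<omega>. (X \<omega>, Y \<omega>))"
proof -
  have "\<H>(\<lambda>\<omega>. (Y \<omega>, X \<omega>)) = \<H>(\<lambda>\<omega>. (X \<omega>, Y \<omega>))"
    by (intro antisym entropy_mono simple_function_Pair X Y) auto
  then show ?thesis
    using mutual_information_eq_entropy_conditional_entropy[OF X Y] entropy_chain_rule[OF Y X]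
    by simp
qed

text \<open>Equality case of Gibbs' inequality: \<open>ln y \<le> y - 1\<close> compares each term
  with \<open>p z - r z\<close>, these differences sum to 0, and equality holds only for
  \<open>y = 1\<close>. The lemma translates the privacy conditions into product formulas and
  back.\<close>

lemma mutual_information_eq_0_iff:
  assumes X: "simple_function M X" and Y: "simple_function M Y"
  shows "\<I>(X ; Y) = 0 \<longleftrightarrow> (\<forall>x y. prob ((\<lambda>\<omega>. (X \<omega>, Y \<omega>)) -` {(x, y)} \<inter> space M) =
    prob (X -` {x} \<inter> space M) * prob (Y -` {y} \<inter> space M))"
proof
  define p where "p z = prob ((\<lambda>\<omega>. (X \<omega>, Y \<omega>)) -` {z} \<inter> space M)" for z
  define px where "px x = prob (X -` {x} \<inter> space M)" for x
  define py where "py y = prob (Y -` {y} \<inter> space M)" for y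
  define r where "r z = px (fst z) * py (snd z)" for z
  have XY: "simple_function M (\<lambda>\<omega>. (X \<omega>, Y \<omega>))"
    by (intro simple_function_Pair X Y)
  have I: "\<I>(X ; Y) = (\<Sum>z\<in>(\<lambda>\<omega>. (X \<omega>, Y \<omega>)) ` space M. p z * log b (p z / r z))"
    using mutual_information_simple_distributed[OF simple_distributed_prob[OF X]
        simple_distributed_prob[OF Y] simple_distributed_prob[OF XY]]
    by (simp add: p_def px_def py_def r_def split_beta')
  have fin: "finite (X ` space M)" "finite (Y ` space M)"
    using X Y by (auto simp: simple_function_def)
  let ?S = "X ` space M \<times> Y ` space M" and ?XY = "(\<lambda>\<omega>. (X \<omega>, Y \<omega>)) ` space M"
  have p0: "p z = 0" if "z \<notin> ?XY" for z
  proof -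
    have "(\<lambda>\<omega>. (X \<omega>, Y \<omega>)) -` {z} \<inter> space M = {}" using that by auto
    then show ?thesis by (simp add: p_def)
  qed
  have r0: "r z = 0" if "z \<notin> ?S" for z
  proof -
    have "X -` {fst z} \<inter> space M = {} \<or> Y -` {snd z} \<inter> space M = {}"
      using that by (cases z) auto
    then show ?thesis by (auto simp: r_def px_def py_def)
  qed
  have sub: "?XY \<subseteq> ?S" by auto
  \<comment> \<open>The range of the pair may miss points at which \<open>r\<close> is positive;
    \<open>r\<close> is known to have total mass 1 only on the full rectangle.\<close>
  have I': "\<I>(X ; Y) = (\<Sum>z\<in>?S. p z * log b (p z / r z))"
    unfolding I using fin sub p0 by (intro sum.mono_neutral_left) auto
  have nn: "p z \<ge> 0" "r z \<ge> 0" for z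
    by (auto simp: p_def r_def px_def py_def)
  have pos: "r z > 0" if "p z > 0" for z
  proof -
    have "z \<in> ?XY"
      using that p0[of z] by (cases "z \<in> ?XY") auto
    then obtain \<omega> where \<omega>: "\<omega> \<in> space M" "z = (X \<omega>, Y \<omega>)"
      by auto
    then show ?thesis
      using prob_comp_pos[OF XY \<omega>(1), of fst] prob_comp_pos[OF XY \<omega>(1), of snd] that
      by (auto simp: r_def px_def py_def p_def)
  qed
  have sum_p: "(\<Sum>z\<in>?S. p z) = 1"
  proof -
    have "(\<Sum>z\<in>?XY. p z) = (\<Sum>z\<in>?S. p z)"
      using fin sub p0 by (intro sum.mono_neutral_left) auto
    then show ?thesis
      using sum_prob_simple[OF XY] by (simp add: p_def)
  qed
  have sum_r: "(\<Sum>z\<in>?S. r z) = 1"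
  proof -
    have "(\<Sum>z\<in>?S. r z) = (\<Sum>x\<in>X ` space M. px x) * (\<Sum>y\<in>Y ` space M. py y)"
      unfolding sum_product sum.cartesian_product by (intro sum.cong) (auto simp: r_def)
    then show ?thesis
      by (simp add: px_def py_def sum_prob_simple[OF X] sum_prob_simple[OF Y])
  qed
  have term_ge: "p z - r z \<le> ln b * (p z * log b (p z / r z))" for z
  proof (cases "p z > 0")
    case True
    have "ln (r z / p z) \<le> r z / p z - 1"
      using True pos[OF True] by (intro ln_le_minus_one) auto
    then have "p z * (1 - r z / p z) \<le> p z * ln (p z / r z)"
      using True pos[OF True] by (intro mult_left_mono) (auto simp: ln_div)
    moreover have "p z * (1 - r z / p z) = p z - r z"
      using True by (simp add: field_simps)
    moreover have "ln b * (p z * log b (p z / r z)) = p z * ln (p z / r z)"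
      using b_gt_1 by (simp add: log_def)
    ultimately show ?thesis
      by metis
  qed (use nn[of z] in auto)
  have term_eq: "p z = r z" if "p z - r z = ln b * (p z * log b (p z / r z))" for z
  proof (cases "p z > 0")
    case True
    have "p z * (1 - r z / p z) = p z - r z"
      using True by (simp add: field_simps)
    moreover have "ln b * (p z * log b (p z / r z)) = p z * ln (p z / r z)"
      using b_gt_1 by (simp add: log_def)
    ultimately have "p z * ln (p z / r z) = p z * (1 - r z / p z)"
      using that by metis
    then have "ln (r z / p z) = r z / p z - 1"
      using True pos[OF True] by (simp add: ln_div)
    then have "r z / p z = 1"
      using True pos[OF True] by (intro ln_eq_minus_one) auto
    then show ?thesis using True by simp
  qed (use that nn[of z] in auto)
  {
    assume "\<I>(X ; Y) = 0"
    then have "(\<Sum>z\<in>?S. ln b * (p z * log b (p z / r z)) - (p z - r z)) = 0"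
      using I' by (simp add: sum_subtractf sum_distrib_left[symmetric] sum_p sum_r)
    then have "ln b * (p z * log b (p z / r z)) - (p z - r z) = 0" if "z \<in> ?S" for z
      using that fin term_ge by (subst (asm) sum_nonneg_eq_0_iff) auto
    then have "p z = r z" for z
      using term_eq[of z] p0[of z] r0[of z] sub by (cases "z \<in> ?S") auto
    from this[of "(_, _)"]
    show "\<forall>x y. prob ((\<lambda>\<omega>. (X \<omega>, Y \<omega>)) -` {(x, y)} \<inter> space M) =
      prob (X -` {x} \<inter> space M) * prob (Y -` {y} \<inter> space M)"
      by (simp add: p_def r_def px_def py_def)
  }
  assume "\<forall>x y. prob ((\<lambda>\<omega>. (X \<omega>, Y \<omega>)) -` {(x, y)} \<inter> space M) =
    prob (X -` {x} \<inter> space M) * prob (Y -` {y} \<inter> space M)"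
  then have "p z = r z" for z
    by (cases z) (simp add: p_def r_def px_def py_def)
  then show "\<I>(X ; Y) = 0"
    unfolding I by (intro sum.neutral) auto
qed

end

section \<open>Linear algebra over finite fields\<close>

text \<open>Complementary counting. With \<open>T\<close> servers as \<open>S\<close> it counts the
  K-subsets that meet them; with a single server, the subsets that contain it.\<close>

lemma card_subsets_meeting:
  assumes "finite A" "S \<subseteq> A"
  shows "card {D. D \<subseteq> A \<and> card D = k \<and> D \<inter> S \<noteq> {}} = (card A choose k) - ((card A - card S) choose k)"
proof -
  have eq: "{D. D \<subseteq> A \<and> card D = k \<and> D \<inter> S \<noteq> {}} =
      {D. D \<subseteq> A \<and> card D = k} - {D. D \<subseteq> A - S \<and> card D = k}"
    by auto
  have "card (A - S) = card A - card S"
    using assms by (simp add: card_Diff_subset finite_subset)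
  then show ?thesis
    unfolding eq using assms n_subsets[of A k] n_subsets[of "A - S" k]
    by (subst card_Diff_subset) auto
qed

section \<open>Finite sums and independent rows over a commutative ring\<close>

context cring
begin

lemma finsum_swap:
  assumes "finite A" "finite B" and f: "\<And>i j. i \<in> A \<Longrightarrow> j \<in> B \<Longrightarrow> f i j \<in> carrier R"
  shows "(\<Oplus>i\<in>A. \<Oplus>j\<in>B. f i j) = (\<Oplus>j\<in>B. \<Oplus>i\<in>A. f i j)"
  using assms(1) f
proof (induction A)
  case (insert a A)
  have "(\<Oplus>j\<in>B. \<Oplus>i\<in>insert a A. f i j) = (\<Oplus>j\<in>B. f a j \<oplus> (\<Oplus>i\<in>A. f i j))"
    using insert by (intro finsum_cong') (auto intro!: finsum_closed)
  also have "\<dots> = (\<Oplus>j\<in>B. f a j) \<oplus> (\<Oplus>j\<in>B. \<Oplus>i\<in>A. f i j)"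
    using insert by (intro finsum_addf) (auto intro!: finsum_closed)
  finally show ?case
    using insert by (simp add: Pi_iff)
qed (simp add: finsum_zero)

lemma finsum_diff:
  assumes "f \<in> A \<rightarrow> carrier R" "g \<in> A \<rightarrow> carrier R"
  shows "(\<Oplus>i\<in>A. f i \<ominus> g i) = (\<Oplus>i\<in>A. f i) \<ominus> (\<Oplus>i\<in>A. g i)"
proof -
  have "(\<Oplus>i\<in>A. f i) = (\<Oplus>i\<in>A. (f i \<ominus> g i) \<oplus> g i)"
    using assms by (intro finsum_cong') (auto simp: Pi_iff a_minus_def a_assoc l_neg)
  also have "\<dots> = (\<Oplus>i\<in>A. f i \<ominus> g i) \<oplus> (\<Oplus>i\<in>A. g i)"
    using assms by (intro finsum_addf) auto
  finally have sum: "(\<Oplus>i\<in>A. f i) = (\<Oplus>i\<in>A. f i \<ominus> g i) \<oplus> (\<Oplus>i\<in>A. g i)" .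
  have closed: "(\<Oplus>i\<in>A. f i \<ominus> g i) \<in> carrier R" "(\<Oplus>i\<in>A. g i) \<in> carrier R"
    using assms by (auto intro!: finsum_closed)
  have "y = y \<oplus> z \<ominus> z" if "y \<in> carrier R" "z \<in> carrier R" for y z
    using that by (simp add: a_minus_def a_assoc r_neg)
  from this[OF closed] show ?thesis
    unfolding sum[symmetric] .
qed

text \<open>Associativity of row vector times matrix times column vector.\<close>

lemma finsum_bilinear_swap:
  assumes "finite A" "finite B" "c \<in> A \<rightarrow> carrier R" "e \<in> B \<rightarrow> carrier R"
    and a: "\<And>i j. i \<in> A \<Longrightarrow> j \<in> B \<Longrightarrow> a i j \<in> carrier R"
  shows "(\<Oplus>i\<in>A. c i \<otimes> (\<Oplus>j\<in>B. a i j \<otimes> e j)) = (\<Oplus>j\<in>B. (\<Oplus>i\<in>A. c i \<otimes> a i j) \<otimes> e j)"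
proof -
  have "(\<Oplus>i\<in>A. c i \<otimes> (\<Oplus>j\<in>B. a i j \<otimes> e j)) = (\<Oplus>i\<in>A. \<Oplus>j\<in>B. c i \<otimes> a i j \<otimes> e j)"
    using assms by (intro finsum_cong' refl) (auto simp: Pi_iff finsum_rdistr m_assoc intro!: finsum_closed finsum_cong')
  also have "\<dots> = (\<Oplus>j\<in>B. \<Oplus>i\<in>A. c i \<otimes> a i j \<otimes> e j)"
    using assms by (intro finsum_swap) (auto simp: Pi_iff)
  also have "\<dots> = (\<Oplus>j\<in>B. (\<Oplus>i\<in>A. c i \<otimes> a i j) \<otimes> e j)"
    using assms by (intro finsum_cong' refl) (auto simp: Pi_iff finsum_ldistr intro!: finsum_closed)
  finally show ?thesis .
qed

lemma minus_eq_zeroD: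
  assumes "a \<ominus> b = \<zero>" "a \<in> carrier R" "b \<in> carrier R"
  shows "a = b"
proof -
  have "a = (a \<ominus> b) \<oplus> b"
    using assms(2,3) by (simp add: a_minus_def a_assoc l_neg)
  then show ?thesis
    using assms by simp
qed

text \<open>Arbitrary index sets, so that servers, files, code positions and exponents can label
  rows and columns without being numbered.\<close>

definition indep_rows :: "('i \<Rightarrow> 'j \<Rightarrow> 'a) \<Rightarrow> 'i set \<Rightarrow> 'j set \<Rightarrow> bool" where
  "indep_rows a I J \<longleftrightarrow>
     (\<forall>c\<in>I \<rightarrow> carrier R. (\<forall>j\<in>J. (\<Oplus>i\<in>I. c i \<otimes> a i j) = \<zero>) \<longrightarrow> (\<forall>i\<in>I. c i = \<zero>))"

lemma indep_rowsD:
  assumes "indep_rows a I J" "\<And>i. i \<in> I \<Longrightarrow> c i \<in> carrier R"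
    "\<And>j. j \<in> J \<Longrightarrow> (\<Oplus>i\<in>I. c i \<otimes> a i j) = \<zero>" "i \<in> I"
  shows "c i = \<zero>"
  using assms unfolding indep_rows_def by blast

lemma indep_rows_eqD:
  assumes "indep_rows a I J" "\<And>i. i \<in> I \<Longrightarrow> c i \<in> carrier R" "\<And>i. i \<in> I \<Longrightarrow> d i \<in> carrier R"
    "\<And>i j. i \<in> I \<Longrightarrow> j \<in> J \<Longrightarrow> a i j \<in> carrier R"
    "\<And>j. j \<in> J \<Longrightarrow> (\<Oplus>i\<in>I. c i \<otimes> a i j) = (\<Oplus>i\<in>I. d i \<otimes> a i j)" "i \<in> I"
  shows "c i = d i"
proof -
  have "c i \<ominus> d i = \<zero>"
  proof (rule indep_rowsD[OF assms(1) _ _ assms(6)])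
    fix j assume j: "j \<in> J"
    have "(\<Oplus>i\<in>I. (c i \<ominus> d i) \<otimes> a i j) = (\<Oplus>i\<in>I. c i \<otimes> a i j \<ominus> d i \<otimes> a i j)"
      using assms(2-4) j by (intro finsum_cong') (auto simp: a_minus_def l_distr l_minus)
    also have "\<dots> = (\<Oplus>i\<in>I. c i \<otimes> a i j) \<ominus> (\<Oplus>i\<in>I. d i \<otimes> a i j)"
      using assms(2-4) j by (intro finsum_diff) auto
    also have "\<dots> = \<zero>"
      using assms(2-5) j by (simp add: a_minus_def r_neg Pi_iff)
    finally show "(\<Oplus>i\<in>I. (c i \<ominus> d i) \<otimes> a i j) = \<zero>" .
  qed (use assms in auto)
  then show ?thesis
    using assms(2)[OF assms(6)] assms(3)[OF assms(6)] by (rule minus_eq_zeroD)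
qed

text \<open>By counting, a square matrix over a finite ring whose rows are independent maps row vectors
  onto all vectors, so every unit vector is a combination of its rows.\<close>

lemma indep_rows_transpose:
  assumes fin: "finite (carrier R)" "finite I" "finite J" and card: "card I = card J"
    and a: "\<And>i j. i \<in> I \<Longrightarrow> j \<in> J \<Longrightarrow> a i j \<in> carrier R" and rows: "indep_rows a I J"
  shows "indep_rows (\<lambda>j i. a i j) J I"
  unfolding indep_rows_def
proof (intro ballI impI)
  fix e j0 assume e: "e \<in> J \<rightarrow> carrier R" and 0: "\<forall>i\<in>I. (\<Oplus>j\<in>J. e j \<otimes> a i j) = \<zero>" and j0: "j0 \<in> J"
  define F where "F c = (\<lambda>j\<in>J. \<Oplus>i\<in>I. c i \<otimes> a i j)" for c
  have "inj_on F (I \<rightarrow>\<^sub>E carrier R)"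
  proof (intro inj_onI PiE_ext)
    fix c d i assume c: "c \<in> I \<rightarrow>\<^sub>E carrier R" and d: "d \<in> I \<rightarrow>\<^sub>E carrier R" and eq: "F c = F d" and i: "i \<in> I"
    show "c i = d i"
    proof (rule indep_rows_eqD[OF rows])
      fix j assume "j \<in> J"
      then show "(\<Oplus>i\<in>I. c i \<otimes> a i j) = (\<Oplus>i\<in>I. d i \<otimes> a i j)"
        using fun_cong[OF eq, of j] by (simp add: F_def)
    qed (use c d i a in auto)
  qed auto
  moreover have "F ` (I \<rightarrow>\<^sub>E carrier R) \<subseteq> J \<rightarrow>\<^sub>E carrier R"
    using a by (auto simp: F_def PiE_iff intro!: finsum_closed)
  moreover have "card (J \<rightarrow>\<^sub>E carrier R) = card (I \<rightarrow>\<^sub>E carrier R)"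
    using fin card by (simp add: card_PiE)
  ultimately have "F ` (I \<rightarrow>\<^sub>E carrier R) = J \<rightarrow>\<^sub>E carrier R"
    using fin by (intro card_subset_eq) (auto simp: card_image finite_PiE)
  moreover have "(\<lambda>j\<in>J. if j = j0 then \<one> else \<zero>) \<in> J \<rightarrow>\<^sub>E carrier R"
    by auto
  ultimately obtain c where c: "c \<in> I \<rightarrow>\<^sub>E carrier R" and Fc: "F c = (\<lambda>j\<in>J. if j = j0 then \<one> else \<zero>)"
    by (metis (no_types, lifting) imageE)
  \<comment> \<open>Since \<open>c\<close> combines the rows of \<open>a\<close> to the unit vector
    at \<open>j0\<close>, the entry \<open>e j0\<close> is (c a) e = c (a e) = 0.\<close>
  have "e j0 = (\<Oplus>j\<in>J. if j0 = j then e j else \<zero>)"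
    using e j0 fin by (intro add.finprod_singleton[symmetric]) auto
  also have "\<dots> = (\<Oplus>j\<in>J. (\<Oplus>i\<in>I. c i \<otimes> a i j) \<otimes> e j)"
  proof (intro finsum_cong' refl)
    fix j assume j: "j \<in> J"
    then have "(\<Oplus>i\<in>I. c i \<otimes> a i j) = (if j = j0 then \<one> else \<zero>)"
      using fun_cong[OF Fc, of j] by (simp add: F_def)
    then show "(if j0 = j then e j else \<zero>) = (\<Oplus>i\<in>I. c i \<otimes> a i j) \<otimes> e j"
      using e j by (auto simp: Pi_iff)
  qed (use a c e in \<open>auto intro!: finsum_closed m_closed\<close>)
  also have "\<dots> = (\<Oplus>i\<in>I. c i \<otimes> (\<Oplus>j\<in>J. a i j \<otimes> e j))"
    using fin c e a by (intro finsum_bilinear_swap[symmetric]) auto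
  also have "\<dots> = (\<Oplus>i\<in>I. \<zero>)"
  proof (intro finsum_cong' refl)
    fix i assume i: "i \<in> I"
    have "(\<Oplus>j\<in>J. a i j \<otimes> e j) = (\<Oplus>j\<in>J. e j \<otimes> a i j)"
      using e a i by (intro finsum_cong') (auto simp: m_comm Pi_iff)
    then show "c i \<otimes> (\<Oplus>j\<in>J. a i j \<otimes> e j) = \<zero>"
      using 0 i PiE_mem[OF c i] by simp
  qed auto
  finally show "e j0 = \<zero>"
    by (simp add: finsum_zero)
qed

end

section \<open>Vandermonde matrices\<close>

context field
begin

text \<open>Induction on the set of points. The exponents come from a labelling \<open>t\<close> of
  the columns, which only has to reach all numbers below \<open>card A\<close>.\<close>

lemma vandermonde_indep_rows:
  assumes "finite A" "x \<in> A \<rightarrow> carrier R" "inj_on x A" "{..<card A} \<subseteq> t ` J"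
  shows "indep_rows (\<lambda>i j. x i [^] (t j :: nat)) A J"
proof -
  have "\<forall>i\<in>A. e i = \<zero>" if "e \<in> A \<rightarrow> carrier R" "\<forall>k<card A. (\<Oplus>i\<in>A. e i \<otimes> x i [^] k) = \<zero>" for e
    using assms(1-3) that
  proof (induction A arbitrary: e)
    case (insert a A)
    note x = insert.prems(1) and e = insert.prems(3)
    have xa: "x a \<in> carrier R" and ea: "e a \<in> carrier R"
      and xA: "\<And>i. i \<in> A \<Longrightarrow> x i \<in> carrier R" and eA: "\<And>i. i \<in> A \<Longrightarrow> e i \<in> carrier R"
      using x e by auto
    \<comment> \<open>Multiplying the coefficient at \<open>i\<close> by
      \<open>x i \<ominus> x a\<close> removes the point \<open>a\<close>. The new power sum of
      degree \<open>k\<close> is the old one of degree \<open>Suc k\<close> minus \<open>x a\<close>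
      times the old one of degree \<open>k\<close>, so it vanishes.\<close>
    have "\<forall>i\<in>A. e i \<otimes> (x i \<ominus> x a) = \<zero>"
    proof (intro insert.IH allI impI)
      fix k assume k: "k < card A"
      let ?s = "\<lambda>k. \<Oplus>i\<in>insert a A. e i \<otimes> x i [^] (k::nat)"
      have "(\<Oplus>i\<in>insert a A. e i \<otimes> (x i \<ominus> x a) \<otimes> x i [^] k) =
          (\<Oplus>i\<in>insert a A. e i \<otimes> x i [^] Suc k \<ominus> x a \<otimes> (e i \<otimes> x i [^] k))"
        using xa ea xA eA by (intro finsum_cong' refl)
          (auto simp: a_minus_def r_distr l_distr r_minus l_minus m_ac)
      also have "\<dots> = ?s (Suc k) \<ominus> (\<Oplus>i\<in>insert a A. x a \<otimes> (e i \<otimes> x i [^] k))"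
        using xa ea xA eA by (intro finsum_diff) auto
      also have "(\<Oplus>i\<in>insert a A. x a \<otimes> (e i \<otimes> x i [^] k)) = x a \<otimes> ?s k"
        using xa ea xA eA insert.hyps by (intro finsum_rdistr[symmetric]) auto
      also have "?s (Suc k) = \<zero>"
        using insert.hyps k by (intro insert.prems(4)[rule_format]) simp
      also have "?s k = \<zero>"
        using insert.hyps k by (intro insert.prems(4)[rule_format]) simp
      finally have "(\<Oplus>i\<in>insert a A. e i \<otimes> (x i \<ominus> x a) \<otimes> x i [^] k) = \<zero>"
        using xa by (simp add: a_minus_def)
      then show "(\<Oplus>i\<in>A. e i \<otimes> (x i \<ominus> x a) \<otimes> x i [^] k) = \<zero>"
        using xa ea xA eA insert.hyps by (simp add: Pi_iff a_minus_def r_neg)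
    qed (use x e insert.prems in auto)
    moreover have "x i \<ominus> x a \<noteq> \<zero>" if "i \<in> A" for i
      using that insert.prems(2) insert.hyps xa xA minus_eq_zeroD[of "x i" "x a"]
      by (auto simp: inj_on_def)
    ultimately have zero: "e i = \<zero>" if "i \<in> A" for i
      using that integral[of "e i" "x i \<ominus> x a"] xa xA eA by auto
    have "(\<Oplus>i\<in>insert a A. e i \<otimes> x i [^] (0::nat)) = \<zero>"
      using insert.hyps by (intro insert.prems(4)[rule_format]) simp
    moreover have "(\<Oplus>i\<in>A. e i \<otimes> x i [^] (0::nat)) = (\<Oplus>i\<in>A. \<zero>)"
      using zero by (intro finsum_cong') auto
    ultimately have "e a = \<zero>"
      using xa ea xA eA insert.hyps by (simp add: Pi_iff finsum_zero)
    then show ?case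
      using zero by auto
  qed auto
  moreover have "\<forall>k<card A. (\<Oplus>i\<in>A. e i \<otimes> x i [^] k) = \<zero>"
    if "\<forall>j\<in>J. (\<Oplus>i\<in>A. e i \<otimes> x i [^] t j) = \<zero>" for e
  proof (intro allI impI)
    fix k assume "k < card A"
    then obtain j where "j \<in> J" "k = t j"
      using assms(4) by auto
    then show "(\<Oplus>i\<in>A. e i \<otimes> x i [^] k) = \<zero>"
      using that by simp
  qed
  ultimately show ?thesis
    unfolding indep_rows_def by simp
qed

end

section \<open>Random variables determined by independent sources\<close>

lemma finite_vimage_events:
  assumes "finite (f ` A)"
  shows "finite {f -` X \<inter> A | X. True}"
proof (rule finite_subset)
  show "{f -` X \<inter> A | X. True} \<subseteq> (\<lambda>Y. f -` Y \<inter> A) ` Pow (f ` A)"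
  proof
    fix B assume "B \<in> {f -` X \<inter> A | X. True}"
    then obtain X where "B = f -` X \<inter> A" by auto
    then have "B = f -` (X \<inter> f ` A) \<inter> A" by auto
    then show "B \<in> (\<lambda>Y. f -` Y \<inter> A) ` Pow (f ` A)" by blast
  qed
qed (use assms in simp)

lemma vimage_singleton_event: "f -` {y} \<inter> A \<in> {f -` X \<inter> A | X. True}"
  by blast

lemma Int_stable_vimages: "Int_stable {f -` X \<inter> A | X. True}"
proof (rule Int_stableI)
  fix a b assume "a \<in> {f -` X \<inter> A | X. True}" "b \<in> {f -` X \<inter> A | X. True}"
  then obtain X Y where "a = f -` X \<inter> A" "b = f -` Y \<inter> A" by blast
  then have "a \<inter> b = f -` (X \<inter> Y) \<inter> A" by auto
  then show "a \<inter> b \<in> {f -` X \<inter> A | X. True}" by blast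
qed

text \<open>The atoms of the generated algebra consist of points that lie in exactly the same
  members of the finite family. A set that does not separate points of an atom is a finite union of
  atoms.\<close>

lemma sigma_sets_saturated:
  assumes "finite \<B>" "\<B> \<subseteq> Pow \<Omega>" "A \<subseteq> \<Omega>"
    and sat: "\<And>x y. x \<in> A \<Longrightarrow> y \<in> \<Omega> \<Longrightarrow> (\<And>B. B \<in> \<B> \<Longrightarrow> x \<in> B \<longleftrightarrow> y \<in> B) \<Longrightarrow> y \<in> A"
  shows "A \<in> sigma_sets \<Omega> \<B>"
proof -
  interpret sigma_algebra \<Omega> "sigma_sets \<Omega> \<B>"
    using assms(2) by (rule sigma_algebra_sigma_sets)
  \<comment> \<open>The atom of the points that lie in all members of \<open>\<C>\<close> and in no
    others. Differences are used because an intersection over an empty \<open>\<C>\<close> would not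
    stay inside the space.\<close>
  define cell where "cell \<C> = (\<Omega> - \<Union>(\<B> - \<C>)) - \<Union>((\<lambda>B. \<Omega> - B) ` \<C>)" for \<C>
  have A_eq: "A = \<Union>(cell ` (\<lambda>x. {B \<in> \<B>. x \<in> B}) ` A)"
  proof (intro equalityI subsetI)
    fix y assume "y \<in> \<Union>(cell ` (\<lambda>x. {B \<in> \<B>. x \<in> B}) ` A)"
    then obtain x where "x \<in> A" "y \<in> cell {B \<in> \<B>. x \<in> B}" by auto
    then show "y \<in> A"
      using sat[of x y] by (auto simp: cell_def)
  next
    fix x assume "x \<in> A"
    then show "x \<in> \<Union>(cell ` (\<lambda>x. {B \<in> \<B>. x \<in> B}) ` A)"
      using assms(3) by (intro UnionI[of "cell {B \<in> \<B>. x \<in> B}"]) (auto simp: cell_def)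
  qed
  moreover have "finite ((\<lambda>x. {B \<in> \<B>. x \<in> B}) ` A)"
    by (rule finite_subset[of _ "Pow \<B>"]) (use assms(1) in auto)
  moreover have "cell \<C> \<in> sigma_sets \<Omega> \<B>" if "\<C> \<subseteq> \<B>" for \<C>
    unfolding cell_def using that assms(1) finite_subset[OF that assms(1)]
    by (intro Diff finite_Union top) auto
  ultimately have "\<Union>(cell ` (\<lambda>x. {B \<in> \<B>. x \<in> B}) ` A) \<in> sigma_sets \<Omega> \<B>"
    by (intro finite_Union) auto
  with A_eq show ?thesis
    by simp
qed

text \<open>An event that depends only on the sources of one group lies in the sigma-algebra
  generated by that group, and Int-stable independent families stay independent when they are
  grouped.\<close>

lemma (in prob_space) indep_sets_saturated:
  assumes indep: "indep_sets E (I \<union> J)" and disj: "I \<inter> J = {}" and fin: "finite I" "finite J"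
    and finE: "\<And>i. i \<in> I \<union> J \<Longrightarrow> finite (E i)" and stable: "\<And>i. i \<in> I \<union> J \<Longrightarrow> Int_stable (E i)"
    and A: "A \<subseteq> space M" "\<And>x y. x \<in> A \<Longrightarrow> y \<in> space M \<Longrightarrow>
      (\<And>i B. i \<in> I \<Longrightarrow> B \<in> E i \<Longrightarrow> x \<in> B \<longleftrightarrow> y \<in> B) \<Longrightarrow> y \<in> A"
    and B: "B \<subseteq> space M" "\<And>x y. x \<in> B \<Longrightarrow> y \<in> space M \<Longrightarrow>
      (\<And>i B. i \<in> J \<Longrightarrow> B \<in> E i \<Longrightarrow> x \<in> B \<longleftrightarrow> y \<in> B) \<Longrightarrow> y \<in> B"
  shows "prob (A \<inter> B) = prob A * prob B"
proof -
  have events: "E i \<subseteq> events" if "i \<in> I \<union> J" for i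
    using indep that unfolding indep_sets_def by blast
  then have sp: "E i \<subseteq> Pow (space M)" if "i \<in> I \<union> J" for i
    using that sets.space_closed by blast
  have "indep_sets (\<lambda>b. sigma_sets (space M) (\<Union>i\<in>(if b then I else J). E i)) UNIV"
  proof (rule indep_sets_collect_sigma)
    have "(\<Union>b. if b then I else J) = I \<union> J"
      by (auto simp: UNIV_bool)
    then show "indep_sets E (\<Union>b. if b then I else J)"
      using indep by simp
    show "disjoint_family (\<lambda>b. if b then I else J)"
      using disj by (auto simp: disjoint_family_on_def)
  qed (auto split: if_splits intro: stable)
  from indep_setsD[OF this, of UNIV "\<lambda>b. if b then A else B"]
  have "prob (\<Inter>b. if b then A else B) = (\<Prod>b\<in>UNIV. prob (if b then A else B))"
    if "A \<in> sigma_sets (space M) (\<Union>i\<in>I. E i)" "B \<in> sigma_sets (space M) (\<Union>i\<in>J. E i)"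
    using that by (simp add: UNIV_bool)
  moreover have "A \<in> sigma_sets (space M) (\<Union>i\<in>I. E i)"
  proof (rule sigma_sets_saturated)
    show "y \<in> A" if "x \<in> A" "y \<in> space M"
      "\<And>C. C \<in> (\<Union>i\<in>I. E i) \<Longrightarrow> x \<in> C \<longleftrightarrow> y \<in> C" for x y
      by (rule A(2)[OF that(1,2)]) (use that(3) in blast)
  qed (use fin finE sp A(1) in auto)
  moreover have "B \<in> sigma_sets (space M) (\<Union>i\<in>J. E i)"
  proof (rule sigma_sets_saturated)
    show "y \<in> B" if "x \<in> B" "y \<in> space M"
      "\<And>C. C \<in> (\<Union>i\<in>J. E i) \<Longrightarrow> x \<in> C \<longleftrightarrow> y \<in> C" for x y
      by (rule B(2)[OF that(1,2)]) (use that(3) in blast)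
  qed (use fin finE sp B(1) in auto)
  ultimately show ?thesis
    by (simp add: UNIV_bool Int_commute mult.commute)
qed

lemma simple_function_det:
  assumes X: "simple_function M X"
    and det: "\<And>\<omega> \<omega>'. \<omega> \<in> space M \<Longrightarrow> \<omega>' \<in> space M \<Longrightarrow> X \<omega> = X \<omega>' \<Longrightarrow> Y \<omega> = Y \<omega>'"
  shows "simple_function M Y"
proof -
  define f where "f x = Y (SOME \<omega>. \<omega> \<in> space M \<and> X \<omega> = x)" for x
  have "f (X \<omega>) = Y \<omega>" if "\<omega> \<in> space M" for \<omega>
  proof -
    have "\<exists>\<omega>'. \<omega>' \<in> space M \<and> X \<omega>' = X \<omega>" using that by auto
    from someI_ex[OF this] show ?thesis
      unfolding f_def using det that by blast
  qed
  then show ?thesis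
    using simple_function_compose[OF X, of f] simple_function_cong[of M "f \<circ> X" Y] by simp
qed

lemma simple_function_restrict:
  assumes "finite I" "\<And>i. i \<in> I \<Longrightarrow> simple_function M (X i)"
  shows "simple_function M (\<lambda>\<omega>. \<lambda>i\<in>I. X i \<omega>)"
  using assms
proof (induction I)
  case empty
  have "(\<lambda>\<omega>. \<lambda>i\<in>{}. X i \<omega>) = (\<lambda>\<omega>. \<lambda>i. undefined)"
    by (simp add: restrict_def)
  then show ?case
    by (simp only: simple_function_const)
next
  case (insert i I)
  have "simple_function M (\<lambda>\<omega>. (X i \<omega>, \<lambda>i\<in>I. X i \<omega>))"
    by (intro simple_function_Pair insert.IH insert.prems) auto
  then show ?case
  proof (rule simple_function_det)
    fix \<omega> \<omega>' assume eq: "(X i \<omega>, \<lambda>i\<in>I. X i \<omega>) = (X i \<omega>', \<lambda>i\<in>I. X i \<omega>')"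
    have "X j \<omega> = X j \<omega>'" if "j \<in> I" for j
      using eq that by (auto dest: fun_cong[of _ _ j])
    then show "(\<lambda>i\<in>insert i I. X i \<omega>) = (\<lambda>i\<in>insert i I. X i \<omega>')"
      using eq by (intro restrict_ext) auto
  qed
qed

text \<open>The sources alone, without correctness and privacy. This covers an arbitrary scheme in
  the converse as well as the constructed space before it is known to be a scheme.\<close>

locale pir_sources = pir_model +
  assumes usr_simple': "simple_function M usr"
    and srv_simple': "simple_function M srv"
    and dem_simple: "simple_function M dem"
    and file_simple: "\<And>i. i \<in> {1..m} \<Longrightarrow> simple_function M (W i)"
    and sources_indep: "indep_sets source_events ({User, Server, Demand} \<union> File ` {1..m})"
begin

fun agree :: "source \<Rightarrow> 'c \<Rightarrow> 'c \<Rightarrow> bool" where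
  "agree User \<omega> \<omega>' \<longleftrightarrow> usr \<omega> = usr \<omega>'"
| "agree Server \<omega> \<omega>' \<longleftrightarrow> srv \<omega> = srv \<omega>'"
| "agree Demand \<omega> \<omega>' \<longleftrightarrow> dem \<omega> = dem \<omega>'"
| "agree (File i) \<omega> \<omega>' \<longleftrightarrow> W i \<omega> = W i \<omega>'"

abbreviation sources :: "source set" where
  "sources \<equiv> {User, Server, Demand} \<union> File ` {1..m}"

text \<open>Measurability with respect to the sources in \<open>S\<close>, phrased by sample points,
  so that no function computing \<open>X\<close> from the sources has to be exhibited.\<close>

definition depends_on :: "('c \<Rightarrow> 'z) \<Rightarrow> source set \<Rightarrow> bool" where
  "depends_on X S \<longleftrightarrow>
     (\<forall>\<omega>\<in>space M. \<forall>\<omega>'\<in>space M. (\<forall>s\<in>S. agree s \<omega> \<omega>') \<longrightarrow> X \<omega> = X \<omega>')"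

lemma source_events_agree:
  assumes "\<omega> \<in> space M" "\<omega>' \<in> space M" "\<And>B. B \<in> source_events s \<Longrightarrow> \<omega> \<in> B \<longleftrightarrow> \<omega>' \<in> B"
  shows "agree s \<omega> \<omega>'"
proof (cases s)
  case User
  with assms(3)[of "usr -` {usr \<omega>} \<inter> space M"] assms(1,2) vimage_singleton_event[of usr]
  show ?thesis by simp
next
  case Server
  with assms(3)[of "srv -` {srv \<omega>} \<inter> space M"] assms(1,2) vimage_singleton_event[of srv]
  show ?thesis by simp
next
  case Demand
  with assms(3)[of "dem -` {dem \<omega>} \<inter> space M"] assms(1,2) vimage_singleton_event[of dem]
  show ?thesis by simp
next
  case (File i)
  with assms(3)[of "W i -` {W i \<omega>} \<inter> space M"] assms(1,2) vimage_singleton_event[of "W i"]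
  show ?thesis by simp
qed

lemma finite_source_events: "s \<in> sources \<Longrightarrow> finite (source_events s)"
  using finite_vimage_events[OF simple_functionD(1)[OF usr_simple']]
    finite_vimage_events[OF simple_functionD(1)[OF srv_simple']]
    finite_vimage_events[OF simple_functionD(1)[OF dem_simple]]
    finite_vimage_events[OF simple_functionD(1)[OF file_simple]]
  by (cases s) auto

text \<open>A fibre of a variable that depends on \<open>S\<close> does not separate points on which
  the sources in \<open>S\<close> agree, so \<open>indep_sets_saturated\<close> applies.\<close>

lemma depends_on_indep:
  assumes "S \<subseteq> sources" "S' \<subseteq> sources" "S \<inter> S' = {}"
    and X: "depends_on X S" and Y: "depends_on Y S'"
  shows "prob ((X -` {x} \<inter> space M) \<inter> (Y -` {y} \<inter> space M)) =
    prob (X -` {x} \<inter> space M) * prob (Y -` {y} \<inter> space M)"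
proof (rule indep_sets_saturated)
  show "indep_sets source_events (S \<union> S')"
    by (rule indep_sets_mono_index[OF _ sources_indep]) (use assms(1,2) in auto)
  show "finite S" "finite S'"
    using assms(1,2) by (auto intro: finite_subset)
  show "Int_stable (source_events i)" for i
    by (cases i) (simp_all only: source_events.simps Int_stable_vimages)
  show "finite (source_events i)" if "i \<in> S \<union> S'" for i
    using that assms(1,2) by (intro finite_source_events) auto
  show "\<omega>' \<in> X -` {x} \<inter> space M"
    if "\<omega> \<in> X -` {x} \<inter> space M" "\<omega>' \<in> space M"
      "\<And>i B. i \<in> S \<Longrightarrow> B \<in> source_events i \<Longrightarrow> \<omega> \<in> B \<longleftrightarrow> \<omega>' \<in> B" for \<omega> \<omega>'
    using that X source_events_agree[of \<omega> \<omega>'] unfolding depends_on_def by auto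
  show "\<omega>' \<in> Y -` {y} \<inter> space M"
    if "\<omega> \<in> Y -` {y} \<inter> space M" "\<omega>' \<in> space M"
      "\<And>i B. i \<in> S' \<Longrightarrow> B \<in> source_events i \<Longrightarrow> \<omega> \<in> B \<longleftrightarrow> \<omega>' \<in> B" for \<omega> \<omega>'
    using that Y source_events_agree[of \<omega> \<omega>'] unfolding depends_on_def by auto
qed (use assms in auto)

lemma depends_on_indep_pair:
  assumes "S \<subseteq> sources" "S' \<subseteq> sources" "S \<inter> S' = {}" "depends_on X S" "depends_on Y S'"
  shows "prob ((\<lambda>\<omega>. (X \<omega>, Y \<omega>)) -` {(x, y)} \<inter> space M) =
    prob (X -` {x} \<inter> space M) * prob (Y -` {y} \<inter> space M)"
proof -
  have "(\<lambda>\<omega>. (X \<omega>, Y \<omega>)) -` {(x, y)} \<inter> space M =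
      (X -` {x} \<inter> space M) \<inter> (Y -` {y} \<inter> space M)"
    by auto
  then show ?thesis
    using depends_on_indep[OF assms] by simp
qed

lemma depends_on_entropy:
  assumes "S \<subseteq> sources" "S' \<subseteq> sources" "S \<inter> S' = {}" "depends_on X S" "depends_on Y S'"
    and XY: "simple_function M X" "simple_function M Y"
  shows "\<I>(X ; Y) = 0" "\<H>(\<lambda>\<omega>. (X \<omega>, Y \<omega>)) = \<H>(X) + \<H>(Y)"
proof -
  show "\<I>(X ; Y) = 0"
    unfolding mutual_information_eq_0_iff[OF XY] using depends_on_indep_pair[OF assms(1-5)] by blast
  then show "\<H>(\<lambda>\<omega>. (X \<omega>, Y \<omega>)) = \<H>(X) + \<H>(Y)"
    unfolding mutual_information_eq[OF XY] by simp
qed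

lemma depends_onI:
  "(\<And>\<omega> \<omega>'. \<omega> \<in> space M \<Longrightarrow> \<omega>' \<in> space M \<Longrightarrow> (\<And>s. s \<in> S \<Longrightarrow> agree s \<omega> \<omega>') \<Longrightarrow> X \<omega> = X \<omega>') \<Longrightarrow>
    depends_on X S"
  unfolding depends_on_def by blast

lemma depends_onD:
  "depends_on X S \<Longrightarrow> \<omega> \<in> space M \<Longrightarrow> \<omega>' \<in> space M \<Longrightarrow> (\<And>s. s \<in> S \<Longrightarrow> agree s \<omega> \<omega>') \<Longrightarrow> X \<omega> = X \<omega>'"
  unfolding depends_on_def by blast

lemma depends_on_simple:
  assumes "depends_on X sources"
  shows "simple_function M X"
proof -
  have "simple_function M (\<lambda>\<omega>. (usr \<omega>, srv \<omega>, dem \<omega>, \<lambda>i\<in>{1..m}. W i \<omega>))"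
    by (intro simple_function_Pair simple_function_restrict usr_simple' srv_simple' dem_simple
        file_simple) auto
  then show ?thesis
  proof (rule simple_function_det)
    fix \<omega> \<omega>' assume \<omega>: "\<omega> \<in> space M" "\<omega>' \<in> space M"
      and eq: "(usr \<omega>, srv \<omega>, dem \<omega>, \<lambda>i\<in>{1..m}. W i \<omega>) = (usr \<omega>', srv \<omega>', dem \<omega>', \<lambda>i\<in>{1..m}. W i \<omega>')"
    have "W i \<omega> = W i \<omega>'" if "i \<in> {1..m}" for i
      using eq that by (auto dest: fun_cong[of _ _ i])
    then show "X \<omega> = X \<omega>'"
      using eq by (intro depends_onD[OF assms \<omega>]) auto
  qed
qed

lemma stored_cong:
  assumes "\<And>i. i \<in> {1..m} \<Longrightarrow> W i \<omega> = W i \<omega>'"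
  shows "stored n \<omega> = stored n \<omega>'"
  using assms by (simp add: stored_def cong: restrict_cong)

end

section \<open>The upper bound\<close>

lemma restrict_eq_iff: "restrict f A = restrict g A \<longleftrightarrow> (\<forall>x\<in>A. f x = g x)"
proof
  assume "restrict f A = restrict g A"
  from fun_cong[OF this] show "\<forall>x\<in>A. f x = g x"
    by (metis restrict_apply')
qed (auto intro: restrict_ext)

lemma subadditive_sum_le:
  fixes f :: "nat set \<Rightarrow> real"
  assumes submod: "\<And>S S'. S \<subseteq> A \<Longrightarrow> S' \<subseteq> A \<Longrightarrow> f (S \<union> S') + f (S \<inter> S') \<le> f S + f S'"
    and "finite S" "S \<subseteq> A"
  shows "f S - f {} \<le> (\<Sum>n\<in>S. f {n} - f {})"
  using assms(2,3)
proof (induction S)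
  case (insert n S)
  have "f ({n} \<union> S) + f ({n} \<inter> S) \<le> f {n} + f S"
    using insert.prems by (intro submod) auto
  then show ?case
    using insert by simp
qed simp

text \<open>Double counting. The coefficient is the number of \<open>t\<close>-subsets through a
  fixed element; written as a difference it has the right value 0 for \<open>t = 0\<close>
  too.\<close>

lemma sum_subsets:
  fixes d :: "'i \<Rightarrow> real"
  assumes "finite A"
  shows "(\<Sum>S | S \<subseteq> A \<and> card S = t. \<Sum>n\<in>S. d n) =
    real ((card A choose t) - ((card A - 1) choose t)) * (\<Sum>n\<in>A. d n)"
proof -
  let ?F = "{S. S \<subseteq> A \<and> card S = t}"
  have "(\<Sum>S\<in>?F. \<Sum>n\<in>S. d n) = (\<Sum>S\<in>?F. \<Sum>n\<in>A. if n \<in> S then d n else 0)"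
  proof (rule sum.cong[OF refl])
    fix S assume "S \<in> ?F"
    then have "A \<inter> S = S" by auto
    then show "(\<Sum>n\<in>S. d n) = (\<Sum>n\<in>A. if n \<in> S then d n else 0)"
      using sum.inter_restrict[OF assms, of d S] by simp
  qed
  also have "\<dots> = (\<Sum>n\<in>A. \<Sum>S\<in>?F. if n \<in> S then d n else 0)"
    by (rule sum.swap)
  also have "\<dots> = (\<Sum>n\<in>A. real ((card A choose t) - ((card A - 1) choose t)) * d n)"
  proof (rule sum.cong[OF refl])
    fix n assume "n \<in> A"
    have "(\<Sum>S\<in>?F. if n \<in> S then d n else 0) = (\<Sum>S\<in>{S \<in> ?F. n \<in> S}. d n)"
      using assms by (intro sum.inter_filter[symmetric]) simp
    also have "{S \<in> ?F. n \<in> S} = {S. S \<subseteq> A \<and> card S = t \<and> S \<inter> {n} \<noteq> {}}"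
      by auto
    finally show "(\<Sum>S\<in>?F. if n \<in> S then d n else 0) = real ((card A choose t) - ((card A - 1) choose t)) * d n"
      using card_subsets_meeting[OF assms, of "{n}" t] \<open>n \<in> A\<close> by simp
  qed
  finally show ?thesis
    by (simp add: sum_distrib_left)
qed

text \<open>Both sides count the pairs of a \<open>t\<close>-subset and an element of it; after
  Pascal's rule this is the absorption identity.\<close>

lemma choose_diff_absorb:
  assumes "N \<ge> 1"
  shows "real N * real ((N choose t) - ((N - 1) choose t)) = real t * real (N choose t)"
proof (cases t)
  case (Suc t')
  obtain N' where N: "N = Suc N'" using assms by (cases N) auto
  have "(N choose t) - ((N - 1) choose t) = N' choose t'"
    unfolding N Suc by simp
  moreover have "Suc N' * (N' choose t') = Suc t' * (Suc N' choose Suc t')"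
    using Suc_times_binomial_eq[of N' t'] by (simp add: mult.commute)
  ultimately show ?thesis
    unfolding N Suc by (metis of_nat_mult)
qed simp

text \<open>Each increment along \<open>1, 2, \<dots>\<close> is at most the increment within \<open>S\<close>.\<close>

lemma han_inequality:
  fixes f :: "nat set \<Rightarrow> real"
  assumes submod: "\<And>S S'. S \<subseteq> {1..N} \<Longrightarrow> S' \<subseteq> {1..N} \<Longrightarrow> f (S \<union> S') + f (S \<inter> S') \<le> f S + f S'"
  shows "real ((N choose t) - ((N - 1) choose t)) * (f {1..N} - f {}) \<le>
    (\<Sum>S | S \<subseteq> {1..N} \<and> card S = t. f S - f {})"
proof -
  define d where "d n = f {1..n} - f {1..n - 1}" for n
  have ge: "(\<Sum>n\<in>S. d n) \<le> f S - f {}" if "finite S" "S \<subseteq> {1..N}" for S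
    using that
  proof (induction S rule: finite_linorder_max_induct)
    case (insert n S)
    have "1 \<le> x" "x < n" if "x \<in> S" for x
      using insert.hyps(2) insert.prems that by auto
    \<comment> \<open>As \<open>n\<close> exceeds all of \<open>S\<close>, the segment
      \<open>{1..n - 1}\<close> contains \<open>S\<close>; by submodularity \<open>n\<close> adds at
      most as much to the segment as to \<open>S\<close>.\<close>
    then have "S \<union> {n} \<union> {1..n - 1} = {1..n}" "(S \<union> {n}) \<inter> {1..n - 1} = S"
      using insert.prems by fastforce+
    moreover have "f (S \<union> {n} \<union> {1..n - 1}) + f ((S \<union> {n}) \<inter> {1..n - 1}) \<le> f (S \<union> {n}) + f {1..n - 1}"
      using insert.prems by (intro submod) auto
    ultimately have "d n + f S \<le> f (insert n S)"
      by (simp add: d_def)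
    then show ?case
      using insert by auto
  qed simp
  have "(\<Sum>n\<in>{1..M}. d n) = f {1..M} - f {}" for M
    by (induction M) (simp_all add: d_def)
  then have "real ((N choose t) - ((N - 1) choose t)) * (f {1..N} - f {}) =
      (\<Sum>S | S \<subseteq> {1..N} \<and> card S = t. \<Sum>n\<in>S. d n)"
    using sum_subsets[of "{1..N}" d t] by simp
  also have "\<dots> \<le> (\<Sum>S | S \<subseteq> {1..N} \<and> card S = t. f S - f {})"
    by (intro sum_mono ge) (auto intro: finite_subset)
  finally show ?thesis .
qed

text \<open>The servers of \<open>D\<close> hold a row of each file times a square submatrix of
  \<open>gen\<close>. Recovering that row needs independent rows of the submatrix, whereas the MDS
  property speaks of its columns.\<close>

lemma (in field) mds_generator_indep_rows:
  assumes fin: "finite (carrier R)" and mds: "mds_generator R K N gen" and D: "D \<subseteq> {1..N}" "card D = K"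
  shows "indep_rows gen {1..K} D"
proof -
  have rows: "indep_rows (\<lambda>n k. gen k n) D {1..K}"
    using mds D unfolding mds_generator_def indep_rows_def by blast
  have gen: "gen k n \<in> carrier R" if "n \<in> D" "k \<in> {1..K}" for n k
    using mds D that unfolding mds_generator_def by blast
  have "finite D" using D(1) finite_subset by blast
  from indep_rows_transpose[OF fin this _ _ gen rows] show ?thesis
    using D by simp
qed

context information_space
begin

lemma entropy_cong_prob:
  assumes X: "simple_function M X" and Y: "simple_function M Y"
    and eq: "\<And>x. prob (X -` {x} \<inter> space M) = prob (Y -` {x} \<inter> space M)"
  shows "\<H>(X) = \<H>(Y)"
proof -
  let ?R = "X ` space M \<union> Y ` space M"
  have fin: "finite ?R"
    using X Y by (simp add: simple_functionD)
  have "(\<Sum>x\<in>Z ` space M. prob (Z -` {x} \<inter> space M) * log b (prob (Z -` {x} \<inter> space M))) =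
      (\<Sum>x\<in>?R. prob (Z -` {x} \<inter> space M) * log b (prob (Z -` {x} \<inter> space M)))"
    if Z: "Z ` space M \<subseteq> ?R" for Z
  proof (rule sum.mono_neutral_left[OF fin Z], rule ballI)
    fix x assume "x \<in> ?R - Z ` space M"
    then have "Z -` {x} \<inter> space M = {}" by auto
    then show "prob (Z -` {x} \<inter> space M) * log b (prob (Z -` {x} \<inter> space M)) = 0" by simp
  qed
  from this[of X] this[of Y] show ?thesis
    unfolding entropy_simple_distributed[OF simple_distributed_prob[OF X]]
      entropy_simple_distributed[OF simple_distributed_prob[OF Y]] by (simp add: eq)
qed

lemma entropy_eqI:
  assumes "simple_function M X" "simple_function M Y"
    and "\<And>\<omega> \<omega>'. \<omega> \<in> space M \<Longrightarrow> \<omega>' \<in> space M \<Longrightarrow> X \<omega> = X \<omega>' \<longleftrightarrow> Y \<omega> = Y \<omega>'"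
  shows "\<H>(X) = \<H>(Y)"
proof (rule antisym)
  show "\<H>(X) \<le> \<H>(Y)"
    by (rule entropy_mono[OF assms(2)]) (simp add: assms(3))
  show "\<H>(Y) \<le> \<H>(X)"
    by (rule entropy_mono[OF assms(1)]) (simp add: assms(3)[symmetric])
qed

text \<open>Turns the joint entropy with \<open>B\<close> into a submodular function of the set of
  servers, as required by \<open>han_inequality\<close> and
  \<open>subadditive_sum_le\<close>.\<close>

lemma entropy_family_submodular:
  assumes Y: "\<And>n. n \<in> A \<Longrightarrow> simple_function M (Y n)" and B: "simple_function M B"
    and S: "finite A" "S \<subseteq> A" "S' \<subseteq> A"
  shows "\<H>(\<lambda>\<omega>. (\<lambda>n\<in>S \<union> S'. Y n \<omega>, B \<omega>)) + \<H>(\<lambda>\<omega>. (\<lambda>n\<in>S \<inter> S'. Y n \<omega>, B \<omega>)) \<le>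
    \<H>(\<lambda>\<omega>. (\<lambda>n\<in>S. Y n \<omega>, B \<omega>)) + \<H>(\<lambda>\<omega>. (\<lambda>n\<in>S'. Y n \<omega>, B \<omega>))"
proof -
  have sf: "simple_function M (\<lambda>\<omega>. (\<lambda>n\<in>S. Y n \<omega>, B \<omega>))" if "S \<subseteq> A" for S
    using that S(1) by (intro simple_function_Pair simple_function_restrict B Y) (auto intro: finite_subset)
  show ?thesis
    by (rule entropy_submodular[OF sf[OF S(2)] sf[OF S(3)] sf]) (use S in \<open>auto simp: restrict_eq_iff\<close>)
qed

end

lemma simple_function_count_space:
  assumes "f \<in> measurable M (count_space A)" "finite A"
  shows "simple_function M f"
  unfolding simple_function_def
proof (intro conjI ballI)
  have sub: "f ` space M \<subseteq> A"
    using measurable_space[OF assms(1)] by auto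
  then show "finite (f ` space M)"
    using assms(2) finite_subset by blast
  fix x assume "x \<in> f ` space M"
  then show "f -` {x} \<inter> space M \<in> sets M"
    using sub by (intro measurable_sets[OF assms(1)]) auto
qed

context pir_scheme
begin

lemma finite_carrier: "finite (carrier R)"
  \<comment> \<open>An infinite carrier has \<open>card\<close> 0, which would make the base of the
    logarithm 0.\<close>
  by (rule ccontr) (use b_gt_1 base in simp)

lemma finite_files: "finite files"
  unfolding files_def using finite_carrier by (auto intro: finite_PiE)

lemma card_files: "real (card files) = b ^ (L * K)"
  by (simp add: files_def card_PiE base card_cartesian_product)

lemma finite_demands: "finite demands"
  by (rule finite_subset[of _ "Pow {1..m}"]) (auto simp: demands_def)

end

sublocale pir_scheme \<subseteq> pir_sources R M b N K T m P L gen W usr srv dem query answer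
proof
  show "simple_function M dem"
    using demand_rv finite_demands by (rule simple_function_count_space)
  show "simple_function M (W i)" if "i \<in> {1..m}" for i
    using file_rv[OF that] finite_files by (rule simple_function_count_space)
qed (rule usr_simple srv_simple independent)+

section \<open>Entropies of answers, queries and files in a scheme\<close>

context pir_scheme
begin

definition "ans p S \<omega> = (\<lambda>n\<in>S. A p n \<omega>)"
definition "que p S \<omega> = (\<lambda>n\<in>S. Q p n \<omega>)"
definition "fil B \<omega> = (\<lambda>i\<in>B. W i \<omega>)"
definition "sto S \<omega> = (\<lambda>n\<in>S. stored n \<omega>)"
text \<open>Conditioning on the key is expressed by including it in every tuple; it makes all
  queries known.\<close>

abbreviation "key \<omega> \<equiv> (usr \<omega>, srv \<omega>)"

lemma tuple_eq_iffs:
  "ans p S \<omega> = ans p' S \<omega>' \<longleftrightarrow> (\<forall>n\<in>S. A p n \<omega> = A p' n \<omega>')"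
  "que p S \<omega> = que p' S \<omega>' \<longleftrightarrow> (\<forall>n\<in>S. Q p n \<omega> = Q p' n \<omega>')"
  "fil B \<omega> = fil B \<omega>' \<longleftrightarrow> (\<forall>i\<in>B. W i \<omega> = W i \<omega>')"
  "sto S \<omega> = sto S \<omega>' \<longleftrightarrow> (\<forall>n\<in>S. stored n \<omega> = stored n \<omega>')"
  unfolding ans_def que_def fil_def sto_def by (simp_all only: restrict_eq_iff)

lemma simpleI:
  assumes "\<And>\<omega> \<omega>'. \<lbrakk>\<omega> \<in> space M; \<omega>' \<in> space M; usr \<omega> = usr \<omega>'; srv \<omega> = srv \<omega>'; dem \<omega> = dem \<omega>';
    \<And>i. i \<in> {1..m} \<Longrightarrow> W i \<omega> = W i \<omega>'\<rbrakk> \<Longrightarrow> X \<omega> = X \<omega>'"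
  shows "simple_function M X"
proof (rule depends_on_simple, rule depends_onI)
  fix \<omega> \<omega>' assume \<omega>: "\<omega> \<in> space M" "\<omega>' \<in> space M" and ag: "\<And>s. s \<in> sources \<Longrightarrow> agree s \<omega> \<omega>'"
  have "agree User \<omega> \<omega>'" "agree Server \<omega> \<omega>'" "agree Demand \<omega> \<omega>'"
    "\<And>i. i \<in> {1..m} \<Longrightarrow> agree (File i) \<omega> \<omega>'"
    by (rule ag; simp)+
  then show "X \<omega> = X \<omega>'"
    using \<omega> by (intro assms) auto
qed

lemma A_cong: "Q p n \<omega> = Q p n \<omega>' \<Longrightarrow> srv \<omega> = srv \<omega>' \<Longrightarrow> stored n \<omega> = stored n \<omega>' \<Longrightarrow> A p n \<omega> = A p n \<omega>'"
  by (simp add: A_def)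

lemma Q_cong: "usr \<omega> = usr \<omega>' \<Longrightarrow> Q p n \<omega> = Q p n \<omega>'"
  by (simp add: Q_def)

lemma simple_ans: "simple_function M (\<lambda>\<omega>. A p n \<omega>)"
  by (rule simpleI) (auto intro!: A_cong stored_cong Q_cong)

lemma simple_que: "simple_function M (\<lambda>\<omega>. Q p n \<omega>)"
  by (rule simpleI) (auto intro!: Q_cong)

lemma simple_sto: "simple_function M (stored n)"
  by (rule simpleI) (auto intro!: stored_cong)

lemma simple_fil: "B \<subseteq> {1..m} \<Longrightarrow> simple_function M (fil B)"
  unfolding fil_def by (intro simple_function_restrict file_simple) (auto intro: finite_subset)

lemma simple_key: "simple_function M (\<lambda>\<omega>. key \<omega>)"
  by (intro simple_function_Pair usr_simple srv_simple)

lemma simple_anss: "S \<subseteq> {1..N} \<Longrightarrow> simple_function M (ans p S)"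
  unfolding ans_def by (intro simple_function_restrict simple_ans) (auto intro: finite_subset)

lemma simple_ques: "S \<subseteq> {1..N} \<Longrightarrow> simple_function M (que p S)"
  unfolding que_def by (intro simple_function_restrict simple_que) (auto intro: finite_subset)

lemma simple_stos: "S \<subseteq> {1..N} \<Longrightarrow> simple_function M (sto S)"
  unfolding sto_def by (intro simple_function_restrict simple_sto) (auto intro: finite_subset)

lemmas simple_intros = simple_function_Pair simple_fil simple_key simple_anss simple_ques simple_stos
  simple_ans simple_que simple_sto usr_simple srv_simple file_simple

lemma W_files: "i \<in> {1..m} \<Longrightarrow> \<omega> \<in> space M \<Longrightarrow> W i \<omega> \<in> files"
  using measurable_space[OF file_rv] by auto

lemma entropy_file:
  assumes i: "i \<in> {1..m}"
  shows "\<H>(W i) = real L * real K"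
proof -
  have "prob (W i -` {w} \<inter> space M) = 1 / real (card files)" if "w \<in> W i ` space M" for w
  proof -
    have w: "w \<in> files" using that W_files[OF i] by auto
    have "prob (W i -` {w} \<inter> space M) = measure (distr M (count_space files) (W i)) {w}"
      using w by (subst measure_distr[OF file_rv[OF i]]) auto
    also have "\<dots> = 1 / real (card files)"
      unfolding file_uniform[OF i] using finite_files w by (simp add: measure_uniform_count_measure)
    finally show ?thesis .
  qed
  moreover have "real (card files) > 0"
    unfolding card_files using b_gt_1 by simp
  ultimately have "\<H>(W i) = log b (real (card files))"
    by (rule entropy_uniform_simple[OF file_simple[OF i]])
  then show ?thesis
    unfolding card_files using b_gt_1 by (simp add: log_nat_power)
qed

text \<open>The files are uniform and independent of each other and of the key, so each of them adds
  its full entropy.\<close>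

lemma entropy_files_key:
  assumes "B \<subseteq> {1..m}"
  shows "\<H>(\<lambda>\<omega>. (fil B \<omega>, key \<omega>)) = \<H>(\<lambda>\<omega>. key \<omega>) + real (card B) * (real L * real K)"
proof -
  have "finite B" using assms finite_subset by blast
  then show ?thesis
    using assms
  proof (induction B)
    case empty
    have "\<H>(\<lambda>\<omega>. (fil {} \<omega>, key \<omega>)) = \<H>(\<lambda>\<omega>. key \<omega>)"
      by (rule entropy_eqI) (auto intro!: simple_intros simp: tuple_eq_iffs)
    then show ?case
      by (simp only: card.empty of_nat_0 mult_zero_left add_0_right)
  next
    case (insert i B)
    have "\<H>(\<lambda>\<omega>. (fil (insert i B) \<omega>, key \<omega>)) = \<H>(\<lambda>\<omega>. (W i \<omega>, (fil B \<omega>, key \<omega>)))"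
      using insert.prems by (intro entropy_eqI simple_intros) (auto simp: tuple_eq_iffs)
    also have "\<dots> = \<H>(W i) + \<H>(\<lambda>\<omega>. (fil B \<omega>, key \<omega>))"
    proof (rule depends_on_entropy(2))
      show "depends_on (\<lambda>\<omega>. (fil B \<omega>, key \<omega>)) ({User, Server} \<union> File ` B)"
      proof (rule depends_onI)
        fix \<omega> \<omega>' assume ag: "\<And>s. s \<in> {User, Server} \<union> File ` B \<Longrightarrow> agree s \<omega> \<omega>'"
        have "agree User \<omega> \<omega>'" "agree Server \<omega> \<omega>'" "\<And>i. i \<in> B \<Longrightarrow> agree (File i) \<omega> \<omega>'"
          by (rule ag; simp)+
        then show "(fil B \<omega>, key \<omega>) = (fil B \<omega>', key \<omega>')"
          by (auto simp: tuple_eq_iffs)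
      qed
      show "depends_on (W i) {File i}"
        by (rule depends_onI) simp
    qed (use insert in \<open>auto intro!: simple_intros\<close>)
    finally show ?case
      using insert entropy_file[of i] by (simp add: algebra_simps)
  qed
qed

text \<open>Correctness is a statement about entropy and ignores sample points of probability 0, so
  the files need not be literally a function of answers and key. Submodularity carries the vanishing
  conditional entropy over to every \<open>X\<close> that determines these.\<close>

lemma entropy_decode:
  assumes p: "p \<in> demands" and X: "simple_function M X"
    and det: "\<And>\<omega> \<omega>'. \<omega> \<in> space M \<Longrightarrow> \<omega>' \<in> space M \<Longrightarrow> X \<omega> = X \<omega>' \<Longrightarrow>
      ans p {1..N} \<omega> = ans p {1..N} \<omega>' \<and> key \<omega> = key \<omega>'"
  shows "\<H>(\<lambda>\<omega>. (X \<omega>, fil p \<omega>)) \<le> \<H>(X)"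
proof -
  have pm: "p \<subseteq> {1..m}" using p by (simp add: demands_def)
  let ?Z = "\<lambda>\<omega>. (que p {1..N} \<omega>, ans p {1..N} \<omega>, usr \<omega>, srv \<omega>)"
  have Z: "simple_function M ?Z" by (intro simple_intros order_refl)
  have ZW: "simple_function M (\<lambda>\<omega>. (?Z \<omega>, fil p \<omega>))" by (rule simple_function_Pair[OF Z simple_fil[OF pm]])
  have detZ: "?Z \<omega> = ?Z \<omega>'" if "\<omega> \<in> space M" "\<omega>' \<in> space M" "X \<omega> = X \<omega>'" for \<omega> \<omega>'
    using det[OF that] by (auto simp: tuple_eq_iffs intro: Q_cong)
  have "\<H>(\<lambda>\<omega>. (X \<omega>, fil p \<omega>)) + \<H>(?Z) \<le> \<H>(X) + \<H>(\<lambda>\<omega>. (?Z \<omega>, fil p \<omega>))"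
  proof (rule entropy_submodular[OF X ZW Z])
    show "(X \<omega>, fil p \<omega>) = (X \<omega>', fil p \<omega>')"
      if "X \<omega> = X \<omega>'" "(?Z \<omega>, fil p \<omega>) = (?Z \<omega>', fil p \<omega>')" for \<omega> \<omega>'
      using that by blast
    show "?Z \<omega> = ?Z \<omega>'" if "(?Z \<omega>, fil p \<omega>) = (?Z \<omega>', fil p \<omega>')" for \<omega> \<omega>'
      using that by blast
  qed (rule detZ)
  moreover have "\<H>(\<lambda>\<omega>. (?Z \<omega>, fil p \<omega>)) = \<H>(?Z)"
    using entropy_chain_rule[OF Z simple_fil[OF pm]] correctness[OF p, folded que_def ans_def fil_def] by simp
  ultimately show ?thesis by simp
qed

text \<open>On the event that \<open>p\<close> is demanded, the queries for the random demand are
  those for \<open>p\<close>. This event is independent of the former by privacy and of the latter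
  by independence of the sources, and its positive probability cancels.\<close>

lemma query_prob:
  assumes p: "p \<in> demands" and S: "S \<subseteq> {1..N}" "card S = T"
  shows "prob (que p S -` {x} \<inter> space M) = prob ((\<lambda>\<omega>. que (dem \<omega>) S \<omega>) -` {x} \<inter> space M)"
proof -
  let ?D = "dem -` {p} \<inter> space M"
  have sQ: "simple_function M (\<lambda>\<omega>. que (dem \<omega>) S \<omega>)"
    by (rule simpleI) (auto simp: tuple_eq_iffs intro: Q_cong)
  have "prob ((\<lambda>\<omega>. (dem \<omega>, que (dem \<omega>) S \<omega>)) -` {(p, x)} \<inter> space M) =
      prob ?D * prob ((\<lambda>\<omega>. que (dem \<omega>) S \<omega>) -` {x} \<inter> space M)"
    using query_privacy[OF S, folded que_def] mutual_information_eq_0_iff[OF dem_simple sQ] by blast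
  also have "(\<lambda>\<omega>. (dem \<omega>, que (dem \<omega>) S \<omega>)) -` {(p, x)} \<inter> space M =
      ?D \<inter> (que p S -` {x} \<inter> space M)"
    by auto
  also have "prob \<dots> = prob ?D * prob (que p S -` {x} \<inter> space M)"
  proof (rule depends_on_indep)
    show "depends_on dem {Demand}" by (rule depends_onI) simp
    show "depends_on (que p S) {User}"
      by (rule depends_onI) (auto simp: tuple_eq_iffs intro: Q_cong)
  qed auto
  finally have "prob ?D * prob ((\<lambda>\<omega>. que (dem \<omega>) S \<omega>) -` {x} \<inter> space M) =
      prob ?D * prob (que p S -` {x} \<inter> space M)"
    by (rule sym)
  moreover have "?D = {\<omega> \<in> space M. dem \<omega> = p}" by auto
  then have "prob ?D \<noteq> 0"
    using demand_full[OF p] by simp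
  ultimately show ?thesis
    by simp
qed

text \<open>Once the value of the queries is fixed, the answers are computed from the servers'
  randomness and the files alone, which do not involve the demand. Only the law of the queries is
  left, and \<open>query_prob\<close> frees it of the demand.\<close>

lemma query_answer_prob:
  assumes p: "p \<in> demands" "p' \<in> demands" and S: "S \<subseteq> {1..N}" "card S = T" and B: "B \<subseteq> {1..m}"
  shows "prob ((\<lambda>\<omega>. (ans p S \<omega>, fil B \<omega>, srv \<omega>, que p S \<omega>)) -` {v} \<inter> space M) =
    prob ((\<lambda>\<omega>. (ans p' S \<omega>, fil B \<omega>, srv \<omega>, que p' S \<omega>)) -` {v} \<inter> space M)"
proof -
  obtain a w s x where v: "v = (a, w, s, x)" by (cases v)
  define Y where "Y = (\<lambda>\<omega>. (\<lambda>n\<in>S. answer n (x n) (srv \<omega>) (stored n \<omega>), fil B \<omega>, srv \<omega>))"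
  have depY: "depends_on Y ({Server} \<union> File ` {1..m})"
  proof (rule depends_onI)
    fix \<omega> \<omega>' assume ag: "\<And>s. s \<in> {Server} \<union> File ` {1..m} \<Longrightarrow> agree s \<omega> \<omega>'"
    have srv: "agree Server \<omega> \<omega>'" and W: "\<And>i. i \<in> {1..m} \<Longrightarrow> agree (File i) \<omega> \<omega>'"
      by (rule ag; simp)+
    have "stored n \<omega> = stored n \<omega>'" for n
      using W by (intro stored_cong) simp
    then show "Y \<omega> = Y \<omega>'"
      using srv W B by (auto simp: Y_def tuple_eq_iffs cong: restrict_cong)
  qed
  have "prob ((\<lambda>\<omega>. (ans p S \<omega>, fil B \<omega>, srv \<omega>, que p S \<omega>)) -` {v} \<inter> space M) =
      prob ((\<lambda>\<omega>. que (dem \<omega>) S \<omega>) -` {x} \<inter> space M) * prob (Y -` {(a, w, s)} \<inter> space M)"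
    if p: "p \<in> demands" for p
  proof -
    have "que p S \<omega> = x \<Longrightarrow> ans p S \<omega> = (\<lambda>n\<in>S. answer n (x n) (srv \<omega>) (stored n \<omega>))" for \<omega>
      by (auto simp: ans_def que_def A_def restrict_eq_iff)
    then have "(\<lambda>\<omega>. (ans p S \<omega>, fil B \<omega>, srv \<omega>, que p S \<omega>)) -` {v} \<inter> space M =
        (que p S -` {x} \<inter> space M) \<inter> (Y -` {(a, w, s)} \<inter> space M)"
      unfolding v Y_def by auto
    also have "prob \<dots> = prob (que p S -` {x} \<inter> space M) * prob (Y -` {(a, w, s)} \<inter> space M)"
    proof (rule depends_on_indep[OF _ _ _ _ depY])
      show "depends_on (que p S) {User}"
        by (rule depends_onI) (auto simp: tuple_eq_iffs intro: Q_cong)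
    qed auto
    finally show ?thesis
      unfolding query_prob[OF p S] .
  qed
  from this[OF p(1)] this[OF p(2)] show ?thesis by simp
qed

text \<open>The answers of \<open>S\<close> depend on \<open>usr\<close> only through the queries to
  \<open>S\<close>. Replacing these queries by all of \<open>usr\<close> therefore raises the
  entropy by exactly \<open>H(usr) - H(que p S)\<close>, and by privacy this amount is the same for
  both demands.\<close>

lemma entropy_answers_demand_free:
  assumes p: "p \<in> demands" "p' \<in> demands" and S: "S \<subseteq> {1..N}" "card S = T" and B: "B \<subseteq> {1..m}"
  shows "\<H>(\<lambda>\<omega>. (ans p S \<omega>, fil B \<omega>, key \<omega>)) = \<H>(\<lambda>\<omega>. (ans p' S \<omega>, fil B \<omega>, key \<omega>))"
proof -
  let ?W = "fil {1..m}"
  have eq: "\<H>(\<lambda>\<omega>. (ans p S \<omega>, fil B \<omega>, key \<omega>)) =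
      \<H>(\<lambda>\<omega>. (ans p S \<omega>, fil B \<omega>, srv \<omega>, que p S \<omega>)) + \<H>(usr) - \<H>(que p S)" for p
  proof (rule antisym)
    have "\<H>(\<lambda>\<omega>. (ans p S \<omega>, fil B \<omega>, key \<omega>)) + \<H>(que p S) \<le>
        \<H>(\<lambda>\<omega>. (ans p S \<omega>, fil B \<omega>, srv \<omega>, que p S \<omega>)) + \<H>(usr)"
      using S B by (intro entropy_submodular simple_intros) (auto simp: tuple_eq_iffs intro: Q_cong)
    then show "\<H>(\<lambda>\<omega>. (ans p S \<omega>, fil B \<omega>, key \<omega>)) \<le>
      \<H>(\<lambda>\<omega>. (ans p S \<omega>, fil B \<omega>, srv \<omega>, que p S \<omega>)) + \<H>(usr) - \<H>(que p S)" by simp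
    have dW: "depends_on (\<lambda>\<omega>. (?W \<omega>, srv \<omega>)) ({Server} \<union> File ` {1..m})"
    proof (rule depends_onI)
      fix \<omega> \<omega>' assume ag: "\<And>s. s \<in> {Server} \<union> File ` {1..m} \<Longrightarrow> agree s \<omega> \<omega>'"
      have "agree Server \<omega> \<omega>'" "\<And>i. i \<in> {1..m} \<Longrightarrow> agree (File i) \<omega> \<omega>'"
        by (rule ag; simp)+
      then show "(?W \<omega>, srv \<omega>) = (?W \<omega>', srv \<omega>')"
        by (auto simp: tuple_eq_iffs)
    qed
    have dQ: "depends_on (que p S) {User}" and dU: "depends_on usr {User}"
      by (rule depends_onI, auto simp: tuple_eq_iffs intro: Q_cong)+
    have e1: "\<H>(\<lambda>\<omega>. (usr \<omega>, (?W \<omega>, srv \<omega>))) = \<H>(usr) + \<H>(\<lambda>\<omega>. (?W \<omega>, srv \<omega>))"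
      by (rule depends_on_entropy(2)[OF _ _ _ dU dW]) (auto intro!: simple_intros)
    have e2: "\<H>(\<lambda>\<omega>. (que p S \<omega>, (?W \<omega>, srv \<omega>))) = \<H>(que p S) + \<H>(\<lambda>\<omega>. (?W \<omega>, srv \<omega>))"
      by (rule depends_on_entropy(2)[OF _ _ _ dQ dW]) (use S in \<open>auto intro!: simple_intros\<close>)
    \<comment> \<open>The queries to \<open>S\<close> together with all files and \<open>srv\<close>
      determine the answers. By \<open>e1\<close> and \<open>e2\<close> the entropy of files and
      \<open>srv\<close> cancels, since they are independent of \<open>usr\<close>.\<close>
    have "\<H>(\<lambda>\<omega>. (usr \<omega>, (?W \<omega>, srv \<omega>))) + \<H>(\<lambda>\<omega>. (ans p S \<omega>, fil B \<omega>, srv \<omega>, que p S \<omega>)) \<le>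
        \<H>(\<lambda>\<omega>. (ans p S \<omega>, fil B \<omega>, key \<omega>)) + \<H>(\<lambda>\<omega>. (que p S \<omega>, (?W \<omega>, srv \<omega>)))"
    proof (rule entropy_submodular)
      fix \<omega> \<omega>' assume eq: "(que p S \<omega>, (?W \<omega>, srv \<omega>)) = (que p S \<omega>', (?W \<omega>', srv \<omega>'))"
      have W: "W i \<omega> = W i \<omega>'" if "i \<in> {1..m}" for i
        using eq that by (simp add: tuple_eq_iffs)
      have st: "stored n \<omega> = stored n \<omega>'" for n
        using W by (rule stored_cong)
      have "ans p S \<omega> = ans p S \<omega>'"
        using eq st by (auto simp: tuple_eq_iffs intro!: A_cong)
      then show "(ans p S \<omega>, fil B \<omega>, srv \<omega>, que p S \<omega>) = (ans p S \<omega>', fil B \<omega>', srv \<omega>', que p S \<omega>')"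
        using eq W B by (auto simp: tuple_eq_iffs)
    qed (use S B in \<open>auto intro!: simple_intros simp: tuple_eq_iffs intro: Q_cong\<close>)
    then show "\<H>(\<lambda>\<omega>. (ans p S \<omega>, fil B \<omega>, srv \<omega>, que p S \<omega>)) + \<H>(usr) - \<H>(que p S) \<le>
      \<H>(\<lambda>\<omega>. (ans p S \<omega>, fil B \<omega>, key \<omega>))"
      using e1 e2 by simp
  qed
  have "\<H>(\<lambda>\<omega>. (ans p S \<omega>, fil B \<omega>, srv \<omega>, que p S \<omega>)) = \<H>(\<lambda>\<omega>. (ans p' S \<omega>, fil B \<omega>, srv \<omega>, que p' S \<omega>))"
    using query_answer_prob[OF p S B] S B by (intro entropy_cong_prob simple_intros) auto
  moreover have "\<H>(que p S) = \<H>(que p' S)"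
    using query_prob[OF p(1) S] query_prob[OF p(2) S] S by (intro entropy_cong_prob simple_intros) auto
  ultimately show ?thesis
    unfolding eq by simp
qed

lemma stored_determines:
  assumes mds: "mds_generator R K N gen" and S: "S \<subseteq> {1..N}" "card S = K"
    and \<omega>: "\<omega> \<in> space M" "\<omega>' \<in> space M" and eq: "\<And>n. n \<in> S \<Longrightarrow> stored n \<omega> = stored n \<omega>'"
    and i: "i \<in> {1..m}"
  shows "W i \<omega> = W i \<omega>'"
proof -
  have gen: "gen k n \<in> carrier R" if "k \<in> {1..K}" "n \<in> S" for k n
    using mds S that unfolding mds_generator_def by blast
  have Wf: "W i \<omega> \<in> {1..L} \<times> {1..K} \<rightarrow>\<^sub>E carrier R" "W i \<omega>' \<in> {1..L} \<times> {1..K} \<rightarrow>\<^sub>E carrier R"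
    using W_files[OF i] \<omega> by (simp_all add: files_def)
  show ?thesis
  proof (rule PiE_ext[OF Wf])
    fix lk assume "lk \<in> {1..L} \<times> {1..K}"
    then obtain l k where lk: "lk = (l, k)" "l \<in> {1..L}" "k \<in> {1..K}" by auto
    have "W i \<omega> (l, k) = W i \<omega>' (l, k)"
    proof (rule indep_rows_eqD[OF mds_generator_indep_rows[OF finite_carrier mds S] _ _ _ _ lk(3)])
      fix n assume n: "n \<in> S"
      show "(\<Oplus>k\<in>{1..K}. W i \<omega> (l, k) \<otimes> gen k n) = (\<Oplus>k\<in>{1..K}. W i \<omega>' (l, k) \<otimes> gen k n)"
        using fun_cong[OF fun_cong[OF eq[OF n]], of i l] i lk(2) by (simp add: stored_def)
    qed (use Wf lk gen in auto)
    then show "W i \<omega> lk = W i \<omega>' lk" by (simp add: lk)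
  qed
qed

text \<open>Given the files in \<open>B\<close>, a server stores one unknown symbol per row of each
  other file. Summed over \<open>K\<close> servers these bounds equal the entropy of the remaining
  files, so they turn out to be tight.\<close>

lemma entropy_stored_le:
  assumes mds: "mds_generator R K N gen" and n: "n \<in> {1..N}" and B: "B \<subseteq> {1..m}"
  shows "\<H>(\<lambda>\<omega>. (stored n \<omega>, fil B \<omega>, key \<omega>)) \<le>
    \<H>(\<lambda>\<omega>. (fil B \<omega>, key \<omega>)) + (real m - real (card B)) * real L"
proof -
  have gen: "gen k n \<in> carrier R" if "k \<in> {1..K}" for k
    using mds n that unfolding mds_generator_def by blast
  let ?X = "\<lambda>\<omega>. \<lambda>i\<in>{1..m} - B. stored n \<omega> i"
  let ?V = "({1..m} - B) \<rightarrow>\<^sub>E {1..L} \<rightarrow>\<^sub>E carrier R"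
  have sX: "simple_function M ?X"
    by (rule simple_function_det[OF simple_sto[of n]]) simp
  have "\<H>(\<lambda>\<omega>. (stored n \<omega>, fil B \<omega>, key \<omega>)) \<le> \<H>(\<lambda>\<omega>. (fil B \<omega>, key \<omega>)) + \<H>(?X)"
  proof (rule entropy_subadditive)
    fix \<omega> \<omega>' assume eq: "(fil B \<omega>, key \<omega>) = (fil B \<omega>', key \<omega>')" "?X \<omega> = ?X \<omega>'"
    have "stored n \<omega> i = stored n \<omega>' i" for i
    proof (cases "i \<in> {1..m} - B")
      case True
      then show ?thesis
        using eq(2) unfolding restrict_eq_iff by blast
    next
      case False
      then show ?thesis
        using eq(1) by (auto simp: stored_def tuple_eq_iffs)
    qed
    then have "stored n \<omega> = stored n \<omega>'" by blast
    then show "(stored n \<omega>, fil B \<omega>, key \<omega>) = (stored n \<omega>', fil B \<omega>', key \<omega>')"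
      using eq by simp
  qed (use B sX in \<open>auto intro!: simple_intros\<close>)
  also have "\<H>(?X) \<le> log b (real (card (?X ` space M)))"
    by (rule entropy_le_card[OF simple_distributed_prob[OF sX]])
  also have "\<dots> \<le> log b (real (card ?V))"
  proof (rule log_mono[OF b_gt_1])
    have fin: "finite ?V"
      using finite_carrier by (intro finite_PiE) auto
    have sub: "?X ` space M \<subseteq> ?V"
    proof (intro image_subsetI restrict_PiE_iff[THEN iffD2] ballI)
      fix \<omega> i assume \<omega>: "\<omega> \<in> space M" and i: "i \<in> {1..m} - B"
      have "W i \<omega> \<in> {1..L} \<times> {1..K} \<rightarrow>\<^sub>E carrier R"
        using W_files[of i \<omega>] i \<omega> by (simp add: files_def)
      then show "stored n \<omega> i \<in> {1..L} \<rightarrow>\<^sub>E carrier R"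
        using i gen by (auto simp: stored_def intro!: finsum_closed m_closed)
    qed
    show "real (card (?X ` space M)) \<le> real (card ?V)"
      using card_mono[OF fin sub] by simp
    have "?X ` space M \<noteq> {}" using not_empty by auto
    then show "0 < real (card (?X ` space M))"
      using finite_subset[OF sub fin] by (simp add: card_gt_0_iff)
  qed
  also have "real (card ?V) = b ^ (L * (m - card B))"
    using B by (simp add: card_PiE base card_Diff_subset finite_subset power_mult)
  also have "log b \<dots> = (real m - real (card B)) * real L"
    using b_gt_1 card_mono[OF _ B] by (simp add: log_nat_power of_nat_diff)
  finally show ?thesis by simp
qed

text \<open>Any \<open>K\<close> stored vectors are independent given the files in \<open>B\<close>; hence so are the answers
  computed from them.\<close>

lemma entropy_answers_independent:
  assumes mds: "mds_generator R K N gen" and S: "S \<subseteq> {1..N}" "card S = K" and B: "B \<subseteq> {1..m}"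
  shows "(\<Sum>n\<in>S. \<H>(\<lambda>\<omega>. (ans p {n} \<omega>, fil B \<omega>, key \<omega>)) - \<H>(\<lambda>\<omega>. (fil B \<omega>, key \<omega>))) \<le>
    \<H>(\<lambda>\<omega>. (ans p S \<omega>, fil B \<omega>, key \<omega>)) - \<H>(\<lambda>\<omega>. (fil B \<omega>, key \<omega>))"
proof -
  let ?f = "\<lambda>n. \<H>(\<lambda>\<omega>. (ans p {n} \<omega>, fil B \<omega>, key \<omega>))"
  let ?k = "\<lambda>n. \<H>(\<lambda>\<omega>. (stored n \<omega>, fil B \<omega>, key \<omega>))"
  let ?b = "\<H>(\<lambda>\<omega>. (fil B \<omega>, key \<omega>))"
  have finS: "finite S" using S(1) finite_subset by blast
  \<comment> \<open>Stored vectors are added one server at a time. As the answer of server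
    \<open>n\<close> is already present, its vector adds at most \<open>?k n - ?f n\<close>. The
    vectors of all of \<open>S\<close> determine every file, which leaves no slack.\<close>
  have "\<H>(\<lambda>\<omega>. (sto S' \<omega>, ans p S \<omega>, fil B \<omega>, key \<omega>)) \<le>
      \<H>(\<lambda>\<omega>. (ans p S \<omega>, fil B \<omega>, key \<omega>)) + (\<Sum>n\<in>S'. ?k n - ?f n)" if "finite S'" "S' \<subseteq> S" for S'
    using that
  proof (induction S')
    case empty
    have "\<H>(\<lambda>\<omega>. (sto {} \<omega>, ans p S \<omega>, fil B \<omega>, key \<omega>)) \<le> \<H>(\<lambda>\<omega>. (ans p S \<omega>, fil B \<omega>, key \<omega>))"
      using S B by (intro entropy_mono simple_intros) (auto simp: tuple_eq_iffs)
    then show ?case by (simp only: sum.empty add_0_right)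
  next
    case (insert n S')
    have S'N: "S' \<subseteq> {1..N}" "{n} \<subseteq> {1..N}" using insert.prems S by auto
    have "\<H>(\<lambda>\<omega>. (sto (insert n S') \<omega>, ans p S \<omega>, fil B \<omega>, key \<omega>)) + ?f n \<le>
        \<H>(\<lambda>\<omega>. (sto S' \<omega>, ans p S \<omega>, fil B \<omega>, key \<omega>)) + ?k n"
      by (intro entropy_submodular simple_intros S'N S B)
        (use insert.prems in \<open>auto simp: tuple_eq_iffs intro: A_cong Q_cong\<close>)
    then show ?case
      using insert by simp
  qed
  from this[OF finS order_refl]
  have "\<H>(\<lambda>\<omega>. (sto S \<omega>, ans p S \<omega>, fil B \<omega>, key \<omega>)) \<le>
      \<H>(\<lambda>\<omega>. (ans p S \<omega>, fil B \<omega>, key \<omega>)) + (\<Sum>n\<in>S. ?k n - ?f n)" .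
  moreover have "\<H>(\<lambda>\<omega>. (fil {1..m} \<omega>, key \<omega>)) \<le> \<H>(\<lambda>\<omega>. (sto S \<omega>, ans p S \<omega>, fil B \<omega>, key \<omega>))"
  proof (rule entropy_mono)
    fix \<omega> \<omega>' assume \<omega>: "\<omega> \<in> space M" "\<omega>' \<in> space M"
      and eq: "(sto S \<omega>, ans p S \<omega>, fil B \<omega>, key \<omega>) = (sto S \<omega>', ans p S \<omega>', fil B \<omega>', key \<omega>')"
    have "W i \<omega> = W i \<omega>'" if "i \<in> {1..m}" for i
      using eq by (intro stored_determines[OF mds S \<omega> _ that]) (simp add: tuple_eq_iffs)
    then show "(fil {1..m} \<omega>, key \<omega>) = (fil {1..m} \<omega>', key \<omega>')"
      using eq by (simp add: tuple_eq_iffs)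
  qed (intro simple_intros S(1) B)
  moreover have "(\<Sum>n\<in>S. ?k n - ?f n) \<le>
      (\<Sum>n\<in>S. (real m - real (card B)) * real L - (?f n - ?b))"
    using entropy_stored_le[OF mds _ B] S(1) by (intro sum_mono) (auto simp: algebra_simps)
  moreover have "(\<Sum>n\<in>S. (real m - real (card B)) * real L - (?f n - ?b)) =
      real K * ((real m - real (card B)) * real L) - (\<Sum>n\<in>S. ?f n - ?b)"
    unfolding sum_subtractf[of "\<lambda>_. (real m - real (card B)) * real L"] using S(2) by simp
  moreover have "\<H>(\<lambda>\<omega>. (fil {1..m} \<omega>, key \<omega>)) - ?b = real K * ((real m - real (card B)) * real L)"
    using entropy_files_key[OF B] entropy_files_key[of "{1..m}"] by (simp add: algebra_simps)
  ultimately show ?thesis by linarith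
qed

text \<open>Multiplied out to avoid division. With \<open>t = T * K\<close> both cases become a
  statement about \<open>t\<close>-subsets of the servers, and \<open>t / N\<close> is the share of
  these subsets that contain a given server.\<close>

lemma download_ge:
  assumes mds: "mds_generator R K N gen" and N: "N \<ge> 1"
    and p: "p \<in> demands" "p' \<in> demands" "p \<union> p' = {1..m}" and KT: "K = 1 \<and> T \<le> N \<or> T = 1 \<and> K \<le> N"
  shows "real N * (\<Sum>n\<in>{1..N}. \<H>(A p n)) \<ge>
    real L * real K * (real N * real P + real T * real K * (real m - real P))"
proof -
  let ?b = "\<H>(\<lambda>\<omega>. (fil p \<omega>, key \<omega>))" and ?z = "\<H>(\<lambda>\<omega>. key \<omega>)"
  let ?f = "\<lambda>p' S. \<H>(\<lambda>\<omega>. (ans p' S \<omega>, fil p \<omega>, key \<omega>))"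
  let ?D = "\<Sum>n\<in>{1..N}. \<H>(A p n)"
  let ?U = "real m - real P"
  have pm: "p \<subseteq> {1..m}" "card p = P" "p' \<subseteq> {1..m}" using p by (auto simp: demands_def)
  have f_empty: "?f p' {} = ?b" for p'
    using pm by (intro entropy_eqI simple_intros) (auto simp: tuple_eq_iffs)
  have submod: "?f p' (S \<union> S') + ?f p' (S \<inter> S') \<le> ?f p' S + ?f p' S'"
    if "S \<subseteq> {1..N}" "S' \<subseteq> {1..N}" for p' S S'
    unfolding ans_def by (rule entropy_family_submodular[where A="{1..N}"]) (use that pm in \<open>auto intro!: simple_intros\<close>)
  \<comment> \<open>The files of \<open>p\<close> are part of \<open>?f p {1..N}\<close>, but they
    add nothing to the answers and the key, from which they are decoded.\<close>
  have "?f p {1..N} - ?z \<le> ?D"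
  proof -
    have "?f p {1..N} \<le> \<H>(\<lambda>\<omega>. ((ans p {1..N} \<omega>, key \<omega>), fil p \<omega>))"
      using pm by (intro entropy_mono simple_intros) auto
    also have "\<dots> \<le> \<H>(\<lambda>\<omega>. (ans p {1..N} \<omega>, key \<omega>))"
      using p(1) by (rule entropy_decode) (auto intro!: simple_intros)
    also have "\<dots> \<le> \<H>(ans p {1..N}) + ?z"
      by (intro entropy_subadditive simple_intros) auto
    also have "\<H>(ans p {1..N}) \<le> ?D"
    proof -
      let ?g = "\<lambda>S. \<H>(\<lambda>\<omega>. (ans p S \<omega>, ()))"
      have g: "?g {} = 0"
      proof -
        have "(\<lambda>\<omega>. (ans p {} \<omega>, ())) = (\<lambda>\<omega>. (\<lambda>_. undefined, ()))"
          by (simp add: ans_def restrict_def)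
        then show ?thesis
          by (simp only: entropy_const)
      qed
      have "?g {1..N} - ?g {} \<le> (\<Sum>n\<in>{1..N}. ?g {n} - ?g {})"
      proof (rule subadditive_sum_le)
        show "?g (S \<union> S') + ?g (S \<inter> S') \<le> ?g S + ?g S'" if "S \<subseteq> {1..N}" "S' \<subseteq> {1..N}" for S S'
          unfolding ans_def by (rule entropy_family_submodular[where A="{1..N}"]) (use that in \<open>auto intro!: simple_intros\<close>)
      qed auto
      moreover have "?g {n} = \<H>(A p n)" if "n \<in> {1..N}" for n
        using that by (intro entropy_eqI simple_intros) (auto simp: tuple_eq_iffs)
      moreover have "\<H>(ans p {1..N}) = ?g {1..N}"
        by (intro entropy_eqI simple_intros) auto
      ultimately show ?thesis
        using g by simp
    qed
    finally show ?thesis by simp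
  qed
  then have D_ge: "?f p S - ?z \<le> ?D" if "S \<subseteq> {1..N}" for S
  proof -
    have "?f p S \<le> ?f p {1..N}"
      using that pm by (intro entropy_mono simple_intros) (auto simp: tuple_eq_iffs)
    then show ?thesis
      using \<open>?f p {1..N} - ?z \<le> ?D\<close> by linarith
  qed
  have b: "?b - ?z = real P * (real L * real K)"
    using entropy_files_key[OF pm(1)] pm(2) by simp
  \<comment> \<open>Given the files of \<open>p\<close>, the answers to \<open>p'\<close> reveal all
    others, because the two demands cover all files.\<close>
  have full: "?U * (real L * real K) \<le> ?f p' {1..N} - ?b"
  proof -
    have "\<H>(\<lambda>\<omega>. (fil {1..m} \<omega>, key \<omega>)) \<le> \<H>(\<lambda>\<omega>. ((ans p' {1..N} \<omega>, fil p \<omega>, key \<omega>), fil p' \<omega>))"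
      unfolding p(3)[symmetric]
      using pm by (intro entropy_mono simple_intros) (auto simp: tuple_eq_iffs)
    also have "\<dots> \<le> ?f p' {1..N}"
      using p(2) pm by (intro entropy_decode simple_intros) auto
    finally show ?thesis
      using entropy_files_key[of "{1..m}"] b by (simp add: algebra_simps)
  qed
  let ?c = "\<lambda>t. real (N choose t)" and ?d = "\<lambda>t. real ((N choose t) - ((N - 1) choose t))"
  have d: "real N * ?d t = real t * ?c t" for t
    by (rule choose_diff_absorb[OF N])
  have sum_D: "(\<Sum>S | S \<subseteq> {1..N} \<and> card S = t. ?f p S - ?b) \<le> ?c t * (?D + ?z - ?b)" for t
  proof -
    have "(\<Sum>S | S \<subseteq> {1..N} \<and> card S = t. ?f p S - ?b) \<le>
        (\<Sum>S | S \<subseteq> {1..N} \<and> card S = t. ?D + ?z - ?b)"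
    proof (rule sum_mono)
      fix S assume "S \<in> {S. S \<subseteq> {1..N} \<and> card S = t}"
      then show "?f p S - ?b \<le> ?D + ?z - ?b"
        using D_ge[of S] by simp
    qed
    then show ?thesis
      using n_subsets[of "{1..N}" t] by simp
  qed
  \<comment> \<open>Privacy exchanges the demands only on sets of \<open>T\<close> servers. For
    \<open>K = 1\<close> these are the \<open>t\<close>-subsets, and Han's inequality comes before
    the exchange.\<close>
  obtain t where t: "t = T * K" "t \<le> N" and
    key_ineq: "?d t * (?f p' {1..N} - ?b) \<le> (\<Sum>S | S \<subseteq> {1..N} \<and> card S = t. ?f p S - ?b)"
  proof (cases "K = 1")
    case True
    have "?d T * (?f p' {1..N} - ?f p' {}) \<le> (\<Sum>S | S \<subseteq> {1..N} \<and> card S = T. ?f p' S - ?f p' {})"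
      by (rule han_inequality) (rule submod)
    also have "\<dots> = (\<Sum>S | S \<subseteq> {1..N} \<and> card S = T. ?f p S - ?b)"
      unfolding f_empty using entropy_answers_demand_free[OF p(1,2) _ _ pm(1)] by (intro sum.cong) auto
    finally have "?d T * (?f p' {1..N} - ?b) \<le> (\<Sum>S | S \<subseteq> {1..N} \<and> card S = T. ?f p S - ?b)"
      unfolding f_empty .
    moreover have "T = T * K" "T \<le> N"
      using True KT N by auto
    ultimately show ?thesis
      by (intro that)
  next
    case False
    then have T: "T = 1" "K \<le> N" using KT by auto
    \<comment> \<open>For \<open>T = 1\<close> the exchange happens at single servers. The passage
      to \<open>K\<close>-subsets comes afterwards, for \<open>p\<close>: there the conditional
      entropies of single answers sum to at most that of the \<open>K\<close> answers
      together.\<close>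
    have "?f p' {1..N} - ?f p' {} \<le> (\<Sum>n\<in>{1..N}. ?f p' {n} - ?f p' {})"
      by (rule subadditive_sum_le[where A="{1..N}"]) (auto intro!: submod)
    also have "\<dots> = (\<Sum>n\<in>{1..N}. ?f p {n} - ?b)"
      unfolding f_empty using entropy_answers_demand_free[OF p(1,2) _ _ pm(1)] T by (intro sum.cong) auto
    finally have "?d K * (?f p' {1..N} - ?b) \<le> ?d K * (\<Sum>n\<in>{1..N}. ?f p {n} - ?b)"
      unfolding f_empty by (intro mult_left_mono) auto
    also have "\<dots> = (\<Sum>S | S \<subseteq> {1..N} \<and> card S = K. \<Sum>n\<in>S. ?f p {n} - ?b)"
      using sum_subsets[of "{1..N}" "\<lambda>n. ?f p {n} - ?b" K] by simp
    also have "\<dots> \<le> (\<Sum>S | S \<subseteq> {1..N} \<and> card S = K. ?f p S - ?b)"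
      using entropy_answers_independent[OF mds _ _ pm(1)] by (intro sum_mono) auto
    finally have "?d K * (?f p' {1..N} - ?b) \<le> (\<Sum>S | S \<subseteq> {1..N} \<and> card S = K. ?f p S - ?b)" .
    moreover have "K = T * K"
      using T by simp
    ultimately show ?thesis
      using T(2) by (intro that)
  qed
  have "?d t * (?U * (real L * real K)) \<le> ?d t * (?f p' {1..N} - ?b)"
    using full by (intro mult_left_mono) auto
  then have "?d t * (?U * (real L * real K)) \<le> ?c t * (?D - real P * (real L * real K))"
    using key_ineq sum_D[of t] b by (simp add: algebra_simps)
  then have "real N * (?d t * (?U * (real L * real K))) \<le> real N * (?c t * (?D - real P * (real L * real K)))"
    by (rule mult_left_mono) simp
  moreover have "real N * (?d t * X) = ?c t * (real t * X)" for X
  proof -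
    have "real N * (?d t * X) = (real t * ?c t) * X"
      by (simp only: d[symmetric] mult.assoc)
    then show ?thesis
      by (simp only: mult_ac)
  qed
  ultimately have "?c t * (real t * (?U * (real L * real K))) \<le> ?c t * (real N * (?D - real P * (real L * real K)))"
    by (simp only: mult.left_commute[of "real N" "?c t"])
  moreover have "?c t > 0"
    using t(2) by (simp add: zero_less_binomial)
  ultimately have "real t * (?U * (real L * real K)) \<le> real N * (?D - real P * (real L * real K))"
    by simp
  then show ?thesis
    using t(1) by (simp add: algebra_simps)
qed

end

section \<open>The code and the queries\<close>

definition positions :: "nat \<Rightarrow> nat \<Rightarrow> nat \<Rightarrow> (nat set \<times> nat) set" where
  "positions N K r = {D. D \<subseteq> {1..N} \<and> card D = K} \<times> {..<r}"

lemma finite_positions [simp]: "finite (positions N K r)"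
  unfolding positions_def by simp

lemma card_positions: "card (positions N K r) = (N choose K) * r"
  using n_subsets[of "{1..N}" K] by (simp add: positions_def card_cartesian_product)

text \<open>Position \<open>(D, s)\<close> is the \<open>s\<close>-th symbol requested from the servers in \<open>D\<close>; \<open>info\<close>
  consists of the positions of the first stage, \<open>s < \<rho>\<close>. The points \<open>x\<close> and \<open>z\<close> define Vandermonde
  matrices, \<open>x\<close> for combining files and \<open>z\<close> for the code, whose coordinates are numbered by \<open>\<tau>\<close>.\<close>

locale mds_pir_code = field R for R :: "('a, 'c) ring_scheme" (structure) +
  fixes N K T m P :: nat
    and gen :: "nat \<Rightarrow> nat \<Rightarrow> 'a" and x :: "nat \<Rightarrow> 'a"
    and z :: "nat set \<times> nat \<Rightarrow> 'a" and \<tau> :: "nat set \<times> nat \<Rightarrow> nat"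
    and \<alpha> \<rho> L :: nat and pos info :: "(nat set \<times> nat) set"
  defines "\<alpha> \<equiv> N choose K" and "\<rho> \<equiv> (N choose K) - ((N - T) choose K)"
    and "L \<equiv> (N choose K) * (N choose K)"
    and "pos \<equiv> positions N K (N choose K)"
    and "info \<equiv> positions N K ((N choose K) - ((N - T) choose K))"
  assumes finite_carrier: "finite (carrier R)" and mds: "mds_generator R K N gen"
    and TN: "T \<le> N" and K_pos: "1 \<le> K" and Pm: "P \<le> m"
    and x: "x \<in> {1..m} \<rightarrow> carrier R" "inj_on x {1..m}"
    and z: "z \<in> pos \<rightarrow> carrier R" "inj_on z pos"
    and \<tau>: "bij_betw \<tau> info {..<card info}"
begin

declare One_nat_def [simp del]

definition vect :: "'i set \<Rightarrow> ('i \<Rightarrow> 'a) set" where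
  "vect I = I \<rightarrow>\<^sub>E carrier R"

text \<open>The matrix with columns \<open>w k\<close>, applied to \<open>g\<close>. For
  \<open>g\<close> a column of the generator matrix this is what a server stores of a file.\<close>

definition comb :: "'i set \<Rightarrow> (nat \<Rightarrow> 'i \<Rightarrow> 'a) \<Rightarrow> (nat \<Rightarrow> 'a) \<Rightarrow> 'i \<Rightarrow> 'a" where
  "comb I w g = (\<lambda>i\<in>I. \<Oplus>k\<in>{1..K}. w k i \<otimes> g k)"

text \<open>The random bases, as maps from vectors to their coordinates. They are bijections because
  \<open>pos\<close> has \<open>L\<close> elements. Compatibility with combinations of
  \<open>K\<close> vectors is what decoding from stored vectors uses; it amounts to linearity for
  \<open>K \<ge> 2\<close> and to homogeneity for \<open>K = 1\<close>.\<close>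

definition keys :: "((nat \<Rightarrow> 'a) \<Rightarrow> nat set \<times> nat \<Rightarrow> 'a) set" where
  "keys = {U \<in> vect {1..L} \<rightarrow>\<^sub>E vect pos. inj_on U (vect {1..L}) \<and>
     (\<forall>w\<in>{1..K} \<rightarrow> vect {1..L}. \<forall>g\<in>{1..K} \<rightarrow> carrier R.
        U (comb {1..L} w g) = comb pos (\<lambda>k. U (w k)) g)}"

text \<open>An evaluation code of Reed-Solomon type: the coordinates of \<open>v\<close> in
  \<open>info\<close> are the coefficients of a polynomial, which is evaluated at the points
  \<open>z j\<close>. The other coordinates of \<open>v\<close> are discarded.\<close>

definition code :: "(nat set \<times> nat \<Rightarrow> 'a) \<Rightarrow> nat set \<times> nat \<Rightarrow> 'a" where
  "code v = (\<lambda>j\<in>pos. \<Oplus>t\<in>info. v t \<otimes> z j [^] \<tau> t)"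

definition seen :: "nat set \<Rightarrow> (nat set \<times> nat) set" where
  "seen S = {j \<in> pos. fst j \<inter> S \<noteq> {}}"

definition symbol :: "nat set \<Rightarrow> (nat \<Rightarrow> (nat \<Rightarrow> 'a) \<Rightarrow> nat set \<times> nat \<Rightarrow> 'a) \<Rightarrow>
    nat \<Rightarrow> nat set \<times> nat \<Rightarrow> (nat \<Rightarrow> 'a) \<Rightarrow> 'a" where
  "symbol p f i j v = (if i \<in> p then f i v j else code (f i v) j)"

text \<open>A query consists of functions, one for each file and visible position; their values at
  the stored vectors are the requested symbols.\<close>

definition queried :: "nat set \<Rightarrow> nat \<Rightarrow> (nat \<Rightarrow> (nat \<Rightarrow> 'a) \<Rightarrow> nat set \<times> nat \<Rightarrow> 'a) \<Rightarrow>
    nat \<Rightarrow> nat set \<times> nat \<Rightarrow> (nat \<Rightarrow> 'a) \<Rightarrow> 'a" where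
  "queried p n f = (\<lambda>i\<in>{1..m}. \<lambda>j\<in>seen {n}. \<lambda>v\<in>vect {1..L}. symbol p f i j v)"

text \<open>The second component is an exponent that selects a Vandermonde combination of the files.
  All \<open>m\<close> combinations amount to a separate download of every file; later positions use
  only \<open>P\<close> of them.\<close>

definition coords :: "nat \<Rightarrow> ((nat set \<times> nat) \<times> nat) set" where
  "coords n = (SIGMA j : seen {n}. {..<if snd j < \<rho> then m else P})"

definition reply :: "nat \<Rightarrow> (nat \<Rightarrow> nat set \<times> nat \<Rightarrow> (nat \<Rightarrow> 'a) \<Rightarrow> 'a) \<Rightarrow> (nat \<Rightarrow> nat \<Rightarrow> 'a) \<Rightarrow>
    (nat set \<times> nat) \<times> nat \<Rightarrow> 'a" where
  "reply n c y = (\<lambda>(j, e)\<in>coords n. \<Oplus>i\<in>{1..m}. c i j (y i) \<otimes> x i [^] e)"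

definition column :: "(nat \<times> nat \<Rightarrow> 'a) \<Rightarrow> nat \<Rightarrow> nat \<Rightarrow> 'a" where
  "column w k = (\<lambda>l\<in>{1..L}. w (l, k))"

definition store :: "nat \<Rightarrow> (nat \<Rightarrow> nat \<times> nat \<Rightarrow> 'a) \<Rightarrow> nat \<Rightarrow> nat \<Rightarrow> 'a" where
  "store n w = (\<lambda>i\<in>{1..m}. \<lambda>l\<in>{1..L}. \<Oplus>k\<in>{1..K}. w i (l, k) \<otimes> gen k n)"

lemma vectI: "(\<And>i. i \<in> I \<Longrightarrow> f i \<in> carrier R) \<Longrightarrow> (\<lambda>i\<in>I. f i) \<in> vect I"
  by (simp add: vect_def)

lemma vectD: "v \<in> vect I \<Longrightarrow> i \<in> I \<Longrightarrow> v i \<in> carrier R"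
  by (auto simp: vect_def)

lemma vect_eqI: "u \<in> vect I \<Longrightarrow> v \<in> vect I \<Longrightarrow> (\<And>i. i \<in> I \<Longrightarrow> u i = v i) \<Longrightarrow> u = v"
  unfolding vect_def by (rule PiE_ext)

lemma finite_pos [simp]: "finite pos" and finite_info [simp]: "finite info"
  and finite_seen [simp]: "finite (seen S)"
  unfolding pos_def info_def seen_def by simp_all

lemma finite_coords [simp]: "finite (coords n)"
  unfolding coords_def by simp

lemma info_subset: "info \<subseteq> pos"
  unfolding info_def pos_def positions_def by auto

lemma seen_subset: "seen S \<subseteq> pos"
  unfolding seen_def by auto

lemma card_seen:
  assumes "S \<subseteq> {1..N}"
  shows "card (seen S) = ((N choose K) - ((N - card S) choose K)) * \<alpha>"
proof -
  have "seen S = {D. D \<subseteq> {1..N} \<and> card D = K \<and> D \<inter> S \<noteq> {}} \<times> {..<\<alpha>}"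
    by (auto simp: seen_def pos_def positions_def \<alpha>_def)
  then show ?thesis
    using card_subsets_meeting[OF _ assms, of K] by (simp add: card_cartesian_product)
qed

lemma card_info: "card info = \<alpha> * \<rho>"
  by (simp add: info_def card_positions \<alpha>_def \<rho>_def)

lemma card_pos: "card pos = L"
  by (simp add: pos_def card_positions L_def)

lemma card_coords:
  assumes "n \<in> {1..N}"
  shows "card (coords n) = ((N choose K) - ((N - 1) choose K)) * (\<rho> * m + (\<alpha> - \<rho>) * P)"
proof -
  let ?A = "{D. D \<subseteq> {1..N} \<and> card D = K \<and> D \<inter> {n} \<noteq> {}}"
  have seen: "seen {n} = ?A \<times> {..<\<alpha>}"
    by (auto simp: seen_def pos_def positions_def \<alpha>_def)
  have "\<rho> \<le> \<alpha>" by (simp add: \<rho>_def \<alpha>_def)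
  have "card (coords n) = (\<Sum>j\<in>?A \<times> {..<\<alpha>}. if snd j < \<rho> then m else P)"
    unfolding coords_def seen[symmetric] by (subst card_SigmaI) auto
  also have "\<dots> = (\<Sum>D\<in>?A. \<Sum>s<\<alpha>. if s < \<rho> then m else P)"
    unfolding sum.cartesian_product by (intro sum.cong) auto
  also have "(\<Sum>s<\<alpha>. if s < \<rho> then m else P) = (\<Sum>s<\<rho>. m) + (\<Sum>s\<in>{\<rho>..<\<alpha>}. P)"
  proof -
    have "{..<\<alpha>} \<inter> {s. s < \<rho>} = {..<\<rho>}" "{..<\<alpha>} \<inter> - {s. s < \<rho>} = {\<rho>..<\<alpha>}"
      using \<open>\<rho> \<le> \<alpha>\<close> by auto
    then show ?thesis
      by (subst sum.If_cases) auto
  qed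
  also have "(\<Sum>D\<in>?A. (\<Sum>s<\<rho>. m) + (\<Sum>s\<in>{\<rho>..<\<alpha>}. P)) = card ?A * (\<rho> * m + (\<alpha> - \<rho>) * P)"
    by simp
  finally show ?thesis
    using card_subsets_meeting[of "{1..N}" "{n}" K] assms by (simp add: One_nat_def)
qed

section \<open>Properties of the code and of the keys\<close>

lemma code_vect: "v \<in> vect pos \<Longrightarrow> code v \<in> vect pos"
  unfolding code_def using z info_subset
  by (intro vectI finsum_closed) (auto intro!: m_closed elim: vectD)

text \<open>Any \<open>card info\<close> coordinates form a square Vandermonde system. Its rows are
  labelled by positions, while recovering coefficients needs independence of the rows labelled by
  \<open>info\<close>, hence the transposition.\<close>

lemma code_inj:
  assumes J: "J \<subseteq> pos" "card J = card info" and u: "u \<in> vect pos" "v \<in> vect pos"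
    and eq: "\<And>j. j \<in> J \<Longrightarrow> code u j = code v j" and t: "t \<in> info"
  shows "u t = v t"
proof -
  have fin: "finite J" using J(1) finite_pos finite_subset by blast
  have zJ: "z \<in> J \<rightarrow> carrier R" "inj_on z J"
    using z J(1) by (auto intro: inj_on_subset)
  have "indep_rows (\<lambda>j t. z j [^] \<tau> t) J info"
    using J \<tau> fin zJ by (intro vandermonde_indep_rows) (auto simp: bij_betw_def)
  from indep_rows_transpose[OF finite_carrier fin finite_info J(2) _ this]
  have rows: "indep_rows (\<lambda>t j. z j [^] \<tau> t) info J"
    using zJ by auto
  show ?thesis
  proof (rule indep_rows_eqD[OF rows _ _ _ _ t])
    fix j assume j: "j \<in> J"
    then show "(\<Oplus>t\<in>info. u t \<otimes> z j [^] \<tau> t) = (\<Oplus>t\<in>info. v t \<otimes> z j [^] \<tau> t)"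
      using eq[OF j] J(1) by (auto simp: code_def)
  qed (use u zJ info_subset in \<open>auto elim: vectD\<close>)
qed

lemma code_eqI:
  assumes "u \<in> vect pos" "v \<in> vect pos" and eq: "\<And>t. t \<in> info \<Longrightarrow> u t = v t"
  shows "code u = code v"
  unfolding code_def using assms info_subset z
  by (intro restrict_ext finsum_cong') (auto intro!: m_closed elim: vectD)

lemma comb_vect: "w \<in> {1..K} \<rightarrow> vect I \<Longrightarrow> g \<in> {1..K} \<rightarrow> carrier R \<Longrightarrow> comb I w g \<in> vect I"
  unfolding comb_def by (intro vectI finsum_closed) (auto intro!: m_closed elim: vectD)

lemma code_comb:
  assumes w: "w \<in> {1..K} \<rightarrow> vect pos" and g: "g \<in> {1..K} \<rightarrow> carrier R"
  shows "code (comb pos w g) = comb pos (\<lambda>k. code (w k)) g"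
proof
  fix j
  show "code (comb pos w g) j = comb pos (\<lambda>k. code (w k)) g j"
  proof (cases "j \<in> pos")
    case True
    have wc: "w k t \<in> carrier R" if "k \<in> {1..K}" "t \<in> pos" for k t
      using w that by (auto simp: vect_def)
    have zc: "z j \<in> carrier R" using z True by auto
    have gc: "g k \<in> carrier R" if "k \<in> {1..K}" for k using g that by auto
    have "code (comb pos w g) j = (\<Oplus>t\<in>info. (\<Oplus>k\<in>{1..K}. w k t \<otimes> g k) \<otimes> z j [^] \<tau> t)"
      unfolding code_def using True info_subset wc zc gc
      by (auto simp: comb_def intro!: finsum_cong' finsum_closed m_closed)
    also have "\<dots> = (\<Oplus>t\<in>info. z j [^] \<tau> t \<otimes> (\<Oplus>k\<in>{1..K}. w k t \<otimes> g k))"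
      using info_subset wc zc gc by (intro finsum_cong') (auto intro!: m_comm m_closed finsum_closed)
    also have "\<dots> = (\<Oplus>k\<in>{1..K}. (\<Oplus>t\<in>info. z j [^] \<tau> t \<otimes> w k t) \<otimes> g k)"
      using info_subset wc zc gc by (intro finsum_bilinear_swap) auto
    also have "\<dots> = (\<Oplus>k\<in>{1..K}. (\<Oplus>t\<in>info. w k t \<otimes> z j [^] \<tau> t) \<otimes> g k)"
    proof -
      have "(\<Oplus>t\<in>info. z j [^] \<tau> t \<otimes> w k t) = (\<Oplus>t\<in>info. w k t \<otimes> z j [^] \<tau> t)" if "k \<in> {1..K}" for k
        using info_subset wc[OF that] zc by (intro finsum_cong') (auto intro!: m_comm)
      moreover have "(\<Oplus>t\<in>info. w k t \<otimes> z j [^] \<tau> t) \<in> carrier R" if "k \<in> {1..K}" for k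
        using info_subset wc[OF that] zc by (intro finsum_closed) auto
      ultimately show ?thesis
        using gc by (intro finsum_cong') auto
    qed
    also have "\<dots> = comb pos (\<lambda>k. code (w k)) g j"
      using True by (simp add: comb_def code_def)
    finally show ?thesis .
  qed (auto simp: code_def comb_def)
qed

lemma keys_vect: "U \<in> keys \<Longrightarrow> v \<in> vect {1..L} \<Longrightarrow> U v \<in> vect pos"
  unfolding keys_def by auto

lemma finite_vect: "finite I \<Longrightarrow> finite (vect I)"
  unfolding vect_def using finite_carrier by (auto intro: finite_PiE)

lemma finite_keys: "finite keys"
  unfolding keys_def by (rule finite_subset[of _ "vect {1..L} \<rightarrow>\<^sub>E vect pos"])
    (auto intro!: finite_PiE finite_vect)

lemma keys_nonempty: "keys \<noteq> {}"
proof -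
  obtain h where h: "bij_betw h pos {1..L}"
    using finite_same_card_bij[of pos "{1..L}"] card_pos by auto
  \<comment> \<open>Renaming the coordinates along the bijection \<open>h\<close> is the simplest
    key.\<close>
  define U where "U = (\<lambda>v\<in>vect {1..L}. \<lambda>j\<in>pos. v (h j))"
  have hL: "h j \<in> {1..L}" if "j \<in> pos" for j
    using h that by (auto simp: bij_betw_def)
  have "inj_on U (vect {1..L})"
  proof (rule inj_onI)
    fix u v assume u: "u \<in> vect {1..L}" and v: "v \<in> vect {1..L}" and eq: "U u = U v"
    show "u = v"
    proof (rule vect_eqI[OF u v])
      fix l assume "l \<in> {1..L}"
      then have "l \<in> h ` pos"
        using h by (simp add: bij_betw_def)
      then obtain j where j: "j \<in> pos" "l = h j"
        by blast
      have "U u j = U v j" by (simp add: eq)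
      then show "u l = v l"
        using u v j by (simp add: U_def)
    qed
  qed
  moreover have "U (comb {1..L} w g) = comb pos (\<lambda>k. U (w k)) g"
    if w: "w \<in> {1..K} \<rightarrow> vect {1..L}" and g: "g \<in> {1..K} \<rightarrow> carrier R" for w g
  proof
    fix j
    show "U (comb {1..L} w g) j = comb pos (\<lambda>k. U (w k)) g j"
    proof (cases "j \<in> pos")
      case True
      have "U (comb {1..L} w g) j = (\<Oplus>k\<in>{1..K}. w k (h j) \<otimes> g k)"
        using True hL[OF True] comb_vect[OF w g] by (simp add: U_def comb_def)
      also have "\<dots> = (\<Oplus>k\<in>{1..K}. U (w k) j \<otimes> g k)"
        using True hL[OF True] w g by (intro finsum_cong') (auto simp: U_def Pi_iff intro!: m_closed intro: vectD)
      finally show ?thesis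
        using True by (simp add: comb_def)
    qed (use comb_vect[OF w g] in \<open>simp add: U_def comb_def\<close>)
  qed
  moreover have "U \<in> vect {1..L} \<rightarrow>\<^sub>E vect pos"
    unfolding U_def using hL by (intro restrict_PiE[THEN iffD2] Pi_I vectI) (auto elim: vectD)
  ultimately have "U \<in> keys"
    unfolding keys_def by simp
  then show ?thesis by auto
qed

text \<open>On the positions seen by \<open>T\<close> servers the code has full rank, so there it can be completed to a
  linear bijection, which permutes the keys.\<close>

lemma queried_private:
  assumes S: "S \<subseteq> {1..N}" "card S = T"
  shows "\<exists>\<sigma>. bij_betw \<sigma> ({1..m} \<rightarrow>\<^sub>E keys) ({1..m} \<rightarrow>\<^sub>E keys) \<and>
    (\<forall>f\<in>{1..m} \<rightarrow>\<^sub>E keys. \<forall>n\<in>S. queried p n f = queried {1..m} n (\<sigma> f))"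
proof -
  let ?J = "seen S"
  \<comment> \<open>Both numbers are \<open>\<alpha> * \<rho>\<close>: on the left \<rho> subsets
    with \<alpha> symbols each, on the right \<alpha> subsets with \<rho> symbols each.\<close>
  have cJ: "card ?J = card info"
    using card_seen[OF S(1)] S(2) by (simp add: card_info \<rho>_def)
  have "card (pos - ?J) = card (pos - info)"
    using cJ seen_subset info_subset by (simp add: card_Diff_subset)
  then obtain h where h: "bij_betw h (pos - ?J) (pos - info)"
    using finite_same_card_bij[of "pos - ?J" "pos - info"] by auto
  \<comment> \<open>On the seen positions \<open>B\<close> encodes. The coordinates outside
    \<open>info\<close>, which \<open>code\<close> discards, are moved by \<open>h\<close> to the
    unseen positions, so that no information is lost.\<close>
  define B where "B v = (\<lambda>j\<in>pos. if j \<in> ?J then code v j else v (h j))" for v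
  have hp: "h j \<in> pos - info" if "j \<in> pos" "j \<notin> ?J" for j
    using h that by (auto simp: bij_betw_def)
  have B_vect: "B v \<in> vect pos" if "v \<in> vect pos" for v
    unfolding B_def using code_vect[OF that] hp that by (intro vectI) (auto intro: vectD)
  have B_inj: "inj_on B (vect pos)"
  proof (rule inj_onI)
    fix u v assume u: "u \<in> vect pos" and v: "v \<in> vect pos" and eq: "B u = B v"
    have eqB: "B u j = B v j" for j by (simp add: eq)
    have 1: "u t = v t" if "t \<in> info" for t
    proof (rule code_inj[OF seen_subset cJ u v _ that])
      fix j assume "j \<in> seen S"
      then show "code u j = code v j"
        using eqB[of j] seen_subset[of S] by (auto simp: B_def split: if_splits)
    qed
    show "u = v"
    proof (rule vect_eqI[OF u v])
      fix t assume t: "t \<in> pos"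
      show "u t = v t"
      proof (cases "t \<in> info")
        case False
        then have "t \<in> h ` (pos - ?J)"
          using h t by (simp add: bij_betw_def)
        then obtain j where "j \<in> pos - ?J" "t = h j"
          by blast
        then show ?thesis
          using eqB[of j] by (simp add: B_def)
      qed (rule 1)
    qed
  qed
  have B_comb: "B (comb pos w g) = comb pos (\<lambda>k. B (w k)) g"
    if w: "w \<in> {1..K} \<rightarrow> vect pos" and g: "g \<in> {1..K} \<rightarrow> carrier R" for w g
  proof
    fix j
    have c: "code (comb pos w g) j = comb pos (\<lambda>k. code (w k)) g j"
      by (simp only: code_comb[OF w g])
    show "B (comb pos w g) j = comb pos (\<lambda>k. B (w k)) g j"
      using hp[of j] c by (auto simp: B_def comb_def)
  qed
  \<comment> \<open>The demand \<open>{1..m}\<close>, for which no file is encoded, serves as a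
    common reference: \<open>\<sigma>\<close> builds the encoding of the undesired files into their
    keys.\<close>
  define \<sigma> where "\<sigma> f = (\<lambda>i\<in>{1..m}. if i \<in> p then f i else (\<lambda>v\<in>vect {1..L}. B (f i v)))"
    for f :: "nat \<Rightarrow> (nat \<Rightarrow> 'a) \<Rightarrow> nat set \<times> nat \<Rightarrow> 'a"
  have BU: "(\<lambda>v\<in>vect {1..L}. B (U v)) \<in> keys" if U: "U \<in> keys" for U
  proof -
    have "inj_on (\<lambda>v. B (U v)) (vect {1..L})"
    proof (rule inj_onI)
      fix u v assume uv: "u \<in> vect {1..L}" "v \<in> vect {1..L}" and eq: "B (U u) = B (U v)"
      have "U u = U v"
        using B_inj eq keys_vect[OF U uv(1)] keys_vect[OF U uv(2)] by (rule inj_onD)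
      then show "u = v"
        using U uv unfolding keys_def by (blast dest: inj_onD)
    qed
    moreover have "B (U (comb {1..L} w g)) = comb pos (\<lambda>k. (\<lambda>v\<in>vect {1..L}. B (U v)) (w k)) g"
      if w: "w \<in> {1..K} \<rightarrow> vect {1..L}" and g: "g \<in> {1..K} \<rightarrow> carrier R" for w g
    proof -
      have Uw: "(\<lambda>k. U (w k)) \<in> {1..K} \<rightarrow> vect pos"
        using w keys_vect[OF U] by auto
      have "B (U (comb {1..L} w g)) = B (comb pos (\<lambda>k. U (w k)) g)"
        using U w g by (auto simp: keys_def)
      also have "\<dots> = comb pos (\<lambda>k. B (U (w k))) g"
        by (rule B_comb[OF Uw g])
      also have "\<dots> = comb pos (\<lambda>k. (\<lambda>v\<in>vect {1..L}. B (U v)) (w k)) g"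
        unfolding comb_def using w g Uw
        by (intro restrict_ext finsum_cong') (auto simp: Pi_iff intro!: m_closed vectD[OF B_vect])
      finally show ?thesis .
    qed
    ultimately have "(\<lambda>v\<in>vect {1..L}. B (U v)) (comb {1..L} w g) =
        comb pos (\<lambda>k. (\<lambda>v\<in>vect {1..L}. B (U v)) (w k)) g"
      if "w \<in> {1..K} \<rightarrow> vect {1..L}" "g \<in> {1..K} \<rightarrow> carrier R" for w g
      using comb_vect[OF that] that by simp
    moreover have "inj_on (\<lambda>v\<in>vect {1..L}. B (U v)) (vect {1..L})"
      using \<open>inj_on (\<lambda>v. B (U v)) (vect {1..L})\<close> by (simp add: inj_on_def)
    moreover have "(\<lambda>v\<in>vect {1..L}. B (U v)) \<in> vect {1..L} \<rightarrow>\<^sub>E vect pos"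
      using B_vect keys_vect[OF U] by auto
    ultimately show ?thesis
      unfolding keys_def by blast
  qed
  have \<sigma>_in: "\<sigma> f \<in> {1..m} \<rightarrow>\<^sub>E keys" if "f \<in> {1..m} \<rightarrow>\<^sub>E keys" for f
    using that BU by (auto simp: \<sigma>_def PiE_iff)
  have "inj_on \<sigma> ({1..m} \<rightarrow>\<^sub>E keys)"
  proof (rule inj_onI)
    fix f g assume f: "f \<in> {1..m} \<rightarrow>\<^sub>E keys" and g: "g \<in> {1..m} \<rightarrow>\<^sub>E keys"
      and \<sigma>_eq: "\<sigma> f = \<sigma> g"
    show "f = g"
    proof (rule PiE_ext[OF f g])
      fix i assume i: "i \<in> {1..m}"
      have eq: "\<sigma> f i v = \<sigma> g i v" for v by (simp add: \<sigma>_eq)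
      have fg: "f i \<in> keys" "g i \<in> keys" using f g i by auto
      show "f i = g i"
      proof (cases "i \<in> p")
        case True
        then show ?thesis using eq i by (auto simp: \<sigma>_def)
      next
        case False
        show ?thesis
        proof (rule PiE_ext[of _ "vect {1..L}" "\<lambda>_. vect pos"])
          fix v assume v: "v \<in> vect {1..L}"
          then have "B (f i v) = B (g i v)"
            using eq[of v] i False by (simp add: \<sigma>_def)
          then show "f i v = g i v"
            using B_inj keys_vect[OF fg(1) v] keys_vect[OF fg(2) v] by (auto dest: inj_onD)
        qed (use fg in \<open>auto simp: keys_def\<close>)
      qed
    qed
  qed
  moreover have "\<sigma> ` ({1..m} \<rightarrow>\<^sub>E keys) = {1..m} \<rightarrow>\<^sub>E keys"
    using calculation \<sigma>_in finite_keys by (intro endo_inj_surj) (auto intro!: finite_PiE)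
  moreover have "queried p n f = queried {1..m} n (\<sigma> f)" if "n \<in> S" for f n
  proof -
    have "symbol p f i j v = symbol {1..m} (\<sigma> f) i j v"
      if "i \<in> {1..m}" "j \<in> seen {n}" "v \<in> vect {1..L}" for i j v
    proof -
      have "j \<in> pos" "j \<in> ?J"
        using that \<open>n \<in> S\<close> by (auto simp: seen_def)
      then show ?thesis
        using that by (auto simp: symbol_def \<sigma>_def B_def)
    qed
    then show ?thesis
      unfolding queried_def by (intro restrict_ext) auto
  qed
  ultimately show ?thesis
    unfolding bij_betw_def by blast
qed

section \<open>Decoding\<close>

lemma symbol_closed:
  assumes "f \<in> {1..m} \<rightarrow>\<^sub>E keys" "i \<in> {1..m}" "j \<in> pos" "v \<in> vect {1..L}"
  shows "symbol p f i j v \<in> carrier R"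
proof -
  have "f i v \<in> vect pos"
    using keys_vect[OF PiE_mem[OF assms(1,2)] assms(4)] .
  then show ?thesis
    using code_vect[of "f i v"] assms(3) by (auto simp: symbol_def intro: vectD)
qed

lemma symbol_comb:
  assumes f: "f \<in> {1..m} \<rightarrow>\<^sub>E keys" and i: "i \<in> {1..m}" and j: "j \<in> pos"
    and w: "w \<in> {1..K} \<rightarrow> vect {1..L}" and g: "g \<in> {1..K} \<rightarrow> carrier R"
  shows "symbol p f i j (comb {1..L} w g) = (\<Oplus>k\<in>{1..K}. symbol p f i j (w k) \<otimes> g k)"
proof -
  have fi: "f i \<in> keys" using f i by auto
  then have 1: "f i (comb {1..L} w g) = comb pos (\<lambda>k. f i (w k)) g"
    using w g by (auto simp: keys_def)
  moreover have "code (comb pos (\<lambda>k. f i (w k)) g) = comb pos (\<lambda>k. code (f i (w k))) g"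
    using w g keys_vect[OF fi] by (intro code_comb) auto
  ultimately show ?thesis
    using j by (auto simp: symbol_def comb_def)
qed

lemma column_vect: "w \<in> {1..L} \<times> {1..K} \<rightarrow>\<^sub>E carrier R \<Longrightarrow> k \<in> {1..K} \<Longrightarrow> column w k \<in> vect {1..L}"
  by (auto simp: column_def vect_def PiE_iff)

lemma store_comb:
  assumes "i \<in> {1..m}" "w i \<in> {1..L} \<times> {1..K} \<rightarrow>\<^sub>E carrier R" "n \<in> {1..N}"
  shows "store n w i = comb {1..L} (column (w i)) (\<lambda>k. gen k n)"
proof -
  have "gen k n \<in> carrier R" if "k \<in> {1..K}" for k
    using mds assms(3) that by (auto simp: mds_generator_def)
  then show ?thesis
    using assms unfolding store_def comb_def
    by (auto intro!: restrict_ext finsum_cong' simp: column_def PiE_iff)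
qed

text \<open>Correctness as injectivity: for fixed \<open>f\<close>, files with equal replies agree
  on \<open>p\<close>. The unknowns are the symbols \<open>E i j k\<close> of the single columns of
  each file, which the servers hold only in combination.\<close>

lemma decodable:
  assumes f: "f \<in> {1..m} \<rightarrow>\<^sub>E keys" and p: "p \<subseteq> {1..m}" "card p = P"
    and w: "\<And>i. i \<in> {1..m} \<Longrightarrow> w i \<in> {1..L} \<times> {1..K} \<rightarrow>\<^sub>E carrier R"
    and w': "\<And>i. i \<in> {1..m} \<Longrightarrow> w' i \<in> {1..L} \<times> {1..K} \<rightarrow>\<^sub>E carrier R"
    and eq: "\<And>n. n \<in> {1..N} \<Longrightarrow>
      reply n (queried p n f) (store n w) = reply n (queried p n f) (store n w')"
    and i: "i \<in> p"
  shows "w i = w' i"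
proof -
  define E where "E i j k = symbol p f i j (column (w i) k)" for i j k
  define E' where "E' i j k = symbol p f i j (column (w' i) k)" for i j k
  have Ec: "E i j k \<in> carrier R" "E' i j k \<in> carrier R" if "i \<in> {1..m}" "j \<in> pos" "k \<in> {1..K}" for i j k
    unfolding E_def E'_def
    by (intro symbol_closed[OF f that(1,2)] column_vect[OF w[OF that(1)] that(3)] column_vect[OF w'[OF that(1)] that(3)])+
  have genc: "gen k n \<in> carrier R" if "k \<in> {1..K}" "n \<in> {1..N}" for k n
    using mds that by (auto simp: mds_generator_def)
  have xc: "x i [^] (e::nat) \<in> carrier R" if "i \<in> {1..m}" for i e
    using x that by auto
  have reply_eq: "reply n (queried p n f) (store n v) (j, e) =
      (\<Oplus>k\<in>{1..K}. (\<Oplus>i\<in>{1..m}. symbol p f i j (column (v i) k) \<otimes> x i [^] e) \<otimes> gen k n)"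
    if v: "v \<in> {1..m} \<rightarrow> ({1..L} \<times> {1..K} \<rightarrow>\<^sub>E carrier R)"
      and n: "n \<in> {1..N}" and j: "j \<in> seen {n}" and e: "(j, e) \<in> coords n" for v n j e
  proof -
    have jp: "j \<in> pos" using j by (auto simp: seen_def)
    have gn: "(\<lambda>k. gen k n) \<in> {1..K} \<rightarrow> carrier R" using genc[OF _ n] by auto
    have sc: "symbol p f i j (column (v i) k) \<in> carrier R" if "i \<in> {1..m}" "k \<in> {1..K}" for i k
      by (rule symbol_closed[OF f that(1) jp column_vect[OF funcset_mem[OF v that(1)] that(2)]])
    have "reply n (queried p n f) (store n v) (j, e) =
        (\<Oplus>i\<in>{1..m}. x i [^] e \<otimes> (\<Oplus>k\<in>{1..K}. symbol p f i j (column (v i) k) \<otimes> gen k n))"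
    proof -
      have "queried p n f i j (store n v i) \<otimes> x i [^] e =
          x i [^] e \<otimes> (\<Oplus>k\<in>{1..K}. symbol p f i j (column (v i) k) \<otimes> gen k n)" if i: "i \<in> {1..m}" for i
      proof -
        have cols: "column (v i) \<in> {1..K} \<rightarrow> vect {1..L}"
          using funcset_mem[OF v i] by (auto intro: column_vect)
        have "queried p n f i j (store n v i) = symbol p f i j (store n v i)"
          using comb_vect[OF cols gn] i j by (simp add: queried_def store_comb[where w=v, OF i funcset_mem[OF v i] n])
        also have "\<dots> = (\<Oplus>k\<in>{1..K}. symbol p f i j (column (v i) k) \<otimes> gen k n)"
          unfolding store_comb[where w=v, OF i funcset_mem[OF v i] n] by (rule symbol_comb[OF f i jp cols gn])
        finally show ?thesis
          using sc[OF i] genc[OF _ n] xc[OF i] by (auto intro!: m_comm finsum_closed)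
      qed
      then show ?thesis
        using e sc genc[OF _ n] xc
        by (auto simp: reply_def intro!: finsum_cong' finsum_closed m_closed)
    qed
    also have "\<dots> = (\<Oplus>k\<in>{1..K}. (\<Oplus>i\<in>{1..m}. x i [^] e \<otimes> symbol p f i j (column (v i) k)) \<otimes> gen k n)"
      using sc genc[OF _ n] xc by (intro finsum_bilinear_swap) auto
    also have "\<dots> = (\<Oplus>k\<in>{1..K}. (\<Oplus>i\<in>{1..m}. symbol p f i j (column (v i) k) \<otimes> x i [^] e) \<otimes> gen k n)"
    proof -
      have "(\<Oplus>i\<in>{1..m}. x i [^] e \<otimes> symbol p f i j (column (v i) k)) =
          (\<Oplus>i\<in>{1..m}. symbol p f i j (column (v i) k) \<otimes> x i [^] e)" if "k \<in> {1..K}" for k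
        using sc[OF _ that] xc by (intro finsum_cong') (auto intro!: m_comm)
      moreover have "(\<Oplus>i\<in>{1..m}. symbol p f i j (column (v i) k) \<otimes> x i [^] e) \<in> carrier R"
        if "k \<in> {1..K}" for k
        using sc[OF _ that] xc by (intro finsum_closed) auto
      ultimately show ?thesis
        using genc[OF _ n] by (intro finsum_cong') auto
    qed
    finally show ?thesis .
  qed
  have w_Pi: "w \<in> {1..m} \<rightarrow> ({1..L} \<times> {1..K} \<rightarrow>\<^sub>E carrier R)"
    and w'_Pi: "w' \<in> {1..m} \<rightarrow> ({1..L} \<times> {1..K} \<rightarrow>\<^sub>E carrier R)"
    using w w' by blast+
  \<comment> \<open>The \<open>K\<close> servers of the subset \<open>fst j\<close> return a row of
    \<open>K\<close> unknowns, one for each \<open>k\<close>, times their columns of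
    \<open>gen\<close>; by the MDS property this fixes the unknowns.\<close>
  have sums: "(\<Oplus>i\<in>{1..m}. E i j k \<otimes> x i [^] e) = (\<Oplus>i\<in>{1..m}. E' i j k \<otimes> x i [^] e)"
    if j: "j \<in> pos" and e: "e < (if snd j < \<rho> then m else P)" and k: "k \<in> {1..K}" for j e k
  proof -
    have D: "fst j \<subseteq> {1..N}" "card (fst j) = K"
      using j by (auto simp: pos_def positions_def)
    show ?thesis
    proof (rule indep_rows_eqD[OF mds_generator_indep_rows[OF finite_carrier mds D] _ _ _ _ k])
      fix n assume n: "n \<in> fst j"
      have nN: "n \<in> {1..N}" using n D by auto
      have js: "j \<in> seen {n}" using n j by (auto simp: seen_def)
      have je: "(j, e) \<in> coords n" using js e by (auto simp: coords_def)
      show "(\<Oplus>k\<in>{1..K}. (\<Oplus>i\<in>{1..m}. E i j k \<otimes> x i [^] e) \<otimes> gen k n) =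
          (\<Oplus>k\<in>{1..K}. (\<Oplus>i\<in>{1..m}. E' i j k \<otimes> x i [^] e) \<otimes> gen k n)"
        using reply_eq[OF w_Pi nN js je] reply_eq[OF w'_Pi nN js je] eq[OF nN]
        unfolding E_def E'_def by simp
    qed (use Ec[OF _ j] xc genc D in \<open>auto intro!: finsum_closed m_closed\<close>)
  qed
  \<comment> \<open>In the first stage all \<open>m\<close> exponents are available, which gives a
    square Vandermonde system in the files.\<close>
  have stage1: "E i j k = E' i j k" if i: "i \<in> {1..m}" and j: "j \<in> info" and k: "k \<in> {1..K}" for i j k
  proof -
    have jp: "j \<in> pos" and jr: "snd j < \<rho>"
      using j info_subset by (auto simp: info_def positions_def \<rho>_def)
    have rows: "indep_rows (\<lambda>i e. x i [^] e) {1..m} {..<m}"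
      using vandermonde_indep_rows[of "{1..m}" x "\<lambda>e. e" "{..<m}"] x by simp
    show ?thesis
      by (rule indep_rows_eqD[OF rows _ _ _ _ i]) (use sums[OF jp _ k] jr Ec[OF _ jp k] xc in auto)
  qed
  \<comment> \<open>The positions in \<open>info\<close> are as many as the dimension of the code,
    so the symbols found there fix the whole codeword.\<close>
  have undesired: "E i j k = E' i j k"
    if i: "i \<in> {1..m}" "i \<notin> p" and j: "j \<in> pos" and k: "k \<in> {1..K}" for i j k
  proof -
    let ?u = "f i (column (w i) k)" and ?v = "f i (column (w' i) k)"
    have uv: "?u \<in> vect pos" "?v \<in> vect pos"
      using keys_vect[OF PiE_mem[OF f i(1)]] column_vect[OF w[OF i(1)] k] column_vect[OF w'[OF i(1)] k] by simp_all
    have "code ?u t = code ?v t" if "t \<in> info" for t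
      using stage1[OF i(1) that k] i(2) by (simp add: E_def E'_def symbol_def)
    then have "code ?u = code ?v"
      by (intro code_eqI uv code_inj[OF info_subset refl uv])
    then show ?thesis
      using i(2) by (simp add: E_def E'_def symbol_def)
  qed
  have finp: "finite p" using p(1) finite_subset by blast
  \<comment> \<open>Once the known undesired part is cancelled, \<open>P\<close> unknowns satisfy
    \<open>P\<close> Vandermonde equations.\<close>
  have desired: "E i j k = E' i j k" if i: "i \<in> p" and j: "j \<in> pos" and k: "k \<in> {1..K}" for i j k
  proof -
    have xp: "x \<in> p \<rightarrow> carrier R" "inj_on x p"
      using x p by (auto intro: inj_on_subset)
    have rows: "indep_rows (\<lambda>i e. x i [^] e) p {..<P}"
      using vandermonde_indep_rows[of p x "\<lambda>e. e" "{..<P}"] xp p finp by simp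
    have split: "(\<Oplus>i\<in>{1..m}. F i \<otimes> x i [^] e) =
        (\<Oplus>i\<in>p. F i \<otimes> x i [^] e) \<oplus> (\<Oplus>i\<in>{1..m} - p. F i \<otimes> x i [^] e)"
      if "\<And>i. i \<in> {1..m} \<Longrightarrow> F i \<in> carrier R" for F and e :: nat
    proof -
      have Un: "p \<union> ({1..m} - p) = {1..m}" using p by auto
      have "(\<lambda>i. F i \<otimes> x i [^] e) \<in> p \<rightarrow> carrier R"
        "(\<lambda>i. F i \<otimes> x i [^] e) \<in> ({1..m} - p) \<rightarrow> carrier R"
        using that xc p by (blast intro: m_closed)+
      from finsum_Un_disjoint[OF finp _ _ this] show ?thesis
        unfolding Un by simp
    qed
    show ?thesis
    proof (rule indep_rows_eqD[OF rows _ _ _ _ i])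
      fix e assume e: "e \<in> {..<P}"
      have "(\<Oplus>i\<in>{1..m}. E i j k \<otimes> x i [^] e) = (\<Oplus>i\<in>{1..m}. E' i j k \<otimes> x i [^] e)"
        using e Pm by (intro sums[OF j _ k]) auto
      moreover have "(\<Oplus>i\<in>{1..m} - p. E i j k \<otimes> x i [^] e) = (\<Oplus>i\<in>{1..m} - p. E' i j k \<otimes> x i [^] e)"
        using undesired[OF _ _ j k] Ec[OF _ j k] xc by (intro finsum_cong') auto
      moreover have "(\<Oplus>i\<in>p. E i j k \<otimes> x i [^] e) \<in> carrier R" "(\<Oplus>i\<in>p. E' i j k \<otimes> x i [^] e) \<in> carrier R"
        "(\<Oplus>i\<in>{1..m} - p. E' i j k \<otimes> x i [^] e) \<in> carrier R"
        using Ec[OF _ j k] xc p by (auto intro!: finsum_closed m_closed)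
      ultimately show "(\<Oplus>i\<in>p. E i j k \<otimes> x i [^] e) = (\<Oplus>i\<in>p. E' i j k \<otimes> x i [^] e)"
        using split[of "\<lambda>i. E i j k" e] split[of "\<lambda>i. E' i j k" e] Ec[OF _ j k]
        by (simp add: add.right_cancel)
    qed (use Ec[OF _ j k] xc p in auto)
  qed
  have im: "i \<in> {1..m}" using i p by auto
  have fi: "f i \<in> keys" using f im by auto
  have col: "column (w i) k = column (w' i) k" if k: "k \<in> {1..K}" for k
  proof -
    have c: "column (w i) k \<in> vect {1..L}" "column (w' i) k \<in> vect {1..L}"
      using column_vect[OF w[OF im] k] column_vect[OF w'[OF im] k] by simp_all
    have "f i (column (w i) k) = f i (column (w' i) k)"
    proof (rule vect_eqI[OF keys_vect[OF fi c(1)] keys_vect[OF fi c(2)]])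
      fix j assume "j \<in> pos"
      then show "f i (column (w i) k) j = f i (column (w' i) k) j"
        using desired[OF i _ k, of j] i by (simp add: E_def E'_def symbol_def)
    qed
    then show ?thesis
      using fi c unfolding keys_def inj_on_def by blast
  qed
  show ?thesis
  proof (rule PiE_ext[OF w[OF im] w'[OF im]])
    fix lk assume "lk \<in> {1..L} \<times> {1..K}"
    then show "w i lk = w' i lk"
      using fun_cong[OF col[of "snd lk"], of "fst lk"] by (cases lk) (auto simp: column_def)
  qed
qed

end

section \<open>Uniform independent sources\<close>

text \<open>One product formula over all boxes expresses both that the coordinates are independent
  and that each is uniform on \<open>{..<c i}\<close>. The sets \<open>Y i\<close> are arbitrary
  because every set of sample points will be an event.\<close>

definition uniform_coordinates ::
    "'w measure \<Rightarrow> ('i \<Rightarrow> 'w \<Rightarrow> nat) \<Rightarrow> 'i set \<Rightarrow> ('i \<Rightarrow> nat) \<Rightarrow> bool" where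
  "uniform_coordinates M X I c \<longleftrightarrow>
     (\<forall>Y. measure M {\<omega> \<in> space M. \<forall>i\<in>I. X i \<omega> \<in> Y i} =
       (\<Prod>i\<in>I. real (card (Y i \<inter> {..<c i})) / real (c i)))"

text \<open>The uniform measure on the finite product of the ranges, transported to an initial
  segment of the naturals, since the sample space has to have type \<open>nat\<close>.\<close>

lemma ex_uniform_coordinates:
  fixes c :: "'i \<Rightarrow> nat"
  assumes "finite I" "\<And>i. i \<in> I \<Longrightarrow> c i > 0"
  shows "\<exists>(M :: nat measure) X. prob_space M \<and> finite (space M) \<and> sets M = Pow (space M) \<and>
    (\<forall>i\<in>I. \<forall>\<omega>\<in>space M. X i \<omega> < c i) \<and> uniform_coordinates M X I c"
proof -
  define V where "V = (\<Pi>\<^sub>E i\<in>I. {..<c i})"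
  have finV: "finite V"
    unfolding V_def using assms(1) by (auto intro: finite_PiE)
  have "(\<lambda>i\<in>I. 0) \<in> V"
    unfolding V_def using assms(2) by auto
  then have neV: "V \<noteq> {}" by auto
  obtain e where e: "bij_betw e {0..<card V} V"
    using ex_bij_betw_nat_finite[OF finV] by auto
  define M where "M = uniform_count_measure {0..<card V}"
  define X where "X i \<omega> = e \<omega> i" for i \<omega>
  have sp: "space M = {0..<card V}"
    by (simp add: M_def space_uniform_count_measure)
  have eV: "e \<omega> \<in> V" if "\<omega> \<in> space M" for \<omega>
    using e that by (auto simp: sp bij_betw_def)
  have cardV: "real (card V) = (\<Prod>i\<in>I. real (c i))"
    unfolding V_def using assms(1) by (simp add: card_PiE)
  have "measure M {\<omega> \<in> space M. \<forall>i\<in>I. X i \<omega> \<in> Y i} =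
      (\<Prod>i\<in>I. real (card (Y i \<inter> {..<c i})) / real (c i))" for Y
  proof -
    let ?B = "{\<omega> \<in> space M. \<forall>i\<in>I. X i \<omega> \<in> Y i}"
    have img: "e ` ?B = (\<Pi>\<^sub>E i\<in>I. Y i \<inter> {..<c i})"
    proof (intro equalityI subsetI)
      fix v assume "v \<in> e ` ?B"
      then show "v \<in> (\<Pi>\<^sub>E i\<in>I. Y i \<inter> {..<c i})"
        using eV by (auto simp: X_def V_def PiE_iff)
    next
      fix v assume v: "v \<in> (\<Pi>\<^sub>E i\<in>I. Y i \<inter> {..<c i})"
      then have "v \<in> V" by (auto simp: V_def PiE_iff)
      then have "v \<in> e ` space M"
        using e by (simp add: sp bij_betw_def)
      then obtain \<omega> where "\<omega> \<in> space M" "v = e \<omega>"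
        by blast
      then show "v \<in> e ` ?B"
        using v by (auto simp: X_def PiE_iff)
    qed
    have "inj_on e (space M)"
      using e by (simp add: sp bij_betw_def)
    then have "inj_on e ?B"
      by (rule inj_on_subset) auto
    from card_image[OF this] have "card ?B = card (\<Pi>\<^sub>E i\<in>I. Y i \<inter> {..<c i})"
      unfolding img by simp
    then have "real (card ?B) = (\<Prod>i\<in>I. real (card (Y i \<inter> {..<c i})))"
      using assms(1) by (simp add: card_PiE)
    moreover have "measure M ?B = real (card ?B) / real (card V)"
      unfolding M_def using sp by (subst measure_uniform_count_measure) (auto simp: M_def)
    ultimately show ?thesis
      by (simp add: cardV prod_dividef)
  qed
  moreover have "prob_space M"
    unfolding M_def using finV neV by (intro prob_space_uniform_count_measure) (auto simp: card_gt_0_iff)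
  moreover have "X i \<omega> < c i" if "i \<in> I" "\<omega> \<in> space M" for i \<omega>
    using eV[OF that(2)] that(1) by (auto simp: X_def V_def)
  moreover have "sets M = Pow (space M)"
    by (simp add: M_def sets_uniform_count_measure space_uniform_count_measure)
  ultimately show ?thesis
    using sp unfolding uniform_coordinates_def by (intro exI[of _ M] exI[of _ X]) auto
qed

lemma uniform_coordinates_marginal:
  assumes "uniform_coordinates M X I c" "finite I" "i \<in> I" "\<And>i. i \<in> I \<Longrightarrow> c i > 0"
  shows "measure M (X i -` Y \<inter> space M) = real (card (Y \<inter> {..<c i})) / real (c i)"
proof -
  let ?Y = "\<lambda>j. if j = i then Y else UNIV"
  have "X i -` Y \<inter> space M = {\<omega> \<in> space M. \<forall>j\<in>I. X j \<omega> \<in> ?Y j}"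
    using assms(3) by auto
  also have "measure M \<dots> = (\<Prod>j\<in>I. real (card (?Y j \<inter> {..<c j})) / real (c j))"
    using assms(1)[unfolded uniform_coordinates_def, rule_format, of ?Y] .
  also have "\<dots> = (\<Prod>j\<in>I. if j = i then real (card (Y \<inter> {..<c i})) / real (c i) else 1)"
  proof (intro prod.cong refl)
    fix j assume "j \<in> I"
    from assms(4)[OF this] show "real (card (?Y j \<inter> {..<c j})) / real (c j) =
        (if j = i then real (card (Y \<inter> {..<c i})) / real (c i) else 1)"
      by simp
  qed
  also have "\<dots> = real (card (Y \<inter> {..<c i})) / real (c i)"
    using assms(2,3) by (subst prod.delta) auto
  finally show ?thesis .
qed

lemma (in prob_space) uniform_coordinates_indep:
  assumes X: "uniform_coordinates M X I c" and I: "finite I" "I \<noteq> {}" and c: "\<And>i. i \<in> I \<Longrightarrow> c i > 0"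
    and sets: "sets M = Pow (space M)"
  shows "indep_sets (\<lambda>i. {X i -` Y \<inter> space M | Y. True}) I"
proof -
  let ?F = "\<lambda>i. {X i -` Y \<inter> space M | Y. True}"
  have "prob (\<Inter>i\<in>I. B i) = (\<Prod>i\<in>I. prob (B i))" if B: "B \<in> Pi I ?F" for B
  proof -
    have "\<forall>i\<in>I. \<exists>Y. B i = X i -` Y \<inter> space M" using B by auto
    then obtain Y where Y: "\<And>i. i \<in> I \<Longrightarrow> B i = X i -` Y i \<inter> space M" by metis
    have "(\<Inter>i\<in>I. B i) = {\<omega> \<in> space M. \<forall>i\<in>I. X i \<omega> \<in> Y i}"
      using Y I(2) by auto
    also have "prob \<dots> = (\<Prod>i\<in>I. real (card (Y i \<inter> {..<c i})) / real (c i))"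
      using X unfolding uniform_coordinates_def by blast
    also have "\<dots> = (\<Prod>i\<in>I. prob (B i))"
      using uniform_coordinates_marginal[OF X I(1) _ c] Y by (intro prod.cong) auto
    finally show ?thesis .
  qed
  moreover have "space M \<in> ?F i" for i
    by (auto intro: exI[of _ UNIV])
  moreover have "?F i \<subseteq> events" for i
    using sets by auto
  ultimately show ?thesis
    using I by (subst indep_sets_finite) auto
qed

lemma uniform_coordinates_from_nat_into:
  assumes X: "uniform_coordinates M X I c" "finite I" "i \<in> I" "\<And>i. i \<in> I \<Longrightarrow> c i > 0"
    and S: "finite S" "c i = card S" "s \<in> S" and less: "\<And>\<omega>. \<omega> \<in> space M \<Longrightarrow> X i \<omega> < c i"
  shows "measure M ((\<lambda>\<omega>. from_nat_into S (X i \<omega>)) -` {s} \<inter> space M) = 1 / real (card S)"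
proof -
  let ?n = "to_nat_on S s"
  have bij: "bij_betw (from_nat_into S) {..<card S} S"
    using S(1) by (rule bij_betw_from_nat_into_finite)
  have n: "?n < card S"
    using to_nat_on_finite[OF S(1)] S(3) by (auto simp: bij_betw_def)
  have sn: "from_nat_into S ?n = s"
    using S by (simp add: countable_finite)
  have "from_nat_into S (X i \<omega>) = s \<longleftrightarrow> X i \<omega> = ?n" if "\<omega> \<in> space M" for \<omega>
    using less[OF that] S(2) n sn bij by (auto simp: bij_betw_def inj_on_def)
  then have "(\<lambda>\<omega>. from_nat_into S (X i \<omega>)) -` {s} \<inter> space M = X i -` {?n} \<inter> space M"
    by auto
  moreover have "{?n} \<inter> {..<c i} = {?n}" using n S(2) by auto
  ultimately show ?thesis
    using uniform_coordinates_marginal[OF X, of "{?n}"] S(2) by simp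
qed

text \<open>Adding \<open>v\<close> permutes the residues, so exactly one value of the pad leads to
  \<open>a\<close>.\<close>

lemma card_mod_shift:
  fixes q v a :: nat
  assumes "a < q"
  shows "card ({g. (v + g) mod q = a} \<inter> {..<q}) = 1"
proof -
  have inj: "inj_on (\<lambda>g. (v + g) mod q) {..<q}"
  proof (rule inj_onI)
    fix g g' assume g: "g \<in> {..<q}" "g' \<in> {..<q}" and "(v + g) mod q = (v + g') mod q"
    then have "[v + g = v + g'] (mod q)" by (simp add: cong_def)
    then have "[g = g'] (mod q)" by (simp add: cong_add_lcancel_nat)
    then show "g = g'" using g by (simp add: cong_less_modulus_unique_nat)
  qed
  moreover have "(\<lambda>g. (v + g) mod q) ` {..<q} \<subseteq> {..<q}"
    using assms by auto
  ultimately have "(\<lambda>g. (v + g) mod q) ` {..<q} = {..<q}"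
    by (intro endo_inj_surj) auto
  then obtain g where g: "g < q" "(v + g) mod q = a"
    using assms by (metis (no_types, lifting) imageE lessThan_iff)
  have "{g. (v + g) mod q = a} \<inter> {..<q} = {g}"
    using inj g by (auto simp: inj_on_def)
  then show ?thesis by simp
qed

section \<open>Privacy and padding over independent sources\<close>

context pir_sources
begin

lemma depends_on_mono: "depends_on X S \<Longrightarrow> S \<subseteq> S' \<Longrightarrow> depends_on X S'"
  unfolding depends_on_def by blast

text \<open>By total probability over the demand, a law shared by all \<open>Y p\<close> that occur
  is also the law at the random demand; together with the independence of the demand this gives the
  product formula.\<close>

lemma demand_private:
  assumes dep: "\<And>p. depends_on (Y p) ({User, Server} \<union> File ` {1..m})"
    and eq: "\<And>p x. p \<in> dem ` space M \<Longrightarrow> prob (Y p -` {x} \<inter> space M) = c x"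
    and simple: "simple_function M (\<lambda>\<omega>. Y (dem \<omega>) \<omega>)"
  shows "\<I>(dem ; \<lambda>\<omega>. Y (dem \<omega>) \<omega>) = 0"
proof -
  let ?Z = "\<lambda>\<omega>. Y (dem \<omega>) \<omega>"
  have joint: "prob ((\<lambda>\<omega>. (dem \<omega>, ?Z \<omega>)) -` {(p, x)} \<inter> space M) = prob (dem -` {p} \<inter> space M) * c x"
    for p x
  proof (cases "p \<in> dem ` space M")
    case True
    have "(\<lambda>\<omega>. (dem \<omega>, ?Z \<omega>)) -` {(p, x)} \<inter> space M =
        (dem -` {p} \<inter> space M) \<inter> (Y p -` {x} \<inter> space M)"
      by auto
    also have "prob \<dots> = prob (dem -` {p} \<inter> space M) * prob (Y p -` {x} \<inter> space M)"
    proof (rule depends_on_indep[OF _ _ _ _ dep])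
      show "depends_on dem {Demand}" by (rule depends_onI) simp
    qed auto
    finally show ?thesis
      using eq[OF True] by simp
  next
    case False
    then have "dem -` {p} \<inter> space M = {}" "(\<lambda>\<omega>. (dem \<omega>, ?Z \<omega>)) -` {(p, x)} \<inter> space M = {}"
      by auto
    then show ?thesis by (simp only: measure_empty mult_zero_left)
  qed
  have "prob (?Z -` {x} \<inter> space M) = c x" for x
  proof -
    have sf: "simple_function M (\<lambda>\<omega>. (dem \<omega>, ?Z \<omega>))"
      by (intro simple_function_Pair dem_simple simple)
    have "prob (?Z -` {x} \<inter> space M) = prob (\<Union>p\<in>dem ` space M. (\<lambda>\<omega>. (dem \<omega>, ?Z \<omega>)) -` {(p, x)} \<inter> space M)"
      by (rule arg_cong[where f=prob]) auto
    also have "\<dots> = (\<Sum>p\<in>dem ` space M. prob ((\<lambda>\<omega>. (dem \<omega>, ?Z \<omega>)) -` {(p, x)} \<inter> space M))"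
      using simple_functionD[OF dem_simple] simple_functionD[OF sf]
      by (intro finite_measure_finite_Union) (auto simp: disjoint_family_on_def)
    also have "\<dots> = (\<Sum>p\<in>dem ` space M. prob (dem -` {p} \<inter> space M)) * c x"
      unfolding joint by (simp add: sum_distrib_right)
    also have "\<dots> = c x"
      using sum_prob_simple[OF dem_simple] by simp
    finally show ?thesis .
  qed
  then show ?thesis
    unfolding mutual_information_eq_0_iff[OF dem_simple simple] using joint by simp
qed

lemma prob_split_user:
  assumes dep: "depends_on Z ({Server} \<union> File ` {1..m})"
  shows "prob ((\<lambda>\<omega>. G (usr \<omega>) (Z \<omega>)) -` {x} \<inter> space M) =
    (\<Sum>u\<in>usr ` space M. prob (usr -` {u} \<inter> space M) * prob ((\<lambda>\<omega>. G u (Z \<omega>)) -` {x} \<inter> space M))"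
proof -
  have depG: "depends_on (\<lambda>\<omega>. G u (Z \<omega>)) ({Server} \<union> File ` {1..m})" for u
    using dep unfolding depends_on_def by metis
  have sf: "simple_function M (\<lambda>\<omega>. G u (Z \<omega>))" for u
    by (rule depends_on_simple[OF depends_on_mono[OF depG]]) auto
  have "prob ((\<lambda>\<omega>. G (usr \<omega>) (Z \<omega>)) -` {x} \<inter> space M) =
      prob (\<Union>u\<in>usr ` space M. (usr -` {u} \<inter> space M) \<inter> ((\<lambda>\<omega>. G u (Z \<omega>)) -` {x} \<inter> space M))"
    by (rule arg_cong[where f=prob]) auto
  also have "\<dots> = (\<Sum>u\<in>usr ` space M. prob ((usr -` {u} \<inter> space M) \<inter> ((\<lambda>\<omega>. G u (Z \<omega>)) -` {x} \<inter> space M)))"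
    using simple_functionD[OF usr_simple'] simple_functionD(2)[OF sf]
    by (intro finite_measure_finite_Union) (auto simp: disjoint_family_on_def)
  also have "\<dots> = (\<Sum>u\<in>usr ` space M. prob (usr -` {u} \<inter> space M) * prob ((\<lambda>\<omega>. G u (Z \<omega>)) -` {x} \<inter> space M))"
  proof (rule sum.cong[OF refl], rule depends_on_indep[OF _ _ _ _ depG])
    show "depends_on usr {User}" by (rule depends_onI) simp
  qed auto
  finally show ?thesis .
qed

text \<open>The user's randomness is uniform, so permuting its values does not change any law. The
  permutation will be the one from \<open>queried_private\<close>.\<close>

lemma prob_user_permuted:
  assumes dep: "depends_on Z ({Server} \<union> File ` {1..m})"
    and unif: "\<And>u. u \<in> usr ` space M \<Longrightarrow> prob (usr -` {u} \<inter> space M) = c"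
    and bij: "bij_betw \<sigma> (usr ` space M) (usr ` space M)"
    and G: "\<And>u z. u \<in> usr ` space M \<Longrightarrow> G u z = G' (\<sigma> u) z"
  shows "prob ((\<lambda>\<omega>. G (usr \<omega>) (Z \<omega>)) -` {x} \<inter> space M) = prob ((\<lambda>\<omega>. G' (usr \<omega>) (Z \<omega>)) -` {x} \<inter> space M)"
proof -
  let ?U = "usr ` space M"
  have "prob ((\<lambda>\<omega>. G (usr \<omega>) (Z \<omega>)) -` {x} \<inter> space M) =
      (\<Sum>u\<in>?U. c * prob ((\<lambda>\<omega>. G' (\<sigma> u) (Z \<omega>)) -` {x} \<inter> space M))"
    unfolding prob_split_user[OF dep] by (rule sum.cong[OF refl]) (simp only: unif G)
  also have "\<dots> = (\<Sum>u\<in>?U. c * prob ((\<lambda>\<omega>. G' u (Z \<omega>)) -` {x} \<inter> space M))"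
    by (rule sum.reindex_bij_betw[OF bij])
  also have "\<dots> = prob ((\<lambda>\<omega>. G' (usr \<omega>) (Z \<omega>)) -` {x} \<inter> space M)"
    unfolding prob_split_user[OF dep, of G'] by (rule sum.cong[OF refl]) (simp only: unif)
  finally show ?thesis .
qed

text \<open>The pad is independent of \<open>h\<close>, so for each value of \<open>h\<close> the
  sum is uniform. This makes the rate independent of the law of the unpadded replies.\<close>

lemma entropy_padded:
  assumes dep: "depends_on h ({User} \<union> File ` {1..m})" and ds: "depends_on s {Server}" and q: "q > 0"
    and unif: "\<And>Y. prob (s -` Y \<inter> space M) = real (card (Y \<inter> {..<q})) / real q"
  shows "\<H>(\<lambda>\<omega>. (h \<omega> + s \<omega>) mod q) = log b (real q)"
proof (rule entropy_uniform_simple)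
  have sf: "simple_function M h"
    by (rule depends_on_simple[OF depends_on_mono[OF dep]]) auto
  have ss: "simple_function M s"
    by (rule depends_on_simple[OF depends_on_mono[OF ds]]) auto
  show sh: "simple_function M (\<lambda>\<omega>. (h \<omega> + s \<omega>) mod q)"
    by (rule simple_function_det[OF simple_function_Pair[OF sf ss]]) auto
  fix a assume "a \<in> (\<lambda>\<omega>. (h \<omega> + s \<omega>) mod q) ` space M"
  then have a: "a < q" using q by auto
  have dG: "depends_on (\<lambda>\<omega>. (v + s \<omega>) mod q) {Server}" for v
    using ds unfolding depends_on_def by metis
  have sv: "simple_function M (\<lambda>\<omega>. (v + s \<omega>) mod q)" for v
    by (rule simple_function_det[OF ss]) simp
  have "prob ((\<lambda>\<omega>. (h \<omega> + s \<omega>) mod q) -` {a} \<inter> space M) =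
      prob (\<Union>v\<in>h ` space M. (h -` {v} \<inter> space M) \<inter> ((\<lambda>\<omega>. (v + s \<omega>) mod q) -` {a} \<inter> space M))"
    by (rule arg_cong[where f=prob]) auto
  also have "\<dots> = (\<Sum>v\<in>h ` space M. prob ((h -` {v} \<inter> space M) \<inter> ((\<lambda>\<omega>. (v + s \<omega>) mod q) -` {a} \<inter> space M)))"
    using simple_functionD[OF sf] simple_functionD(2)[OF sv]
    by (intro finite_measure_finite_Union) (auto simp: disjoint_family_on_def)
  also have "\<dots> = (\<Sum>v\<in>h ` space M. prob (h -` {v} \<inter> space M) * (1 / real q))"
  proof (rule sum.cong[OF refl])
    fix v
    have "prob ((h -` {v} \<inter> space M) \<inter> ((\<lambda>\<omega>. (v + s \<omega>) mod q) -` {a} \<inter> space M)) =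
        prob (h -` {v} \<inter> space M) * prob ((\<lambda>\<omega>. (v + s \<omega>) mod q) -` {a} \<inter> space M)"
      by (rule depends_on_indep[OF _ _ _ dep dG]) auto
    also have "prob ((\<lambda>\<omega>. (v + s \<omega>) mod q) -` {a} \<inter> space M) = 1 / real q"
    proof -
      have eq: "(\<lambda>\<omega>. (v + s \<omega>) mod q) -` {a} \<inter> space M = s -` {g. (v + g) mod q = a} \<inter> space M"
        by auto
      show ?thesis
        unfolding eq unif card_mod_shift[OF a] by simp
    qed
    finally show "prob ((h -` {v} \<inter> space M) \<inter> ((\<lambda>\<omega>. (v + s \<omega>) mod q) -` {a} \<inter> space M)) =
        prob (h -` {v} \<inter> space M) * (1 / real q)" .
  qed
  also have "\<dots> = 1 / real q"
    by (simp only: sum_distrib_right[symmetric] sum_prob_simple[OF sf] mult_1_left)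
  finally show "prob ((\<lambda>\<omega>. (h \<omega> + s \<omega>) mod q) -` {a} \<inter> space M) = 1 / real q" .
qed (use q in simp)

end

section \<open>The scheme\<close>

context mds_pir_code
begin

definition users :: "(nat \<Rightarrow> (nat \<Rightarrow> 'a) \<Rightarrow> nat set \<times> nat \<Rightarrow> 'a) set" where
  "users = {1..m} \<rightarrow>\<^sub>E keys"

definition file_values :: "(nat \<times> nat \<Rightarrow> 'a) set" where
  "file_values = {1..L} \<times> {1..K} \<rightarrow>\<^sub>E carrier R"

definition demand_sets :: "nat set set" where
  "demand_sets = {p. p \<subseteq> {1..m} \<and> card p = P}"

definition requests :: "(nat \<Rightarrow> nat set \<times> nat \<Rightarrow> (nat \<Rightarrow> 'a) \<Rightarrow> 'a) set" where
  "requests = (\<lambda>(p, n, f). queried p n f) ` (Pow {1..m} \<times> {1..N} \<times> users)"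

definition replies :: "nat \<Rightarrow> ((nat set \<times> nat) \<times> nat \<Rightarrow> 'a) set" where
  "replies n = coords n \<rightarrow>\<^sub>E carrier R"

definition answer_size :: nat where
  "answer_size = ((N choose K) - ((N - 1) choose K)) * (\<rho> * m + (\<alpha> - \<rho>) * P)"

text \<open>Every server has the same number of possible replies, so one modulus and one pad serve
  all of them.\<close>

definition modulus :: nat where
  "modulus = card (carrier R) ^ answer_size"

text \<open>Queries are numbered because the alphabets of \<open>pir_achieves\<close> are
  \<open>nat\<close>. The numbering does not depend on the demand and so keeps the equalities
  between queries on which privacy rests.\<close>

definition query_code :: "nat set \<Rightarrow> nat \<Rightarrow> nat \<Rightarrow> nat" where
  "query_code p n u = to_nat_on requests (queried p n (from_nat_into users u))"

text \<open>The servers' randomness is a one-time pad known to the user: it makes every answer exactly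
  uniform.\<close>

definition answer_code :: "nat \<Rightarrow> nat \<Rightarrow> nat \<Rightarrow> (nat \<Rightarrow> nat \<Rightarrow> 'a) \<Rightarrow> nat" where
  "answer_code n c g y =
     (to_nat_on (replies n) (reply n (from_nat_into requests c) y) + g) mod modulus"

fun range_size :: "source \<Rightarrow> nat" where
  "range_size User = card users"
| "range_size Server = modulus"
| "range_size Demand = card demand_sets"
| "range_size (File i) = card file_values"

lemma finite_users: "finite users"
  unfolding users_def by (intro finite_PiE finite_keys) auto

lemma users_nonempty: "users \<noteq> {}"
  unfolding users_def using keys_nonempty by (simp add: PiE_eq_empty_iff)

lemma finite_file_values: "finite file_values"
  unfolding file_values_def using finite_carrier by (intro finite_PiE) auto

lemma file_values_nonempty: "file_values \<noteq> {}"
  unfolding file_values_def by (auto simp: PiE_eq_empty_iff)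

lemma finite_demand_sets: "finite demand_sets"
  by (rule finite_subset[of _ "Pow {1..m}"]) (auto simp: demand_sets_def)

lemma demand_sets_nonempty: "demand_sets \<noteq> {}"
  using obtain_subset_with_card_n[of P "{1..m}"] Pm by (auto simp: demand_sets_def)

lemma finite_requests: "finite requests"
  unfolding requests_def using finite_users by auto

lemma finite_replies: "finite (replies n)"
  unfolding replies_def using finite_carrier by (intro finite_PiE) auto

lemma card_replies: "n \<in> {1..N} \<Longrightarrow> card (replies n) = modulus"
  by (simp add: replies_def card_PiE card_coords modulus_def answer_size_def)

lemma card_carrier_gt_1: "card (carrier R) > 1"
proof -
  have "card {\<zero>, \<one>} \<le> card (carrier R)"
    using finite_carrier by (intro card_mono) auto
  then show ?thesis by simp
qed

lemma modulus_pos: "modulus > 0"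
  using card_carrier_gt_1 by (simp add: modulus_def)

lemma range_size_pos: "range_size s > 0"
  using finite_users users_nonempty finite_file_values file_values_nonempty finite_demand_sets
    demand_sets_nonempty modulus_pos
  by (cases s) (simp_all add: card_gt_0_iff)

lemma request_decode:
  assumes "p \<subseteq> {1..m}" "n \<in> {1..N}" "f \<in> users"
  shows "from_nat_into requests (to_nat_on requests (queried p n f)) = queried p n f"
proof (rule from_nat_into_to_nat_on)
  show "countable requests" using finite_requests by (rule countable_finite)
  show "queried p n f \<in> requests" 
    unfolding requests_def by (rule image_eqI[of _ _ "(p, n, f)"]) (use assms in auto)
qed

lemma reply_closed:
  assumes f: "f \<in> users" and n: "n \<in> {1..N}" and w: "w \<in> {1..m} \<rightarrow> file_values"
  shows "reply n (queried p n f) (store n w) \<in> replies n"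
proof -
  have st: "store n w i \<in> vect {1..L}" if "i \<in> {1..m}" for i
  proof -
    have wi: "w i \<in> {1..L} \<times> {1..K} \<rightarrow>\<^sub>E carrier R"
      using w that unfolding file_values_def by blast
    have "column (w i) \<in> {1..K} \<rightarrow> vect {1..L}"
      using column_vect[OF wi] by blast
    moreover have "(\<lambda>k. gen k n) \<in> {1..K} \<rightarrow> carrier R"
      using mds n unfolding mds_generator_def by blast
    ultimately show ?thesis
      unfolding store_comb[where w=w, OF that wi n] by (rule comb_vect)
  qed
  have f: "f \<in> {1..m} \<rightarrow>\<^sub>E keys" using f by (simp add: users_def)
  have "(\<Oplus>i\<in>{1..m}. queried p n f i j (store n w i) \<otimes> x i [^] e) \<in> carrier R"
    if j: "j \<in> seen {n}" for j and e :: nat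
  proof (rule finsum_closed, rule Pi_I, rule m_closed)
    fix i assume i: "i \<in> {1..m}"
    have "j \<in> pos" using j seen_subset by blast
    then show "queried p n f i j (store n w i) \<in> carrier R"
      using symbol_closed[OF f i _ st[OF i], of j p] i j st[OF i] by (simp add: queried_def)
    show "x i [^] e \<in> carrier R"
      using x(1) i by auto
  qed
  then show ?thesis
    unfolding replies_def reply_def coords_def by auto
qed

end

locale mds_pir_space = mds_pir_code +
  fixes \<Omega> :: "nat measure" and X :: "source \<Rightarrow> nat \<Rightarrow> nat"
  assumes prob_\<Omega>: "prob_space \<Omega>" and finite_\<Omega>: "finite (space \<Omega>)" and sets_\<Omega>: "sets \<Omega> = Pow (space \<Omega>)"
    and X_less: "\<And>s \<omega>. s \<in> {User, Server, Demand} \<union> File ` {1..m} \<Longrightarrow> \<omega> \<in> space \<Omega> \<Longrightarrow> X s \<omega> < range_size s"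
    and X_uniform: "uniform_coordinates \<Omega> X ({User, Server, Demand} \<union> File ` {1..m}) range_size"
begin

definition file_rv :: "nat \<Rightarrow> nat \<Rightarrow> nat \<times> nat \<Rightarrow> 'a" where
  "file_rv i \<omega> = from_nat_into file_values (X (File i) \<omega>)"

definition demand_rv :: "nat \<Rightarrow> nat set" where
  "demand_rv \<omega> = from_nat_into demand_sets (X Demand \<omega>)"

end

text \<open>Events of a decoded source are events of the number that it is decoded from, so
  independence is inherited.\<close>

lemma vimage_events_comp: "{(\<lambda>\<omega>. h (f \<omega>)) -` Y \<inter> A | Y. True} \<subseteq> {f -` Y \<inter> A | Y. True}"
proof
  fix B assume "B \<in> {(\<lambda>\<omega>. h (f \<omega>)) -` Y \<inter> A | Y. True}"
  then obtain Y where "B = (\<lambda>\<omega>. h (f \<omega>)) -` Y \<inter> A" by blast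
  then have "B = f -` (h -` Y) \<inter> A" by auto
  then show "B \<in> {f -` Y \<inter> A | Y. True}" by blast
qed

lemma simple_function_finite:
  assumes "finite (space M)" "sets M = Pow (space M)"
  shows "simple_function M f"
  using assms unfolding simple_function_def by auto

sublocale mds_pir_space \<subseteq> S: pir_sources R \<Omega> "real (card (carrier R))" N K T m P L gen
  file_rv "X User" "X Server" demand_rv query_code answer_code
proof -
  interpret prob_space \<Omega> by (rule prob_\<Omega>)
  interpret pm: pir_model R \<Omega> "real (card (carrier R))" N K T m P L gen
    file_rv "X User" "X Server" demand_rv query_code answer_code
    by unfold_locales (use card_carrier_gt_1 in simp)
  have indep: "indep_sets (\<lambda>s. {X s -` Y \<inter> space \<Omega> | Y. True}) ({User, Server, Demand} \<union> File ` {1..m})"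
    by (rule uniform_coordinates_indep[OF X_uniform _ _ range_size_pos sets_\<Omega>]) auto
  show "pir_sources R \<Omega> (real (card (carrier R))) m file_rv (X User) (X Server) demand_rv"
  proof
    show "indep_sets pm.source_events
      ({User, Server, Demand} \<union> File ` {1..m})"
    proof (rule indep_sets_mono_sets[OF indep])
      fix s
      show "pm.source_events s \<subseteq> {X s -` Y \<inter> space \<Omega> | Y. True}"
      proof (cases s)
        case Demand
        have "demand_rv = (\<lambda>\<omega>. from_nat_into demand_sets (X Demand \<omega>))"
          by (simp add: fun_eq_iff demand_rv_def)
        then show ?thesis
          unfolding Demand pm.source_events.simps by (simp only: vimage_events_comp)
      next
        case (File i)
        have "file_rv i = (\<lambda>\<omega>. from_nat_into file_values (X (File i) \<omega>))"
          by (simp add: fun_eq_iff file_rv_def)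
        then show ?thesis
          unfolding File pm.source_events.simps by (simp only: vimage_events_comp)
      qed (simp_all only: pm.source_events.simps order_refl)
    qed
  qed (rule simple_function_finite[OF finite_\<Omega> sets_\<Omega>])+
qed

lemma (in information_space) conditional_entropy_determined:
  assumes X: "simple_function M X" and Y: "simple_function M Y"
    and det: "\<And>\<omega> \<omega>'. \<omega> \<in> space M \<Longrightarrow> \<omega>' \<in> space M \<Longrightarrow> Y \<omega> = Y \<omega>' \<Longrightarrow> X \<omega> = X \<omega>'"
  shows "\<H>(X | Y) = 0"
proof -
  have "\<H>(\<lambda>\<omega>. (Y \<omega>, X \<omega>)) = \<H>(Y)"
    by (rule entropy_eqI[OF simple_function_Pair[OF Y X] Y]) (use det in blast)
  then show ?thesis
    using entropy_chain_rule[OF Y X] by simp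
qed

section \<open>Correctness, privacy and rate of the scheme\<close>

context mds_pir_space
begin

lemma simple [simp]: "simple_function \<Omega> f"
  using finite_\<Omega> sets_\<Omega> by (rule simple_function_finite)

lemma file_rv_values: "file_rv i \<omega> \<in> file_values"
  unfolding file_rv_def by (rule from_nat_into[OF file_values_nonempty])

lemma demand_rv_sets: "demand_rv \<omega> \<in> demand_sets"
  unfolding demand_rv_def by (rule from_nat_into[OF demand_sets_nonempty])

lemma user_key: "from_nat_into users u \<in> users"
  by (rule from_nat_into[OF users_nonempty])

lemma files_eq: "S.files = file_values"
  by (simp only: S.files_def file_values_def)

lemma demands_eq: "S.demands = demand_sets"
  by (simp only: S.demands_def demand_sets_def)

lemma stored_eq: "S.stored n \<omega> = store n (\<lambda>i. file_rv i \<omega>)"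
  by (simp only: S.stored_def store_def)

lemma finite_sources: "finite ({User, Server, Demand} \<union> File ` {1..m})"
  by simp

lemma marginal:
  "s \<in> {User, Server, Demand} \<union> File ` {1..m} \<Longrightarrow>
    S.prob (X s -` Y \<inter> space \<Omega>) = real (card (Y \<inter> {..<range_size s})) / real (range_size s)"
  by (rule uniform_coordinates_marginal[OF X_uniform finite_sources _ range_size_pos])

lemma prob_user: "u < card users \<Longrightarrow> S.prob (X User -` {u} \<inter> space \<Omega>) = 1 / real (card users)"
  using marginal[of User "{u}"] by simp

lemma user_range: "X User ` space \<Omega> = {..<card users}"
proof
  show "X User ` space \<Omega> \<subseteq> {..<card users}"
    using X_less[of User] by auto
  show "{..<card users} \<subseteq> X User ` space \<Omega>"
  proof
    fix u assume u: "u \<in> {..<card users}"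
    then have "S.prob (X User -` {u} \<inter> space \<Omega>) \<noteq> 0"
      using prob_user[of u] by simp
    then have "X User -` {u} \<inter> space \<Omega> \<noteq> {}"
      by (metis measure_empty)
    then show "u \<in> X User ` space \<Omega>" by auto
  qed
qed

lemma query_permuted:
  assumes "D \<subseteq> {1..N}" "card D = T" and p: "p \<subseteq> {1..m}"
  shows "\<exists>\<sigma>. bij_betw \<sigma> (X User ` space \<Omega>) (X User ` space \<Omega>) \<and>
    (\<forall>u\<in>X User ` space \<Omega>. \<forall>n\<in>D. query_code p n u = query_code {1..m} n (\<sigma> u))"
proof -
  obtain \<sigma> where \<sigma>: "bij_betw \<sigma> users users"
    and eq: "\<And>f n. f \<in> users \<Longrightarrow> n \<in> D \<Longrightarrow> queried p n f = queried {1..m} n (\<sigma> f)"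
    using queried_private[OF assms(1,2), of p] unfolding users_def by blast
  let ?\<sigma> = "to_nat_on users \<circ> (\<sigma> \<circ> from_nat_into users)"
  have "bij_betw ?\<sigma> {..<card users} {..<card users}"
    by (rule bij_betw_trans[OF bij_betw_trans[OF bij_betw_from_nat_into_finite[OF finite_users] \<sigma>]
          to_nat_on_finite[OF finite_users]])
  moreover have "query_code p n u = query_code {1..m} n (?\<sigma> u)" if "n \<in> D" for u n
  proof -
    have "\<sigma> (from_nat_into users u) \<in> users"
      using \<sigma> user_key by (auto simp: bij_betw_def)
    then show ?thesis
      using eq[OF user_key that] countable_finite[OF finite_users] by (simp add: query_code_def)
  qed
  ultimately show ?thesis
    unfolding user_range by blast
qed

text \<open>\<open>G\<close> stands for anything computed from the queries to \<open>D\<close>, the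
  pad and the files: a projection gives privacy of the queries, the servers' computation gives
  privacy of the answers.\<close>

lemma demand_hidden:
  assumes D: "D \<subseteq> {1..N}" "card D = T"
  shows "S.mutual_information_Pow demand_rv
    (\<lambda>\<omega>. G (\<lambda>n\<in>D. query_code (demand_rv \<omega>) n (X User \<omega>)) (X Server \<omega>, \<lambda>i\<in>{1..m}. file_rv i \<omega>)) = 0"
proof -
  let ?Z = "\<lambda>\<omega>. (X Server \<omega>, \<lambda>i\<in>{1..m}. file_rv i \<omega>)"
  let ?Y = "\<lambda>p \<omega>. G (\<lambda>n\<in>D. query_code p n (X User \<omega>)) (?Z \<omega>)"
  have Z_eq: "?Z \<omega> = ?Z \<omega>'"
    if "\<And>s. s \<in> {Server} \<union> File ` {1..m} \<Longrightarrow> S.agree s \<omega> \<omega>'" for \<omega> \<omega>'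
  proof -
    have "S.agree Server \<omega> \<omega>'" "\<And>i. i \<in> {1..m} \<Longrightarrow> S.agree (File i) \<omega> \<omega>'"
      by (rule that; simp)+
    then show ?thesis
      by (auto simp: restrict_eq_iff)
  qed
  have depZ: "S.depends_on ?Z ({Server} \<union> File ` {1..m})"
    by (rule S.depends_onI) (rule Z_eq)
  have "S.depends_on (?Y p) ({User, Server} \<union> File ` {1..m})" for p
  proof (rule S.depends_onI)
    fix \<omega> \<omega>' assume ag: "\<And>s. s \<in> {User, Server} \<union> File ` {1..m} \<Longrightarrow> S.agree s \<omega> \<omega>'"
    have "?Z \<omega> = ?Z \<omega>'"
      by (rule Z_eq) (rule ag, auto)
    moreover have "S.agree User \<omega> \<omega>'"
      by (rule ag) simp
    ultimately show "?Y p \<omega> = ?Y p \<omega>'"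
      by simp
  qed
  moreover have "S.prob (?Y p -` {v} \<inter> space \<Omega>) = S.prob (?Y {1..m} -` {v} \<inter> space \<Omega>)"
    if "p \<in> demand_rv ` space \<Omega>" for p v
  proof -
    have "p \<subseteq> {1..m}" using that demand_rv_sets by (auto simp: demand_sets_def)
    from query_permuted[OF D this] obtain \<sigma>
      where \<sigma>: "bij_betw \<sigma> (X User ` space \<Omega>) (X User ` space \<Omega>)"
        and eq: "\<And>u n. u \<in> X User ` space \<Omega> \<Longrightarrow> n \<in> D \<Longrightarrow> query_code p n u = query_code {1..m} n (\<sigma> u)"
      by blast
    show ?thesis
    proof (rule S.prob_user_permuted[OF depZ _ \<sigma>])
      show "S.prob (X User -` {u} \<inter> space \<Omega>) = 1 / real (card users)" if "u \<in> X User ` space \<Omega>" for u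
        using that prob_user unfolding user_range by simp
      show "G (\<lambda>n\<in>D. query_code p n u) z = G (\<lambda>n\<in>D. query_code {1..m} n (\<sigma> u)) z"
        if "u \<in> X User ` space \<Omega>" for u z
        using eq[OF that] by (simp cong: restrict_cong)
    qed
  qed
  ultimately show ?thesis
    by (rule S.demand_private[OF _ _ simple]) simp
qed

text \<open>The user knows the pad, and the numbers of the replies lie below the modulus, so
  subtracting the pad recovers the reply.\<close>

lemma reply_eqI:
  assumes n: "n \<in> {1..N}" and p: "p \<subseteq> {1..m}" and eq: "S.A p n \<omega> = S.A p n \<omega>'"
    and u: "X User \<omega> = X User \<omega>'" and g: "X Server \<omega> = X Server \<omega>'"
  defines "f \<equiv> from_nat_into users (X User \<omega>)"
  shows "reply n (queried p n f) (store n (\<lambda>i. file_rv i \<omega>)) = reply n (queried p n f) (store n (\<lambda>i. file_rv i \<omega>'))"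
proof -
  let ?r = "\<lambda>\<omega>. reply n (queried p n f) (store n (\<lambda>i. file_rv i \<omega>))"
  let ?e = "to_nat_on (replies n)"
  have f: "f \<in> users" unfolding f_def by (rule user_key)
  have A: "S.A p n \<nu> = (?e (?r \<nu>) + X Server \<nu>) mod modulus" if "X User \<nu> = X User \<omega>" for \<nu>
    using request_decode[OF p n f] that
    by (simp add: S.A_def S.Q_def answer_code_def query_code_def stored_eq f_def)
  have r: "?r \<nu> \<in> replies n" for \<nu>
    using file_rv_values by (intro reply_closed f n) auto
  have less: "?e (?r \<nu>) < modulus" for \<nu>
    using to_nat_on_finite[OF finite_replies[of n]] r card_replies[OF n] by (auto simp: bij_betw_def)
  have "[?e (?r \<omega>) + X Server \<omega> = ?e (?r \<omega>') + X Server \<omega>] (mod modulus)"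
    using eq A[of \<omega>] A[of \<omega>'] u g by (simp add: cong_def)
  then have "[?e (?r \<omega>) = ?e (?r \<omega>')] (mod modulus)"
    by (simp add: cong_add_rcancel_nat)
  then have "?e (?r \<omega>) = ?e (?r \<omega>')"
    using less by (simp add: cong_less_modulus_unique_nat)
  then show ?thesis
    using to_nat_on_inj[of "replies n"] r countable_finite[OF finite_replies] by auto
qed

lemma files_eqI:
  assumes p: "p \<in> demand_sets" and i: "i \<in> p"
    and eq: "\<And>n. n \<in> {1..N} \<Longrightarrow> S.A p n \<omega> = S.A p n \<omega>'"
    and u: "X User \<omega> = X User \<omega>'" and g: "X Server \<omega> = X Server \<omega>'"
  shows "file_rv i \<omega> = file_rv i \<omega>'"
proof (rule decodable[where p=p and w="\<lambda>i. file_rv i \<omega>" and w'="\<lambda>i. file_rv i \<omega>'" and f="from_nat_into users (X User \<omega>)"])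
  show "from_nat_into users (X User \<omega>) \<in> {1..m} \<rightarrow>\<^sub>E keys"
    using user_key by (simp add: users_def)
  show "p \<subseteq> {1..m}" "card p = P"
    using p by (auto simp: demand_sets_def)
  then show "reply n (queried p n (from_nat_into users (X User \<omega>))) (store n (\<lambda>i. file_rv i \<omega>)) =
      reply n (queried p n (from_nat_into users (X User \<omega>))) (store n (\<lambda>i. file_rv i \<omega>'))"
    if "n \<in> {1..N}" for n
    by (intro reply_eqI that eq u g)
qed (use file_rv_values i in \<open>auto simp: file_values_def\<close>)

lemma scheme:
  "pir_scheme R \<Omega> (real (card (carrier R))) N K T m P L gen file_rv (X User) (X Server) demand_rv
    query_code answer_code"
proof
  show "demand_rv \<in> \<Omega> \<rightarrow>\<^sub>M count_space S.demands"
    using demand_rv_sets sets_\<Omega> by (auto simp: measurable_def demands_eq)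
  show meas: "file_rv i \<in> \<Omega> \<rightarrow>\<^sub>M count_space S.files" for i
    using file_rv_values sets_\<Omega> by (auto simp: measurable_def files_eq)
  show "0 < S.prob {\<omega> \<in> space \<Omega>. demand_rv \<omega> = p}" if "p \<in> S.demands" for p
  proof -
    have "{\<omega> \<in> space \<Omega>. demand_rv \<omega> = p} =
        (\<lambda>\<omega>. from_nat_into demand_sets (X Demand \<omega>)) -` {p} \<inter> space \<Omega>"
      by (auto simp: demand_rv_def)
    also have "S.prob \<dots> = 1 / real (card demand_sets)"
      by (rule uniform_coordinates_from_nat_into[OF X_uniform finite_sources _ range_size_pos finite_demand_sets])
        (use that X_less[of Demand] in \<open>simp_all add: demands_eq\<close>)
    finally show ?thesis
      using finite_demand_sets demand_sets_nonempty by (simp add: card_gt_0_iff)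
  qed
  show "distr \<Omega> (count_space S.files) (file_rv i) = uniform_count_measure S.files" if i: "i \<in> {1..m}" for i
  proof (rule measure_eqI_finite[where A=file_values])
    fix w assume w: "w \<in> file_values"
    have "emeasure (distr \<Omega> (count_space S.files) (file_rv i)) {w} =
        ennreal (S.prob ((\<lambda>\<omega>. from_nat_into file_values (X (File i) \<omega>)) -` {w} \<inter> space \<Omega>))"
      using w by (subst emeasure_distr[OF meas]) (simp_all add: files_eq S.emeasure_eq_measure file_rv_def[abs_def])
    also have "S.prob ((\<lambda>\<omega>. from_nat_into file_values (X (File i) \<omega>)) -` {w} \<inter> space \<Omega>) =
        1 / real (card file_values)"
      by (rule uniform_coordinates_from_nat_into[OF X_uniform finite_sources _ range_size_pos finite_file_values])
        (use w i X_less[of "File i"] in simp_all)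
    also have "ennreal \<dots> = emeasure (uniform_count_measure S.files) {w}"
      using w finite_file_values by (simp add: files_eq emeasure_uniform_count_measure)
    finally show "emeasure (distr \<Omega> (count_space S.files) (file_rv i)) {w} =
        emeasure (uniform_count_measure S.files) {w}" .
  qed (simp_all add: files_eq sets_uniform_count_measure finite_file_values)
  show "S.mutual_information_Pow (\<lambda>\<omega>. \<lambda>n\<in>{1..N}. S.Q p n \<omega>) (\<lambda>\<omega>. \<lambda>i\<in>{1..m}. file_rv i \<omega>) = 0" for p
  proof (rule S.depends_on_entropy(1))
    show "S.depends_on (\<lambda>\<omega>. \<lambda>n\<in>{1..N}. S.Q p n \<omega>) {User}"
      by (rule S.depends_onI) (simp add: S.Q_def)
    show "S.depends_on (\<lambda>\<omega>. \<lambda>i\<in>{1..m}. file_rv i \<omega>) (File ` {1..m})"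
    proof (rule S.depends_onI)
      fix \<omega> \<omega>' assume ag: "\<And>s. s \<in> File ` {1..m} \<Longrightarrow> S.agree s \<omega> \<omega>'"
      have "S.agree (File i) \<omega> \<omega>'" if "i \<in> {1..m}" for i
        using that by (intro ag) simp
      then show "(\<lambda>i\<in>{1..m}. file_rv i \<omega>) = (\<lambda>i\<in>{1..m}. file_rv i \<omega>')"
        by (simp add: restrict_eq_iff)
    qed
  qed auto
  show "S.conditional_entropy_Pow (\<lambda>\<omega>. \<lambda>i\<in>p. file_rv i \<omega>)
      (\<lambda>\<omega>. (\<lambda>n\<in>{1..N}. S.Q p n \<omega>, \<lambda>n\<in>{1..N}. S.A p n \<omega>, X User \<omega>, X Server \<omega>)) = 0"
    if p: "p \<in> S.demands" for p
  proof (rule S.conditional_entropy_determined)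
    fix \<omega> \<omega>'
    assume eq: "(\<lambda>n\<in>{1..N}. S.Q p n \<omega>, \<lambda>n\<in>{1..N}. S.A p n \<omega>, X User \<omega>, X Server \<omega>) =
      (\<lambda>n\<in>{1..N}. S.Q p n \<omega>', \<lambda>n\<in>{1..N}. S.A p n \<omega>', X User \<omega>', X Server \<omega>')"
    have "file_rv i \<omega> = file_rv i \<omega>'" if "i \<in> p" for i
      by (rule files_eqI[of p]) (use eq that p in \<open>auto simp: demands_eq restrict_eq_iff\<close>)
    then show "(\<lambda>i\<in>p. file_rv i \<omega>) = (\<lambda>i\<in>p. file_rv i \<omega>')"
      by (simp add: restrict_eq_iff)
  qed simp_all
  show "S.mutual_information_Pow demand_rv (\<lambda>\<omega>. \<lambda>n\<in>D. S.Q (demand_rv \<omega>) n \<omega>) = 0"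
    if "D \<subseteq> {1..N}" "card D = T" for D
    using demand_hidden[OF that, of "\<lambda>q z. q"] by (simp only: S.Q_def)
  show "S.mutual_information_Pow demand_rv (\<lambda>\<omega>. \<lambda>n\<in>D. S.A (demand_rv \<omega>) n \<omega>) = 0"
    if D: "D \<subseteq> {1..N}" "card D = T" for D
  proof -
    let ?G = "\<lambda>q z. \<lambda>n\<in>D. answer_code n (q n) (fst z) (store n (snd z))"
    have "(\<lambda>\<omega>. \<lambda>n\<in>D. S.A (demand_rv \<omega>) n \<omega>) =
        (\<lambda>\<omega>. ?G (\<lambda>n\<in>D. query_code (demand_rv \<omega>) n (X User \<omega>)) (X Server \<omega>, \<lambda>i\<in>{1..m}. file_rv i \<omega>))"
      unfolding restrict_eq_iff fun_eq_iff
      by (auto simp: S.A_def S.Q_def stored_eq store_def intro!: arg_cong[where f="answer_code _ _ _"] cong: restrict_cong)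
    then show ?thesis
      using demand_hidden[OF D, of ?G] by (simp only:)
  qed
qed (rule simple S.sources_indep refl)+

lemma entropy_answer:
  assumes "n \<in> {1..N}"
  shows "S.entropy_Pow (S.A p n) = real answer_size"
proof -
  let ?h = "\<lambda>\<omega>. to_nat_on (replies n) (reply n (from_nat_into requests (query_code p n (X User \<omega>))) (S.stored n \<omega>))"
  have "S.entropy_Pow (\<lambda>\<omega>. (?h \<omega> + X Server \<omega>) mod modulus) = log (real (card (carrier R))) (real modulus)"
  proof (rule S.entropy_padded)
    show "S.depends_on ?h ({User} \<union> File ` {1..m})"
    proof (rule S.depends_onI)
      fix \<omega> \<omega>' assume ag: "\<And>s. s \<in> {User} \<union> File ` {1..m} \<Longrightarrow> S.agree s \<omega> \<omega>'"
      have "S.agree User \<omega> \<omega>'" "\<And>i. i \<in> {1..m} \<Longrightarrow> S.agree (File i) \<omega> \<omega>'"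
        by (rule ag; simp)+
      then show "?h \<omega> = ?h \<omega>'"
        using S.stored_cong[of \<omega> \<omega>' n] by simp
    qed
    show "S.depends_on (X Server) {Server}"
      by (rule S.depends_onI) simp
  qed (use marginal[of Server] modulus_pos in simp_all)
  also have "(\<lambda>\<omega>. (?h \<omega> + X Server \<omega>) mod modulus) = S.A p n"
    by (simp add: fun_eq_iff S.A_def S.Q_def answer_code_def)
  also have "log (real (card (carrier R))) (real modulus) = real answer_size"
    using card_carrier_gt_1 by (simp add: modulus_def log_nat_power)
  finally show ?thesis .
qed

text \<open>Counting pairs of a server and a subset containing it gives the factor
  \<open>K * (N choose K)\<close> in the total download; it cancels against \<open>K\<close> and one
  of the two binomial factors of \<open>L\<close>.\<close>

lemma rate_eq:
  assumes p: "p \<in> demand_sets" and "N \<ge> 1" "P \<ge> 1" "K \<le> N"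
  shows "S.rate p = real (N choose K) / (real m / real P * (real (N choose K) - real ((N - T) choose K))
    + real ((N - T) choose K))"
proof -
  interpret sch: pir_scheme R \<Omega> "real (card (carrier R))" N K T m P L gen file_rv "X User" "X Server"
    demand_rv query_code answer_code
    by (rule scheme)
  let ?a = "real (N choose K)" and ?b = "real ((N - T) choose K)"
  let ?d = "real ((N choose K) - ((N - 1) choose K))"
  have le: "(N - T) choose K \<le> N choose K"
    by (rule binomial_right_mono) simp
  have a: "?a > 0"
    using assms(4) by (simp add: zero_less_binomial)
  have "S.rate p = (\<Sum>i\<in>p. real L * real K) / (\<Sum>n\<in>{1..N}. real answer_size)"
    unfolding S.rate_def
    by (intro arg_cong2[where f="(/)"] sum.cong entropy_answer sch.entropy_file)
      (use p in \<open>auto simp: demand_sets_def\<close>)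
  also have "\<dots> = real P * (?a * ?a * real K) / (real N * real answer_size)"
    using p by (simp add: demand_sets_def L_def)
  also have "real N * real answer_size = (real N * ?d) * ((?a - ?b) * real m + ?b * real P)"
    using le by (simp add: answer_size_def \<alpha>_def \<rho>_def of_nat_diff)
  also have "real N * ?d = real K * ?a"
    using choose_diff_absorb[OF assms(2)] .
  also have "real P * (?a * ?a * real K) / (real K * ?a * ((?a - ?b) * real m + ?b * real P)) =
      real P * ?a / ((?a - ?b) * real m + ?b * real P)"
    using a K_pos by simp
  also have "\<dots> = ?a / (((?a - ?b) * real m + ?b * real P) / real P)"
    using assms(3) by simp
  also have "((?a - ?b) * real m + ?b * real P) / real P = real m / real P * (?a - ?b) + ?b"
    using assms(3) by (simp add: field_simps)
  finally show ?thesis .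
qed

end

text \<open>The size conditions provide distinct evaluation points: \<open>m\<close> of them for
  combining the files, and one for each of the \<open>L\<close> positions of the code.\<close>

lemma pir_achieves_mds:
  fixes R :: "'a ring" and gen :: "nat \<Rightarrow> nat \<Rightarrow> 'a"
  assumes "N \<ge> 1" "K \<ge> 1" "T \<ge> 1" "1 \<le> P" "P \<le> m" "T + K \<le> N"
    and R: "field R" "finite (carrier R)" "mds_generator R K N gen"
    and large: "(N choose K) * (N choose K) \<le> card (carrier R)" "m \<le> card (carrier R)"
  shows "pir_achieves R N K T m P gen ((N choose K) * (N choose K))
    (real (N choose K) / (real m / real P * (real (N choose K) - real ((N - T) choose K))
      + real ((N - T) choose K)))"
proof -
  let ?pos = "positions N K (N choose K)"
  let ?info = "positions N K ((N choose K) - ((N - T) choose K))"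
  obtain x where x: "x ` {1..m} \<subseteq> carrier R" "inj_on x {1..m}"
    using card_le_inj[of "{1..m}" "carrier R"] R(2) large(2) by auto
  obtain z where z: "z ` ?pos \<subseteq> carrier R" "inj_on z ?pos"
    using card_le_inj[of ?pos "carrier R"] R(2) large(1) by (auto simp: card_positions)
  obtain \<tau> where \<tau>: "bij_betw \<tau> ?info {..<card ?info}"
    using ex_bij_betw_finite_nat[of ?info] by (auto simp: atLeast0LessThan)
  have code: "mds_pir_code R N K T m P gen x z \<tau>"
    using assms x z \<tau> by (intro mds_pir_code.intro mds_pir_code_axioms.intro) auto
  interpret C: mds_pir_code R N K T m P gen x z \<tau> "N choose K" "(N choose K) - ((N - T) choose K)"
    "(N choose K) * (N choose K)" ?pos ?info
    by (rule code)
  obtain \<Omega> :: "nat measure" and X where \<Omega>: "prob_space \<Omega>" "finite (space \<Omega>)" "sets \<Omega> = Pow (space \<Omega>)"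
    "\<forall>s\<in>{User, Server, Demand} \<union> File ` {1..m}. \<forall>\<omega>\<in>space \<Omega>. X s \<omega> < C.range_size s"
    "uniform_coordinates \<Omega> X ({User, Server, Demand} \<union> File ` {1..m}) C.range_size"
    using ex_uniform_coordinates[of "{User, Server, Demand} \<union> File ` {1..m}" C.range_size] C.range_size_pos
    by auto
  interpret D: mds_pir_space R N K T m P gen x z \<tau> "N choose K" "(N choose K) - ((N - T) choose K)"
    "(N choose K) * (N choose K)" ?pos ?info \<Omega> X
    by (rule mds_pir_space.intro[OF code mds_pir_space_axioms.intro[OF \<Omega>(1-3) \<Omega>(4)[rule_format] \<Omega>(5)]])
  show ?thesis
    unfolding pir_achieves_def
  proof (intro exI conjI ballI)
    show "pir_scheme R \<Omega> (real (card (carrier R))) N K T m P ((N choose K) * (N choose K)) gen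
        D.file_rv (X User) (X Server) D.demand_rv C.query_code C.answer_code"
      by (rule D.scheme)
    fix p assume "p \<in> D.S.demands"
    then show "D.S.rate p = real (N choose K) /
        (real m / real P * (real (N choose K) - real ((N - T) choose K)) + real ((N - T) choose K))"
      using assms(1,4,6) by (intro D.rate_eq) (simp_all add: D.demands_eq)
  qed
qed

lemma pir_achieves_le:
  fixes R :: "'a ring"
  assumes ach: "pir_achieves R N K T m P gen L s" and L: "L \<ge> 1" and mds: "mds_generator R K N gen"
    and params: "N \<ge> 1" "K \<ge> 1" "T \<ge> 1" "1 \<le> P" "P \<le> m" "T + K \<le> N" "m \<le> 2 * P"
    and KT: "K = 1 \<or> T = 1"
  shows "s \<le> real (N choose K) / (real m / real P * (real (N choose K) - real ((N - T) choose K))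
    + real ((N - T) choose K))"
proof -
  obtain \<Omega> :: "nat measure" and W usr srv dem query answer where
    scheme: "pir_scheme R \<Omega> (real (card (carrier R))) N K T m P L gen W
      (usr :: nat \<Rightarrow> nat) (srv :: nat \<Rightarrow> nat) dem (query :: nat set \<Rightarrow> nat \<Rightarrow> nat \<Rightarrow> nat)
      (answer :: nat \<Rightarrow> nat \<Rightarrow> nat \<Rightarrow> (nat \<Rightarrow> nat \<Rightarrow> 'a) \<Rightarrow> nat)"
    and rate: "\<And>p. p \<in> pir_model.demands m P \<Longrightarrow>
      pir_model.rate R \<Omega> (real (card (carrier R))) N K m L gen W usr srv query answer p = s"
    using ach unfolding pir_achieves_def by blast
  interpret S: pir_scheme R \<Omega> "real (card (carrier R))" N K T m P L gen W usr srv dem query answer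
    by (rule scheme)
  \<comment> \<open>The first \<open>P\<close> and the last \<open>P\<close> files; they cover all
    files because \<open>m \<le> 2 * P\<close>.\<close>
  let ?p = "{1..P}" and ?p' = "{m - P + 1..m}"
  have p: "?p \<in> S.demands" "?p' \<in> S.demands" "?p \<union> ?p' = {1..m}"
    using params by (auto simp: S.demands_def)
  let ?D = "\<Sum>n\<in>{1..N}. S.entropy_Pow (S.A ?p n)"
  have D: "real L * real K * (real N * real P + real T * real K * (real m - real P)) \<le> real N * ?D"
    using KT params by (intro S.download_ge[OF mds params(1) p]) auto
  have s: "s = real P * (real L * real K) / ?D"
  proof -
    have "(\<Sum>i\<in>?p. S.entropy_Pow (W i)) = (\<Sum>i\<in>?p. real L * real K)"
      using params by (intro sum.cong S.entropy_file) auto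
    then show ?thesis
      using rate[OF p(1)] by (simp add: S.rate_def)
  qed
  let ?E = "real N * real P + real T * real K * (real m - real P)"
  have E: "?E > 0"
    using params by (intro add_pos_nonneg mult_pos_pos mult_nonneg_nonneg) auto
  have LK: "real L * real K > 0"
    using L params by simp
  \<comment> \<open>Rules out a zero denominator in the rate.\<close>
  have "0 < real N * ?D"
    using D mult_pos_pos[OF LK E] by linarith
  then have D_pos: "?D > 0"
    using params(1) by (simp add: zero_less_mult_iff)
  have "real P * (real L * real K) * ?E \<le> real P * (real N * ?D)"
    using mult_left_mono[OF D, of "real P"] by (simp add: algebra_simps)
  then have "s \<le> real P * real N / ?E"
    unfolding s using D_pos E by (simp add: divide_le_eq le_divide_eq mult_ac)
  also have "\<dots> = real (N choose K) / (real m / real P * (real (N choose K) - real ((N - T) choose K))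
      + real ((N - T) choose K))"
  proof -
    let ?a = "real (N choose K)" and ?b = "real ((N - T) choose K)"
    have a: "?a > 0"
      using params by (simp add: zero_less_binomial)
    \<comment> \<open>This identity is where the formula for the rate meets the bound on the
      download. It is special to the two cases: for \<open>K\<close> and \<open>T\<close> both equal
      to 2 the sides differ.\<close>
    have rel: "real N * (?a - ?b) = real T * real K * ?a"
      using KT
    proof
      assume "K = 1"
      then show ?thesis using params by (simp add: of_nat_diff)
    next
      assume T: "T = 1"
      have "(N - 1) choose K \<le> N choose K" by (rule binomial_right_mono) simp
      then show ?thesis
        using choose_diff_absorb[OF params(1), of K] by (simp add: T of_nat_diff)
    qed
    have "real N * (real m * (?a - ?b) + real P * ?b) = ?a * ?E"
    proof -
      have "real N * (real m * (?a - ?b) + real P * ?b) =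
          (real m - real P) * (real N * (?a - ?b)) + real N * real P * ?a"
        by (simp add: algebra_simps)
      then show ?thesis
        unfolding rel by (simp add: algebra_simps)
    qed
    moreover have "real m / real P * (?a - ?b) + ?b = (real m * (?a - ?b) + real P * ?b) / real P"
      using params by (simp add: field_simps)
    moreover have "real m * (?a - ?b) + real P * ?b = ?a * ?E / real N"
      using calculation(1) params by (simp add: field_simps)
    ultimately have "real m / real P * (?a - ?b) + ?b = ?a * ?E / real N / real P"
      by simp
    then show ?thesis
      using a E params by simp
  qed
  finally show ?thesis .
qed

theorem theorem4:
  fixes N K T M P :: nat
  assumes "N \<ge> 1" and "K \<ge> 1" and "T \<ge> 1"
    and "2 \<le> P" and "P \<le> M"
    and "T + K \<le> N"
    and "real P \<ge> real M / 2"
  shows "\<exists>q0 :: nat. \<forall>q\<ge>q0. primepow q \<longrightarrow>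
    (\<forall>(R :: 'a ring) (gen :: nat \<Rightarrow> nat \<Rightarrow> 'a).
       field R \<and> finite (carrier R) \<and> card (carrier R) = q \<and> mds_generator R K N gen \<longrightarrow>
       (let r = real (N choose K) /
                  (real M / real P * (real (N choose K) - real ((N - T) choose K))
                    + real ((N - T) choose K))
        in (\<exists>L\<ge>1. pir_achieves R N K T M P gen L r) \<and>
           (K = 1 \<or> T = 1 \<longrightarrow> pir_capacity R N K T M P gen = r)))"
proof (intro exI[of _ "max ((N choose K) * (N choose K)) M"] allI impI)
  fix q :: nat and R :: "'a ring" and gen :: "nat \<Rightarrow> nat \<Rightarrow> 'a"
  assume q: "max ((N choose K) * (N choose K)) M \<le> q"
    and R: "field R \<and> finite (carrier R) \<and> card (carrier R) = q \<and> mds_generator R K N gen"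
  define r where "r = real (N choose K) / (real M / real P * (real (N choose K) - real ((N - T) choose K))
    + real ((N - T) choose K))"
  have "pir_achieves R N K T M P gen ((N choose K) * (N choose K)) r"
    unfolding r_def using assms q R by (intro pir_achieves_mds) auto
  moreover have "(N choose K) * (N choose K) \<ge> 1"
    using assms(6) by (simp add: Suc_le_eq)
  ultimately have ach: "\<exists>L\<ge>1. pir_achieves R N K T M P gen L r"
    by blast
  have cap: "pir_capacity R N K T M P gen = r" if KT: "K = 1 \<or> T = 1"
    unfolding pir_capacity_def
  \<comment> \<open>The supremum is attained by the scheme, so it remains to see that no rate
    exceeds \<open>r\<close>.\<close>
  proof (rule cSup_eq_maximum)
    show "r \<in> {r. \<exists>L\<ge>1. pir_achieves R N K T M P gen L r}"
      using ach by simp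
    fix s assume "s \<in> {r. \<exists>L\<ge>1. pir_achieves R N K T M P gen L r}"
    then obtain L where L: "L \<ge> 1" "pir_achieves R N K T M P gen L s" by blast
    then show "s \<le> r"
      unfolding r_def using pir_achieves_le[OF L(2) L(1)] assms R KT by auto
  qed
  show "let r = real (N choose K) /
                  (real M / real P * (real (N choose K) - real ((N - T) choose K))
                    + real ((N - T) choose K))
        in (\<exists>L\<ge>1. pir_achieves R N K T M P gen L r) \<and>
           (K = 1 \<or> T = 1 \<longrightarrow> pir_capacity R N K T M P gen = r)"
    unfolding Let_def r_def[symmetric] using ach cap by blast
qed

end
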